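(* Let $s,t\in\mathbb{R}$ with $s<t$. Then the identity representation is a boundary representation of $\mathrm{Mult}(H_s,H_t)\subset B(H_s,H_t)$.
   Context: For $s\in\mathbb{R}$, $H_s$ is the Hilbert space of analytic functions $f(z)=\sum_{n\ge0}a_nz^n$ on the open unit disc $\mathbb{D}$ with $\|f\|_{H_s}^2=\sum_{n\ge0}|a_n|^2(n+1)^{-s}<\infty$; it is a reproducing kernel Hilbert space with kernel $k_s(z,w)=\sum_{n\ge0}(n+1)^s(z\overline{w})^n$. $\mathrm{Mult}(H_s,H_t)=\{\varphi:\mathbb{D}\to\mathbb{C}:\varphi f\in H_t\text{ for all }f\in H_s\}$, identified with a subspace of $B(H_s,H_t)$ via the (bounded) multiplication operators $M_\varphi f=\varphi f$. A TRO is a norm-closed subspace $T\subset B(H,K)$ with $xy^*z\in T$ for $x,y,z\in T$. A representation of $T$ is a linear map $\theta:T\to B(H_1,K_1)$ with $\theta(xy^*z)=\theta(x)\theta(y)^*\theta(z)$; it is irreducible if whenever projections $p\in B(H_1)$, $q\in B(K_1)$ satisfy $q\theta(x)=\theta(x)p$ for all $x\in T$, then $p=1,q=1$ or $p=0,q=0$. A linear map $\psi$ on a space $Y$ into $B(H_1,K_1)$ is nondegenerate if projections $p,q$ with $q\psi(x)=0=\psi(x)p$ for all $x\in Y$ must both be $0$; a rectangular operator state is a nondegenerate linear map with completely bounded norm $1$. For $M\subset B(H,K)$ generating the TRO $T\subset B(H,K)$ (the smallest TRO containing $M$), "the identity representation is a boundary representation of $M$" means that the inclusion $M\hookrightarrow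 B(H,K)$ is a rectangular operator state and every rectangular operator state $T\to B(H,K)$ extending it is an irreducible representation of $T$. *)

theory Defs
  imports "HOL-Complex_Analysis.Complex_Analysis" "HOL-Library.Function_Algebras"
    "HOL-Real_Asymp.Real_Asymp"
begin

section \<open>Complex vector spaces of functions\<close>

class complex_space = ab_group_add +
  fixes scaleC :: "complex \<Rightarrow> 'a \<Rightarrow> 'a" (infixr "*\<^sub>C" 75)
  assumes scaleC_add_right: "c *\<^sub>C (x + y) = c *\<^sub>C x + c *\<^sub>C y"
    and scaleC_add_left: "(c + d) *\<^sub>C x = c *\<^sub>C x + d *\<^sub>C x"
    and scaleC_scaleC: "c *\<^sub>C (d *\<^sub>C x) = (c * d) *\<^sub>C x"
    and scaleC_one: "1 *\<^sub>C x = x"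

global_interpretation complex_space:
  vector_space "scaleC :: complex \<Rightarrow> 'a \<Rightarrow> 'a::complex_space"
  defines csubspace = complex_space.subspace
  by unfold_locales
    (simp_all add: scaleC_add_right scaleC_add_left scaleC_scaleC scaleC_one)

instantiation complex :: complex_space
begin
definition scaleC_complex :: "complex \<Rightarrow> complex \<Rightarrow> complex"
  where "scaleC_complex c x = c * x"
instance by standard (simp_all add: scaleC_complex_def algebra_simps)
end

instantiation "fun" :: (type, complex_space) complex_space
begin
definition scaleC_fun :: "complex \<Rightarrow> ('a \<Rightarrow> 'b) \<Rightarrow> 'a \<Rightarrow> 'b"
  where "scaleC_fun c f = (\<lambda>x. c *\<^sub>C f x)"
instance
  by standard (simp_all add: scaleC_fun_def fun_eq_iff scaleC_add_right scaleC_add_left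
      scaleC_scaleC scaleC_one)
end


section \<open>Hilbert spaces and bounded operators\<close>

text \<open>
  A Hilbert space is a linear subspace of an ambient complex vector space together with an inner
  product, linear in its first argument.  The ambient type only supplies the vector
  space operations; two Hilbert spaces in the same type need not be related.
\<close>

record 'a hilb =
  hcarrier :: "'a set"
  hinner :: "'a \<Rightarrow> 'a \<Rightarrow> complex"

definition hnorm :: "('a, 'z) hilb_scheme \<Rightarrow> 'a \<Rightarrow> real" where
  "hnorm H f = sqrt (Re (hinner H f f))"

definition hilbert_space :: "'a::complex_space hilb \<Rightarrow> bool" where
  "hilbert_space H \<longleftrightarrow>
     csubspace (hcarrier H) \<and>
     (\<forall>f\<in>hcarrier H. \<forall>g\<in>hcarrier H. \<forall>h\<in>hcarrier H.
        hinner H (f + g) h = hinner H f h + hinner H g h) \<and>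
     (\<forall>c. \<forall>f\<in>hcarrier H. \<forall>g\<in>hcarrier H. hinner H (c *\<^sub>C f) g = c * hinner H f g) \<and>
     (\<forall>f\<in>hcarrier H. \<forall>g\<in>hcarrier H. hinner H g f = cnj (hinner H f g)) \<and>
     (\<forall>f\<in>hcarrier H. f \<noteq> 0 \<longrightarrow> Re (hinner H f f) > 0) \<and>
     (\<forall>X. (\<forall>n. X n \<in> hcarrier H) \<and>
          (\<forall>e>0. \<exists>N. \<forall>m\<ge>N. \<forall>n\<ge>N. hnorm H (X m - X n) < e) \<longrightarrow>
          (\<exists>f\<in>hcarrier H. (\<lambda>n. hnorm H (X n - f)) \<longlonglongrightarrow> 0))"

text \<open>
  Operators are HOL functions that vanish outside the carrier of their domain, so that equality of
  operators is equality of functions, and sums, scalar multiples and compositions of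
  operators are those of functions.
\<close>

definition bounded_ops :: "'a::complex_space hilb \<Rightarrow> 'b::complex_space hilb \<Rightarrow> ('a \<Rightarrow> 'b) set" where
  "bounded_ops H K = {x.
     (\<forall>f\<in>hcarrier H. x f \<in> hcarrier K) \<and>
     (\<forall>f. f \<notin> hcarrier H \<longrightarrow> x f = 0) \<and>
     (\<forall>f\<in>hcarrier H. \<forall>g\<in>hcarrier H. x (f + g) = x f + x g) \<and>
     (\<forall>c. \<forall>f\<in>hcarrier H. x (c *\<^sub>C f) = c *\<^sub>C x f) \<and>
     (\<exists>C. \<forall>f\<in>hcarrier H. hnorm K (x f) \<le> C * hnorm H f)}"

definition op_norm :: "'a::complex_space hilb \<Rightarrow> 'b::complex_space hilb \<Rightarrow> ('a \<Rightarrow> 'b) \<Rightarrow> real" where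
  "op_norm H K x = (SUP f\<in>{f \<in> hcarrier H. hnorm H f \<le> 1}. hnorm K (x f))"

definition op_id :: "'a::complex_space hilb \<Rightarrow> 'a \<Rightarrow> 'a" where
  "op_id H = (\<lambda>f. if f \<in> hcarrier H then f else 0)"

definition op_adj ::
  "'a::complex_space hilb \<Rightarrow> 'b::complex_space hilb \<Rightarrow> ('a \<Rightarrow> 'b) \<Rightarrow> 'b \<Rightarrow> 'a" where
  "op_adj H K x = (\<lambda>k. if k \<in> hcarrier K
     then THE h. h \<in> hcarrier H \<and> (\<forall>f\<in>hcarrier H. hinner K (x f) k = hinner H f h)
     else 0)"

definition projections :: "'a::complex_space hilb \<Rightarrow> ('a \<Rightarrow> 'a) set" where
  "projections H = {p \<in> bounded_ops H H. p \<circ> p = p \<and> op_adj H H p = p}"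

text \<open>\<open>operator_space H K Y\<close>: \<open>Y\<close> is a linear subspace of \<open>B(H, K)\<close>, not assumed closed.\<close>

definition operator_space ::
  "'a::complex_space hilb \<Rightarrow> 'b::complex_space hilb \<Rightarrow> ('a \<Rightarrow> 'b) set \<Rightarrow> bool" where
  "operator_space H K Y \<longleftrightarrow>
     hilbert_space H \<and> hilbert_space K \<and> csubspace Y \<and> Y \<subseteq> bounded_ops H K"

definition linear_map_on :: "'c::complex_space set \<Rightarrow> 'd::complex_space set \<Rightarrow> ('c \<Rightarrow> 'd) \<Rightarrow> bool"
  where "linear_map_on Y Z \<psi> \<longleftrightarrow>
     (\<forall>x\<in>Y. \<psi> x \<in> Z) \<and>
     (\<forall>x\<in>Y. \<forall>y\<in>Y. \<psi> (x + y) = \<psi> x + \<psi> y) \<and>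
     (\<forall>c. \<forall>x\<in>Y. \<psi> (c *\<^sub>C x) = c *\<^sub>C \<psi> x)"


section \<open>Completely bounded norm\<close>

text \<open>The \<open>n\<close>-fold Hilbert direct sum of \<open>H\<close> and the identification of \<open>M_n(B(H, K))\<close>
  with \<open>B(H^n, K^n)\<close>; matrices are indexed by \<open>i, j < n\<close> and other entries are ignored.\<close>

definition hilb_power :: "nat \<Rightarrow> 'a::complex_space hilb \<Rightarrow> (nat \<Rightarrow> 'a) hilb" where
  "hilb_power n H =
     \<lparr> hcarrier = {h. (\<forall>i<n. h i \<in> hcarrier H) \<and> (\<forall>i\<ge>n. h i = 0)},
       hinner = (\<lambda>g h. \<Sum>i<n. hinner H (g i) (h i)) \<rparr>"

definition matrix_op ::
  "nat \<Rightarrow> 'a::complex_space hilb \<Rightarrow> (nat \<Rightarrow> nat \<Rightarrow> 'a \<Rightarrow> 'b::complex_space) \<Rightarrow> (nat \<Rightarrow> 'a) \<Rightarrow> nat \<Rightarrow> 'b"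
  where "matrix_op n H x = (\<lambda>h. if h \<in> hcarrier (hilb_power n H)
     then (\<lambda>i. if i < n then (\<Sum>j<n. x i j (h j)) else 0)
     else 0)"

definition matrix_norm ::
  "nat \<Rightarrow> 'a::complex_space hilb \<Rightarrow> 'b::complex_space hilb \<Rightarrow> (nat \<Rightarrow> nat \<Rightarrow> 'a \<Rightarrow> 'b) \<Rightarrow> real" where
  "matrix_norm n H K x = op_norm (hilb_power n H) (hilb_power n K) (matrix_op n H x)"

text \<open>The supremum over \<open>n\<close> of the norms of \<open>\<psi>\<^sub>n : M_n(Y) \<rightarrow> M_n(B(H1, K1))\<close>,
  for \<open>Y \<subseteq> B(H, K)\<close>; it may be infinite.\<close>

definition cb_norm ::
  "'a::complex_space hilb \<Rightarrow> 'b::complex_space hilb \<Rightarrow> ('a \<Rightarrow> 'b) set \<Rightarrow>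
   'c::complex_space hilb \<Rightarrow> 'd::complex_space hilb \<Rightarrow> (('a \<Rightarrow> 'b) \<Rightarrow> 'c \<Rightarrow> 'd) \<Rightarrow> ennreal" where
  "cb_norm H K Y H1 K1 \<psi> =
     (SUP n. SUP x\<in>{x. (\<forall>i<n. \<forall>j<n. x i j \<in> Y) \<and> matrix_norm n H K x \<le> 1}.
        ennreal (matrix_norm n H1 K1 (\<lambda>i j. \<psi> (x i j))))"


section \<open>Ternary rings of operators and boundary representations\<close>

definition TRO ::
  "'a::complex_space hilb \<Rightarrow> 'b::complex_space hilb \<Rightarrow> ('a \<Rightarrow> 'b) set \<Rightarrow> bool" where
  "TRO H K T \<longleftrightarrow>
     operator_space H K T \<and>
     (\<forall>X. \<forall>x\<in>bounded_ops H K.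
        (\<forall>n. X n \<in> T) \<and> (\<lambda>n. op_norm H K (X n - x)) \<longlonglongrightarrow> 0 \<longrightarrow> x \<in> T) \<and>
     (\<forall>x\<in>T. \<forall>y\<in>T. \<forall>z\<in>T. x \<circ> op_adj H K y \<circ> z \<in> T)"

definition generated_TRO ::
  "'a::complex_space hilb \<Rightarrow> 'b::complex_space hilb \<Rightarrow> ('a \<Rightarrow> 'b) set \<Rightarrow> ('a \<Rightarrow> 'b) set" where
  "generated_TRO H K M = \<Inter>{T. TRO H K T \<and> M \<subseteq> T}"

definition TRO_representation ::
  "'a::complex_space hilb \<Rightarrow> 'b::complex_space hilb \<Rightarrow> ('a \<Rightarrow> 'b) set \<Rightarrow>
   'c::complex_space hilb \<Rightarrow> 'd::complex_space hilb \<Rightarrow> (('a \<Rightarrow> 'b) \<Rightarrow> 'c \<Rightarrow> 'd) \<Rightarrow> bool" where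
  "TRO_representation H K T H1 K1 \<theta> \<longleftrightarrow>
     TRO H K T \<and> hilbert_space H1 \<and> hilbert_space K1 \<and>
     linear_map_on T (bounded_ops H1 K1) \<theta> \<and>
     (\<forall>x\<in>T. \<forall>y\<in>T. \<forall>z\<in>T.
        \<theta> (x \<circ> op_adj H K y \<circ> z) = \<theta> x \<circ> op_adj H1 K1 (\<theta> y) \<circ> \<theta> z)"

definition irreducible_map ::
  "('a \<Rightarrow> 'b) set \<Rightarrow> 'c::complex_space hilb \<Rightarrow> 'd::complex_space hilb \<Rightarrow>
   (('a \<Rightarrow> 'b) \<Rightarrow> 'c \<Rightarrow> 'd) \<Rightarrow> bool" where
  "irreducible_map T H1 K1 \<theta> \<longleftrightarrow>
     (\<forall>p\<in>projections H1. \<forall>q\<in>projections K1.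
        (\<forall>x\<in>T. q \<circ> \<theta> x = \<theta> x \<circ> p) \<longrightarrow>
        p = op_id H1 \<and> q = op_id K1 \<or> p = 0 \<and> q = 0)"

definition nondegenerate_map ::
  "('a \<Rightarrow> 'b) set \<Rightarrow> 'c::complex_space hilb \<Rightarrow> 'd::complex_space hilb \<Rightarrow>
   (('a \<Rightarrow> 'b) \<Rightarrow> 'c \<Rightarrow> 'd) \<Rightarrow> bool" where
  "nondegenerate_map Y H1 K1 \<psi> \<longleftrightarrow>
     (\<forall>p\<in>projections H1. \<forall>q\<in>projections K1.
        (\<forall>x\<in>Y. q \<circ> \<psi> x = 0 \<and> \<psi> x \<circ> p = 0) \<longrightarrow> p = 0 \<and> q = 0)"

definition rectangular_operator_state ::
  "'a::complex_space hilb \<Rightarrow> 'b::complex_space hilb \<Rightarrow> ('a \<Rightarrow> 'b) set \<Rightarrow>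
   'c::complex_space hilb \<Rightarrow> 'd::complex_space hilb \<Rightarrow> (('a \<Rightarrow> 'b) \<Rightarrow> 'c \<Rightarrow> 'd) \<Rightarrow> bool" where
  "rectangular_operator_state H K Y H1 K1 \<psi> \<longleftrightarrow>
     operator_space H K Y \<and> hilbert_space H1 \<and> hilbert_space K1 \<and>
     linear_map_on Y (bounded_ops H1 K1) \<psi> \<and>
     nondegenerate_map Y H1 K1 \<psi> \<and>
     cb_norm H K Y H1 K1 \<psi> = 1"

definition identity_is_boundary_representation ::
  "'a::complex_space hilb \<Rightarrow> 'b::complex_space hilb \<Rightarrow> ('a \<Rightarrow> 'b) set \<Rightarrow> bool" where
  "identity_is_boundary_representation H K M \<longleftrightarrow>
     rectangular_operator_state H K M H K (\<lambda>x. x) \<and>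
     (\<forall>\<psi>. rectangular_operator_state H K (generated_TRO H K M) H K \<psi> \<and> (\<forall>x\<in>M. \<psi> x = x) \<longrightarrow>
        TRO_representation H K (generated_TRO H K M) H K \<psi> \<and>
        irreducible_map (generated_TRO H K M) H K \<psi>)"


section \<open>The spaces \<open>H_s\<close> and their multipliers\<close>

text \<open>A function on the open unit disc is represented by its extension by zero to the plane.\<close>

definition taylor_coeff :: "(complex \<Rightarrow> complex) \<Rightarrow> nat \<Rightarrow> complex" where
  "taylor_coeff f n = (deriv ^^ n) f 0 / fact n"

definition Hs :: "real \<Rightarrow> (complex \<Rightarrow> complex) hilb" where
  "Hs s =
     \<lparr> hcarrier = {f. f holomorphic_on ball 0 1 \<and> (\<forall>z. z \<notin> ball 0 1 \<longrightarrow> f z = 0) \<and>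
         summable (\<lambda>n. (cmod (taylor_coeff f n))\<^sup>2 * (real n + 1) powr (-s))},
       hinner = (\<lambda>f g. \<Sum>n. taylor_coeff f n * cnj (taylor_coeff g n) *
         of_real ((real n + 1) powr (-s))) \<rparr>"

text \<open>The following lemmas lead to \<open>hilbert_space_Hs\<close>.\<close>

lemma Hs_sums:
  assumes "f \<in> hcarrier (Hs s)" "cmod z < 1"
  shows "(\<lambda>n. taylor_coeff f n * z ^ n) sums f z"
  using holomorphic_power_series[of f 0 1 z] assms by (simp add: Hs_def taylor_coeff_def)

lemma Hs_eqI:
  assumes "f \<in> hcarrier (Hs s)" "g \<in> hcarrier (Hs s)" "\<And>n. taylor_coeff f n = taylor_coeff g n"
  shows "f = g"
proof
  fix z
  show "f z = g z"
  proof (cases "cmod z < 1")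
    case True
    show ?thesis
      using Hs_sums[OF assms(1) True] Hs_sums[OF assms(2) True] assms(3) sums_unique2 by auto
  next
    case False
    then show ?thesis using assms(1,2) by (simp add: Hs_def)
  qed
qed

lemma taylor_coeff_add:
  assumes "f holomorphic_on ball 0 1" "g holomorphic_on ball 0 1"
  shows "taylor_coeff (f + g) n = taylor_coeff f n + taylor_coeff g n"
  using higher_deriv_add[OF assms, of 0 n]
  by (simp add: taylor_coeff_def plus_fun_def add_divide_distrib)

lemma taylor_coeff_scaleC:
  assumes "f holomorphic_on ball 0 1"
  shows "taylor_coeff (c *\<^sub>C f) n = c * taylor_coeff f n"
  using higher_deriv_cmult[OF assms, of 0 n c]
  by (simp add: taylor_coeff_def scaleC_fun_def scaleC_complex_def)

lemma taylor_coeff_zero [simp]: "taylor_coeff 0 n = 0"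
  using higher_deriv_const[of n 0] by (simp add: taylor_coeff_def zero_fun_def)

lemma taylor_coeff_powser:
  assumes "\<And>z. cmod z < 1 \<Longrightarrow> (\<lambda>n. a n * z ^ n) sums f z"
  shows "f holomorphic_on ball 0 1" "taylor_coeff f = a"
proof -
  show hol: "f holomorphic_on ball 0 1"
    by (rule power_series_holomorphic[where a=a]) (simp add: assms)
  show "taylor_coeff f = a"
  proof (rule ext, rule ccontr)
    fix k assume k: "taylor_coeff f k \<noteq> a k"
    define d where "d n = taylor_coeff f n - a n" for n
    have d: "(\<lambda>n. d n * z ^ n) sums 0" if "cmod z < 1" for z
      using sums_diff[OF holomorphic_power_series[OF hol, of z] assms[OF that]] that
      by (simp add: d_def taylor_coeff_def algebra_simps)
    define F where "F = Abs_fps d"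
    have conv: "fps_conv_radius F > 0"
    proof -
      have "ereal (norm (1/2 :: complex)) \<le> conv_radius d"
        by (rule conv_radius_geI) (use d[of "1/2"] in \<open>simp add: sums_iff\<close>)
      then have "ereal (1/2) \<le> fps_conv_radius F"
        by (simp add: fps_conv_radius_def F_def)
      moreover have "(0::ereal) < ereal (1/2)" by simp
      ultimately show ?thesis by (rule less_le_trans[rotated])
    qed
    have "(\<lambda>_::complex. 0 :: complex) has_fps_expansion F"
    proof -
      have "\<forall>\<^sub>F z in nhds (0::complex). z \<in> ball 0 1"
        by (intro eventually_nhds_in_open) auto
      then have "\<forall>\<^sub>F z in nhds 0. eval_fps F z = (0::complex)"
      proof eventually_elim
        case (elim z)
        then show ?case using d[of z] by (simp add: eval_fps_def F_def sums_iff)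
      qed
      then show ?thesis using conv by (simp add: has_fps_expansion_def)
    qed
    then have "F = 0"
      by (rule fps_expansion_unique_complex) simp
    then have "d k = 0" by (metis F_def fps_nth_Abs_fps fps_zero_nth)
    with k show False by (simp add: d_def)
  qed
qed

lemma summable_weighted_add:
  fixes a b :: "nat \<Rightarrow> complex" and w :: "nat \<Rightarrow> real"
  assumes "summable (\<lambda>n. (cmod (a n))\<^sup>2 * w n)" "summable (\<lambda>n. (cmod (b n))\<^sup>2 * w n)" "\<And>n. w n \<ge> 0"
  shows "summable (\<lambda>n. (cmod (a n + b n))\<^sup>2 * w n)"
proof (rule summable_comparison_test')
  show "summable (\<lambda>n. 2 * ((cmod (a n))\<^sup>2 * w n) + 2 * ((cmod (b n))\<^sup>2 * w n))"
    using assms by (intro summable_add summable_mult)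
  fix n :: nat
  have "(cmod (a n + b n))\<^sup>2 \<le> (cmod (a n) + cmod (b n))\<^sup>2"
    by (intro power_mono norm_triangle_ineq) auto
  also have "\<dots> \<le> 2 * (cmod (a n))\<^sup>2 + 2 * (cmod (b n))\<^sup>2"
    using sum_squares_ge_zero[of "cmod (a n) - cmod (b n)" 0]
    by (simp add: power2_eq_square algebra_simps)
  finally have "(cmod (a n + b n))\<^sup>2 * w n \<le> (2 * (cmod (a n))\<^sup>2 + 2 * (cmod (b n))\<^sup>2) * w n"
    by (intro mult_right_mono assms)
  then show "norm ((cmod (a n + b n))\<^sup>2 * w n)
      \<le> 2 * ((cmod (a n))\<^sup>2 * w n) + 2 * ((cmod (b n))\<^sup>2 * w n)"
    using assms(3)[of n] by (simp add: algebra_simps)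
qed

lemma summable_weighted_prod:
  fixes a b :: "nat \<Rightarrow> complex" and w :: "nat \<Rightarrow> real"
  assumes "summable (\<lambda>n. (cmod (a n))\<^sup>2 * w n)" "summable (\<lambda>n. (cmod (b n))\<^sup>2 * w n)" "\<And>n. w n \<ge> 0"
  shows "summable (\<lambda>n. a n * cnj (b n) * of_real (w n))"
proof (rule summable_comparison_test')
  show "summable (\<lambda>n. (cmod (a n))\<^sup>2 * w n + (cmod (b n))\<^sup>2 * w n)"
    using assms by (intro summable_add)
  fix n :: nat
  have "0 \<le> (cmod (a n) - cmod (b n))\<^sup>2" "0 \<le> cmod (a n) * cmod (b n)" by simp_all
  then have "cmod (a n) * cmod (b n) \<le> (cmod (a n))\<^sup>2 + (cmod (b n))\<^sup>2"
    unfolding power2_diff by linarith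
  then have "cmod (a n) * cmod (b n) * w n \<le> ((cmod (a n))\<^sup>2 + (cmod (b n))\<^sup>2) * w n"
    by (intro mult_right_mono assms)
  then show "norm (a n * cnj (b n) * of_real (w n))
      \<le> (cmod (a n))\<^sup>2 * w n + (cmod (b n))\<^sup>2 * w n"
    using assms(3)[of n] by (simp add: norm_mult algebra_simps)
qed

lemma Hs_powser:
  assumes "summable (\<lambda>n. (cmod (a n))\<^sup>2 * (real n + 1) powr (-s))"
  obtains f where "f \<in> hcarrier (Hs s)" "taylor_coeff f = a"
proof -
  define f where "f z = (if cmod z < 1 then \<Sum>n. a n * z ^ n else 0)" for z
  have sums: "(\<lambda>n. a n * z ^ n) sums f z" if z: "cmod z < 1" for z
  proof -
    define r where "r = (cmod z + 1) / 2"
    have r: "0 < r" "r < 1" "cmod z \<le> r"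
      using z norm_ge_zero[of z] by (simp_all add: r_def del: norm_ge_zero)
    have "(\<lambda>n. (real n + 1) powr s * (r ^ n)\<^sup>2) \<in> O(\<lambda>n. 1 / real n ^ 2)"
      using r(1,2) by real_asymp
    moreover have "summable (\<lambda>n. norm (1 / real n ^ 2))"
      using inverse_power_summable[of 2, where 'a=real] by (simp add: field_simps)
    ultimately have "summable (\<lambda>n. (real n + 1) powr s * (r ^ n)\<^sup>2)"
      by (rule summable_comparison_test_bigo[rotated])
    then have sm: "summable (\<lambda>n. (cmod (a n))\<^sup>2 * (real n + 1) powr (-s)
        + (real n + 1) powr s * (r ^ n)\<^sup>2)"
      by (rule summable_add[OF assms])
    have "summable (\<lambda>n. a n * z ^ n)"
    proof (rule summable_comparison_test'[OF sm])
      fix n :: nat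
      define u where "u = cmod (a n) * (real n + 1) powr (-s/2)"
      define v where "v = (real n + 1) powr (s/2) * r ^ n"
      have e: "u\<^sup>2 = (cmod (a n))\<^sup>2 * (real n + 1) powr (-s)"
        "v\<^sup>2 = (real n + 1) powr s * (r ^ n)\<^sup>2"
        "u * v = cmod (a n) * r ^ n"
      proof -
        have p: "(real n + 1) powr (q/2) * (real n + 1) powr (q/2) = (real n + 1) powr q" for q
          by (simp flip: powr_add)
        have "(real n + 1) powr (-s/2) * (real n + 1) powr (s/2) = 1"
          by (simp flip: powr_add)
        then have "cmod (a n) * r ^ n * ((real n + 1) powr (-s/2) * (real n + 1) powr (s/2))
            = cmod (a n) * r ^ n" by simp
        then show "u * v = cmod (a n) * r ^ n" by (simp only: u_def v_def mult_ac)
        show "u\<^sup>2 = (cmod (a n))\<^sup>2 * (real n + 1) powr (-s)"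
          unfolding u_def power_mult_distrib by (simp only: power2_eq_square p)
        show "v\<^sup>2 = (real n + 1) powr s * (r ^ n)\<^sup>2"
          unfolding v_def power_mult_distrib by (simp only: power2_eq_square p)
      qed
      have "norm (a n * z ^ n) \<le> cmod (a n) * r ^ n"
        using r by (simp add: norm_mult norm_power mult_left_mono power_mono)
      also have "\<dots> = u * v" using e by simp
      also have "\<dots> \<le> u\<^sup>2 + v\<^sup>2"
      proof -
        have "0 \<le> (u - v)\<^sup>2" by simp
        moreover have "0 \<le> u * v" using r(1) by (simp add: u_def v_def)
        ultimately show ?thesis unfolding power2_diff by linarith
      qed
      finally show "norm (a n * z ^ n) \<le> (cmod (a n))\<^sup>2 * (real n + 1) powr (-s)
        + (real n + 1) powr s * (r ^ n)\<^sup>2" using e by simp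
    qed
    then show ?thesis using z by (simp add: f_def summable_sums)
  qed
  note tc = taylor_coeff_powser[OF sums]
  have "f \<in> hcarrier (Hs s)"
    using tc assms by (simp add: Hs_def) (simp add: f_def)
  with tc(2) that show thesis by blast
qed

lemma hinner_Hs_sums:
  assumes "f \<in> hcarrier (Hs s)" "g \<in> hcarrier (Hs s)"
  shows "(\<lambda>n. taylor_coeff f n * cnj (taylor_coeff g n) * of_real ((real n + 1) powr (-s)))
    sums hinner (Hs s) f g"
proof -
  have "summable (\<lambda>n. taylor_coeff f n * cnj (taylor_coeff g n) * of_real ((real n + 1) powr (-s)))"
    by (rule summable_weighted_prod) (use assms in \<open>simp_all add: Hs_def\<close>)
  then show ?thesis by (simp add: Hs_def summable_sums)
qed

lemma hnorm_Hs_sums: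
  assumes "f \<in> hcarrier (Hs s)"
  shows "(\<lambda>n. (cmod (taylor_coeff f n))\<^sup>2 * (real n + 1) powr (-s)) sums (hnorm (Hs s) f)\<^sup>2"
    and "hnorm (Hs s) f \<ge> 0"
proof -
  have eq: "Re (taylor_coeff f n * cnj (taylor_coeff f n) * of_real ((real n + 1) powr (-s)))
      = (cmod (taylor_coeff f n))\<^sup>2 * (real n + 1) powr (-s)" for n
    by (simp only: complex_norm_square[symmetric] of_real_mult[symmetric] Re_complex_of_real)
  have *: "(\<lambda>n. (cmod (taylor_coeff f n))\<^sup>2 * (real n + 1) powr (-s)) sums Re (hinner (Hs s) f f)"
    using sums_Re[OF hinner_Hs_sums[OF assms assms]] unfolding eq .
  have "Re (hinner (Hs s) f f) \<ge> 0"
    by (rule sums_le[OF _ sums_zero *]) simp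
  then show "(\<lambda>n. (cmod (taylor_coeff f n))\<^sup>2 * (real n + 1) powr (-s)) sums (hnorm (Hs s) f)\<^sup>2"
    "hnorm (Hs s) f \<ge> 0"
    using * by (simp_all add: hnorm_def)
qed

lemma Hs_add:
  assumes "f \<in> hcarrier (Hs s)" "g \<in> hcarrier (Hs s)"
  shows "f + g \<in> hcarrier (Hs s)" "taylor_coeff (f + g) n = taylor_coeff f n + taylor_coeff g n"
proof -
  have hol: "f holomorphic_on ball 0 1" "g holomorphic_on ball 0 1"
    using assms by (simp_all add: Hs_def)
  show "taylor_coeff (f + g) n = taylor_coeff f n + taylor_coeff g n"
    using taylor_coeff_add[OF hol] .
  have "f + g holomorphic_on ball 0 1"
    unfolding plus_fun_def by (intro holomorphic_intros hol)
  moreover have "summable (\<lambda>n. (cmod (taylor_coeff (f + g) n))\<^sup>2 * (real n + 1) powr (-s))"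
    unfolding taylor_coeff_add[OF hol]
    by (rule summable_weighted_add) (use assms in \<open>simp_all add: Hs_def\<close>)
  ultimately show "f + g \<in> hcarrier (Hs s)"
    using assms by (simp add: Hs_def)
qed

lemma Hs_scaleC:
  assumes "f \<in> hcarrier (Hs s)"
  shows "c *\<^sub>C f \<in> hcarrier (Hs s)" "taylor_coeff (c *\<^sub>C f) n = c * taylor_coeff f n"
proof -
  have hol: "f holomorphic_on ball 0 1"
    using assms by (simp_all add: Hs_def)
  show "taylor_coeff (c *\<^sub>C f) n = c * taylor_coeff f n"
    using taylor_coeff_scaleC[OF hol] .
  have "c *\<^sub>C f holomorphic_on ball 0 1"
    unfolding scaleC_fun_def scaleC_complex_def by (intro holomorphic_intros hol)
  moreover have "summable (\<lambda>n. (cmod (taylor_coeff (c *\<^sub>C f) n))\<^sup>2 * (real n + 1) powr (-s))"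
    using summable_mult[of "\<lambda>n. (cmod (taylor_coeff f n))\<^sup>2 * (real n + 1) powr (-s)" "(cmod c)\<^sup>2"]
      assms
    unfolding taylor_coeff_scaleC[OF hol]
    by (simp add: Hs_def norm_mult power_mult_distrib mult.assoc)
  ultimately show "c *\<^sub>C f \<in> hcarrier (Hs s)"
    using assms by (simp add: Hs_def scaleC_fun_def scaleC_complex_def)
qed

lemma Hs_diff:
  assumes "f \<in> hcarrier (Hs s)" "g \<in> hcarrier (Hs s)"
  shows "f - g \<in> hcarrier (Hs s)" "taylor_coeff (f - g) n = taylor_coeff f n - taylor_coeff g n"
proof -
  have "f - g = f + (-1) *\<^sub>C g"
    by (simp add: fun_eq_iff scaleC_fun_def scaleC_complex_def)
  then show "f - g \<in> hcarrier (Hs s)" "taylor_coeff (f - g) n = taylor_coeff f n - taylor_coeff g n"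
    using Hs_add[OF assms(1) Hs_scaleC(1)[OF assms(2), of "-1"]] Hs_scaleC[OF assms(2), of "-1"]
    by simp_all
qed

lemma Hs_complete:
  assumes X: "\<And>n. X n \<in> hcarrier (Hs s)"
    and cauchy: "\<And>e. e > 0 \<Longrightarrow> \<exists>N. \<forall>m\<ge>N. \<forall>n\<ge>N. hnorm (Hs s) (X m - X n) < e"
  shows "\<exists>f\<in>hcarrier (Hs s). (\<lambda>n. hnorm (Hs s) (X n - f)) \<longlonglongrightarrow> 0"
proof -
  define w where "w k = (real k + 1) powr (-s)" for k
  have w: "w k > 0" for k by (simp add: w_def)
  define c where "c n k = taylor_coeff (X n) k" for n k
  have part: "(\<Sum>k<K. (cmod (c m k - c n k))\<^sup>2 * w k) \<le> (hnorm (Hs s) (X m - X n))\<^sup>2" for m n K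
  proof -
    have "(\<lambda>k. (cmod (c m k - c n k))\<^sup>2 * w k) sums (hnorm (Hs s) (X m - X n))\<^sup>2"
      using hnorm_Hs_sums(1)[OF Hs_diff(1)[OF X X], of m n]
      by (simp add: Hs_diff(2)[OF X X] c_def w_def)
    moreover have "0 \<le> (cmod (c m k - c n k))\<^sup>2 * w k" for k
      using w[of k] by simp
    ultimately show ?thesis
      using sum_le_suminf[of "\<lambda>k. (cmod (c m k - c n k))\<^sup>2 * w k" "{..<K}"]
      by (simp add: sums_iff)
  qed
  have "Cauchy (\<lambda>n. c n k)" for k
  proof (rule metric_CauchyI)
    fix e :: real assume e: "e > 0"
    then have "e * sqrt (w k) > 0" using w by simp
    then obtain N where N: "\<forall>m\<ge>N. \<forall>n\<ge>N. hnorm (Hs s) (X m - X n) < e * sqrt (w k)"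
      using cauchy by blast
    have "dist (c m k) (c n k) < e" if "m \<ge> N" "n \<ge> N" for m n
    proof -
      have "(cmod (c m k - c n k))\<^sup>2 * w k \<le> (\<Sum>j<Suc k. (cmod (c m j - c n j))\<^sup>2 * w j)"
        by (rule member_le_sum) (auto intro!: mult_nonneg_nonneg less_imp_le[OF w])
      also have "\<dots> \<le> (hnorm (Hs s) (X m - X n))\<^sup>2" by (rule part)
      also have "\<dots> < (e * sqrt (w k))\<^sup>2"
        using N that hnorm_Hs_sums(2)[OF Hs_diff(1)[OF X X]]
        by (intro power_strict_mono) auto
      also have "\<dots> = e\<^sup>2 * w k" using w[of k] by (simp add: power_mult_distrib less_imp_le)
      finally have "(cmod (c m k - c n k))\<^sup>2 < e\<^sup>2" using w[of k] by simp
      then show ?thesis using e by (auto simp: dist_norm intro: power_less_imp_less_base[of _ 2])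
    qed
    then show "\<exists>N. \<forall>m\<ge>N. \<forall>n\<ge>N. dist (c m k) (c n k) < e" by blast
  qed
  then have "\<exists>l. (\<lambda>n. c n k) \<longlonglongrightarrow> l" for k
    by (simp add: Cauchy_convergent_iff convergent_def)
  then obtain a where a: "\<And>k. (\<lambda>n. c n k) \<longlonglongrightarrow> a k" by metis
  have lim: "\<exists>N. \<forall>m\<ge>N. \<forall>K. (\<Sum>k<K. (cmod (c m k - a k))\<^sup>2 * w k) \<le> e\<^sup>2" if e: "e > 0" for e
  proof -
    obtain N where N: "\<forall>m\<ge>N. \<forall>n\<ge>N. hnorm (Hs s) (X m - X n) < e"
      using cauchy[OF e] by blast
    have "(\<Sum>k<K. (cmod (c m k - a k))\<^sup>2 * w k) \<le> e\<^sup>2" if m: "m \<ge> N" for m K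
    proof (rule tendsto_upperbound)
      show "(\<lambda>n. \<Sum>k<K. (cmod (c m k - c n k))\<^sup>2 * w k)
          \<longlonglongrightarrow> (\<Sum>k<K. (cmod (c m k - a k))\<^sup>2 * w k)"
        by (intro tendsto_intros a)
      have "(\<Sum>k<K. (cmod (c m k - c n k))\<^sup>2 * w k) \<le> e\<^sup>2" if n: "n \<ge> N" for n
      proof -
        have "(hnorm (Hs s) (X m - X n))\<^sup>2 \<le> e\<^sup>2"
          using N m n hnorm_Hs_sums(2)[OF Hs_diff(1)[OF X X]]
          by (intro power_mono) (auto intro: less_imp_le)
        then show ?thesis using part[of m n K] by linarith
      qed
      then show "\<forall>\<^sub>F n in sequentially. (\<Sum>k<K. (cmod (c m k - c n k))\<^sup>2 * w k) \<le> e\<^sup>2"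
        using eventually_sequentially by blast
    qed simp
    then show ?thesis by blast
  qed
  have nn: "0 \<le> (cmod (c m k - a k))\<^sup>2 * w k" for m k
    using w[of k] by simp
  have sumd: "\<exists>N. \<forall>m\<ge>N. summable (\<lambda>k. (cmod (c m k - a k))\<^sup>2 * w k) \<and>
      (\<Sum>k. (cmod (c m k - a k))\<^sup>2 * w k) \<le> e\<^sup>2" if e: "e > 0" for e
  proof -
    obtain N where N: "\<forall>m\<ge>N. \<forall>K. (\<Sum>k<K. (cmod (c m k - a k))\<^sup>2 * w k) \<le> e\<^sup>2"
      using lim[OF e] by blast
    have "summable (\<lambda>k. (cmod (c m k - a k))\<^sup>2 * w k) \<and>
      (\<Sum>k. (cmod (c m k - a k))\<^sup>2 * w k) \<le> e\<^sup>2" if "m \<ge> N" for m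
    proof -
      have sm: "summable (\<lambda>k. (cmod (c m k - a k))\<^sup>2 * w k)"
        using N that nn by (intro summableI_nonneg_bounded[where x="e\<^sup>2"]) auto
      moreover have "(\<Sum>k. (cmod (c m k - a k))\<^sup>2 * w k) \<le> e\<^sup>2"
        using N that sm by (intro suminf_le_const) auto
      ultimately show ?thesis by blast
    qed
    then show ?thesis by blast
  qed
  obtain N where "summable (\<lambda>k. (cmod (c N k - a k))\<^sup>2 * w k)"
    using sumd[of 1] by auto
  then have "summable (\<lambda>k. (cmod (a k - c N k))\<^sup>2 * w k)"
    by (simp add: norm_minus_commute)
  moreover have "summable (\<lambda>k. (cmod (c N k))\<^sup>2 * w k)"
    using X[of N] by (simp add: Hs_def c_def w_def)
  ultimately have "summable (\<lambda>k. (cmod ((a k - c N k) + c N k))\<^sup>2 * w k)"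
    by (rule summable_weighted_add) (use w in \<open>auto intro: less_imp_le\<close>)
  then have "summable (\<lambda>k. (cmod (a k))\<^sup>2 * (real k + 1) powr (-s))"
    by (simp add: w_def)
  then obtain f where f: "f \<in> hcarrier (Hs s)" "taylor_coeff f = a"
    by (rule Hs_powser)
  have sq: "(\<lambda>k. (cmod (c m k - a k))\<^sup>2 * w k) sums (hnorm (Hs s) (X m - f))\<^sup>2" for m
    using hnorm_Hs_sums(1)[OF Hs_diff(1)[OF X f(1)], of m]
    by (simp add: Hs_diff(2)[OF X f(1)] f(2) c_def w_def)
  have "(\<lambda>n. hnorm (Hs s) (X n - f)) \<longlonglongrightarrow> 0"
  proof (rule LIMSEQ_I)
    fix e :: real assume e: "e > 0"
    obtain N where N: "\<forall>m\<ge>N. (\<Sum>k. (cmod (c m k - a k))\<^sup>2 * w k) \<le> (e/2)\<^sup>2"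
      using sumd[of "e/2"] e by auto
    have "norm (hnorm (Hs s) (X m - f) - 0) < e" if "m \<ge> N" for m
    proof -
      have "(hnorm (Hs s) (X m - f))\<^sup>2 \<le> (e/2)\<^sup>2"
        using N that sums_unique[OF sq[of m]] by simp
      then have "hnorm (Hs s) (X m - f) \<le> e/2"
        by (rule power2_le_imp_le) (use e in simp)
      then show ?thesis
        using e hnorm_Hs_sums(2)[OF Hs_diff(1)[OF X f(1)], of m] by simp
    qed
    then show "\<exists>no. \<forall>n\<ge>no. norm (hnorm (Hs s) (X n - f) - 0) < e" by blast
  qed
  with f(1) show ?thesis by blast
qed

lemma hilbert_space_Hs: "hilbert_space (Hs s)"
proof -
  let ?H = "Hs s"
  have zero: "0 \<in> hcarrier ?H"
    by (simp add: Hs_def zero_fun_def taylor_coeff_zero[unfolded zero_fun_def])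
  have "csubspace (hcarrier ?H)"
    by (rule complex_space.subspaceI) (auto intro: zero Hs_add(1) Hs_scaleC(1))
  moreover have "hinner ?H (f + g) h = hinner ?H f h + hinner ?H g h"
    if "f \<in> hcarrier ?H" "g \<in> hcarrier ?H" "h \<in> hcarrier ?H" for f g h
    using sums_add[OF hinner_Hs_sums[OF that(1,3)] hinner_Hs_sums[OF that(2,3)]]
      hinner_Hs_sums[OF Hs_add(1)[OF that(1,2)] that(3)] Hs_add(2)[OF that(1,2)]
    by (auto simp: algebra_simps intro: sums_unique2)
  moreover have "hinner ?H (c *\<^sub>C f) g = c * hinner ?H f g"
    if "f \<in> hcarrier ?H" "g \<in> hcarrier ?H" for c f g
    using sums_mult[OF hinner_Hs_sums[OF that], of c]
      hinner_Hs_sums[OF Hs_scaleC(1)[OF that(1)] that(2), of c] Hs_scaleC(2)[OF that(1), of c]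
    by (auto simp: mult.assoc intro: sums_unique2)
  moreover have "hinner ?H g f = cnj (hinner ?H f g)"
    if "f \<in> hcarrier ?H" "g \<in> hcarrier ?H" for f g
  proof -
    have "(\<lambda>n. cnj (taylor_coeff f n * cnj (taylor_coeff g n) * of_real ((real n + 1) powr (-s))))
        sums cnj (hinner ?H f g)"
      unfolding sums_cnj by (rule hinner_Hs_sums[OF that])
    moreover have "cnj (taylor_coeff f n * cnj (taylor_coeff g n) * of_real ((real n + 1) powr (-s)))
        = taylor_coeff g n * cnj (taylor_coeff f n) * of_real ((real n + 1) powr (-s))" for n
      by simp
    ultimately have "(\<lambda>n. taylor_coeff g n * cnj (taylor_coeff f n) *
        of_real ((real n + 1) powr (-s))) sums cnj (hinner ?H f g)"
      by (simp only:)
    then show ?thesis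
      by (rule sums_unique2[OF hinner_Hs_sums[OF that(2,1)]])
  qed
  moreover have "Re (hinner ?H f f) > 0" if f: "f \<in> hcarrier ?H" and "f \<noteq> 0" for f
  proof -
    obtain n where n: "taylor_coeff f n \<noteq> 0"
      using Hs_eqI[OF f zero] \<open>f \<noteq> 0\<close> by auto
    have "0 < (hnorm ?H f)\<^sup>2"
      using hnorm_Hs_sums(1)[OF f] n
        suminf_pos2[of "\<lambda>n. (cmod (taylor_coeff f n))\<^sup>2 * (real n + 1) powr (-s)" n]
      by (simp add: sums_iff)
    then show ?thesis using hnorm_Hs_sums(2)[OF f] by (simp add: hnorm_def)
  qed
  ultimately show ?thesis
    unfolding hilbert_space_def using Hs_complete[of _ s] by blast
qed

definition Mult :: "real \<Rightarrow> real \<Rightarrow> (complex \<Rightarrow> complex) set" where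
  "Mult s t = {\<phi>. (\<forall>z. z \<notin> ball 0 1 \<longrightarrow> \<phi> z = 0) \<and>
     (\<forall>f\<in>hcarrier (Hs s). (\<lambda>z. \<phi> z * f z) \<in> hcarrier (Hs t))}"

text \<open>\<open>\<phi>\<close> is recovered from \<open>mult_op s \<phi>\<close>, because the constant function \<open>1\<close> on the disc lies in every
  \<open>H_s\<close>.  Boundedness of the multiplication operators is not built in: it is required by
  \<open>operator_space\<close>.\<close>

definition mult_op :: "real \<Rightarrow> (complex \<Rightarrow> complex) \<Rightarrow> (complex \<Rightarrow> complex) \<Rightarrow> complex \<Rightarrow> complex" where
  "mult_op s \<phi> = (\<lambda>f. if f \<in> hcarrier (Hs s) then (\<lambda>z. \<phi> z * f z) else 0)"

definition Mult_ops :: "real \<Rightarrow> real \<Rightarrow> ((complex \<Rightarrow> complex) \<Rightarrow> complex \<Rightarrow> complex) set" where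
  "Mult_ops s t = mult_op s ` Mult s t"

end

theory Submission
  imports Defs
begin

text \<open>
  Let \<open>J\<close> be the inclusion of \<open>H_s\<close> in \<open>H_t\<close> and \<open>T\<close> the TRO generated by the multipliers.  Since
  \<open>s < t\<close>, \<open>J\<close> is diagonal with norm 1 attained only at the constants, so the powers \<open>(J J\<^sup>*)\<^sup>n J\<close>
  converge to the rank one operator \<open>1 \<otimes> 1\<^sup>*\<close>, and \<open>T\<close> contains \<open>f \<otimes> 1\<^sup>*\<close> for every polynomial \<open>f\<close>.
  Let \<open>\<psi>\<close> be a completely contractive map on \<open>T\<close> that fixes the multipliers.  For small \<open>\<eta>\<close> the column
  with entries \<open>J\<close> and \<open>\<eta> M\<close>, where \<open>M\<close> is multiplication by \<open>z\<^sup>i\<close>, attains its norm only at the constants,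
  with a gap, and is fixed by \<open>\<psi>\<close>; this forces \<open>\<psi> (z\<^sup>i \<otimes> 1\<^sup>*) 1 = z\<^sup>i\<close>.  Rows with entries
  \<open>f \<otimes> 1\<^sup>*\<close> and \<open>x\<close> then show that \<open>x\<^sup>* f = 0\<close> implies \<open>(\<psi> x)\<^sup>* f = 0\<close>.  Applied to
  \<open>J - (f \<otimes> f\<^sup>*) J\<close> for a unit vector \<open>f\<close> this gives \<open>\<psi> ((f \<otimes> f\<^sup>*) J) = (f \<otimes> f\<^sup>*) J\<close>.  By polarization and because \<open>J\<^sup>*\<close>
  has dense range, \<open>\<psi>\<close> fixes the rank one operators, and then \<open>\<psi> x = x\<close> for all \<open>x\<close> in \<open>T\<close>.
\<close>


section \<open>Hilbert spaces\<close>

text \<open>Dividing by \<epsilon> and letting it tend to 0 leaves \<open>a \<le> 0\<close>. This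
  closes the perturbation arguments below: a gain of first order cannot be paid for by a cost of
  second order.\<close>

lemma linear_le_quadratic_imp_le_0:
  fixes a b :: real
  assumes "\<And>\<epsilon>. \<epsilon> > 0 \<Longrightarrow> \<epsilon> * a \<le> \<epsilon>\<^sup>2 * b"
  shows "a \<le> 0"
proof -
  have "a \<le> \<epsilon> * b" if "\<epsilon> > 0" for \<epsilon>
    using assms[OF that] that by (simp add: power2_eq_square mult.assoc)
  then have "eventually (\<lambda>\<epsilon>. a \<le> \<epsilon> * b) (at_right 0)"
    by (simp add: eventually_at_filter)
  moreover have "((\<lambda>\<epsilon>. \<epsilon> * b) \<longlongrightarrow> 0 * b) (at_right 0)" by (intro tendsto_intros)
  ultimately show ?thesis by (intro tendsto_lowerbound[of "\<lambda>\<epsilon>. \<epsilon> * b" 0 "at_right 0"]) auto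
qed

section \<open>Inner product geometry and the basic theorems on one Hilbert space\<close>

locale hilb_space =
  fixes H :: "'a::complex_space hilb"
  assumes hilbert: "hilbert_space H"
begin

abbreviation "V \<equiv> hcarrier H"
abbreviation "ip \<equiv> hinner H"
abbreviation "nrm \<equiv> hnorm H"

lemma subspace_V: "csubspace V"
  using hilbert by (simp add: hilbert_space_def)

lemma zero_in [simp, intro]: "0 \<in> V"
  and add_in [simp, intro]: "f \<in> V \<Longrightarrow> g \<in> V \<Longrightarrow> f + g \<in> V"
  and diff_in [simp, intro]: "f \<in> V \<Longrightarrow> g \<in> V \<Longrightarrow> f - g \<in> V"
  and scale_in [simp, intro]: "f \<in> V \<Longrightarrow> c *\<^sub>C f \<in> V"
  and sum_in: "(\<And>i. i \<in> A \<Longrightarrow> h i \<in> V) \<Longrightarrow> sum h A \<in> V"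
  using subspace_V complex_space.subspace_0 complex_space.subspace_add complex_space.subspace_diff
    complex_space.subspace_scale complex_space.subspace_sum by blast+

lemma ip_add_left: "f \<in> V \<Longrightarrow> g \<in> V \<Longrightarrow> h \<in> V \<Longrightarrow> ip (f + g) h = ip f h + ip g h"
  using hilbert[unfolded hilbert_space_def, THEN conjunct2, THEN conjunct1] by blast

lemma ip_scale_left: "f \<in> V \<Longrightarrow> g \<in> V \<Longrightarrow> ip (c *\<^sub>C f) g = c * ip f g"
  using hilbert[unfolded hilbert_space_def, THEN conjunct2, THEN conjunct2, THEN conjunct1] by blast

lemma ip_commute: "f \<in> V \<Longrightarrow> g \<in> V \<Longrightarrow> ip g f = cnj (ip f g)"
  using hilbert[unfolded hilbert_space_def, THEN conjunct2, THEN conjunct2, THEN conjunct2, THEN conjunct1] by blast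

lemma ip_pos: "f \<in> V \<Longrightarrow> f \<noteq> 0 \<Longrightarrow> Re (ip f f) > 0"
  using hilbert[unfolded hilbert_space_def, THEN conjunct2, THEN conjunct2, THEN conjunct2, THEN conjunct2, THEN conjunct1] by blast

lemma ip_add_right: "f \<in> V \<Longrightarrow> g \<in> V \<Longrightarrow> h \<in> V \<Longrightarrow> ip h (f + g) = ip h f + ip h g"
  by (metis add_in complex_cnj_add ip_add_left ip_commute)

lemma ip_scale_right: "f \<in> V \<Longrightarrow> g \<in> V \<Longrightarrow> ip f (c *\<^sub>C g) = cnj c * ip f g"
  by (metis complex_cnj_mult ip_commute ip_scale_left scale_in)

lemma ip_zero_left [simp]: "f \<in> V \<Longrightarrow> ip 0 f = 0"
  using ip_scale_left[of 0 f 0] by simp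

lemma ip_zero_right [simp]: "f \<in> V \<Longrightarrow> ip f 0 = 0"
  using ip_scale_right[of f 0 0] by simp

lemma ip_diff_left: "f \<in> V \<Longrightarrow> g \<in> V \<Longrightarrow> h \<in> V \<Longrightarrow> ip (f - g) h = ip f h - ip g h"
  using ip_add_left[of "f - g" g h] by simp

lemma ip_diff_right: "f \<in> V \<Longrightarrow> g \<in> V \<Longrightarrow> h \<in> V \<Longrightarrow> ip h (f - g) = ip h f - ip h g"
  using ip_add_right[of "f - g" g h] by simp

lemma ip_self: "f \<in> V \<Longrightarrow> ip f f = of_real ((nrm f)\<^sup>2)"
  using ip_commute[of f f] ip_pos[of f]
  by (cases "f = 0") (auto simp: hnorm_def complex_eq_iff)

lemma nrm_ge_0 [simp]: "f \<in> V \<Longrightarrow> nrm f \<ge> 0"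
  using ip_pos[of f] by (cases "f = 0") (auto simp: hnorm_def)

lemma nrm_zero [simp]: "nrm 0 = 0"
  by (simp add: hnorm_def)

lemma nrm_eq_0 [simp]: "f \<in> V \<Longrightarrow> nrm f = 0 \<longleftrightarrow> f = 0"
  using ip_pos[of f] by (cases "f = 0") (auto simp: hnorm_def)

lemma Re_ip_self: "f \<in> V \<Longrightarrow> Re (ip f f) = (nrm f)\<^sup>2"
  by (simp add: ip_self)

lemma nrm_scale [simp]: "f \<in> V \<Longrightarrow> nrm (c *\<^sub>C f) = cmod c * nrm f"
proof -
  assume f: "f \<in> V"
  have "ip (c *\<^sub>C f) (c *\<^sub>C f) = (c * cnj c) * ip f f"
    using f by (simp add: ip_scale_left ip_scale_right mult.assoc)
  also have "\<dots> = of_real ((cmod c * nrm f)\<^sup>2)"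
    using f by (simp add: ip_self complex_norm_square[symmetric] power_mult_distrib)
  finally have "(nrm (c *\<^sub>C f))\<^sup>2 = (cmod c * nrm f)\<^sup>2"
    using f by (simp only: scale_in Re_complex_of_real flip: Re_ip_self)
  then show ?thesis using f by (simp add: power2_eq_iff_nonneg)
qed

lemma nrm_minus_commute: "f \<in> V \<Longrightarrow> g \<in> V \<Longrightarrow> nrm (f - g) = nrm (g - f)"
proof -
  assume "f \<in> V" "g \<in> V"
  moreover have "f - g = (-1) *\<^sub>C (g - f)" by simp
  ultimately show ?thesis by (metis diff_in mult_1 norm_minus_cancel norm_one nrm_scale)
qed

lemma nrm_add_sq: "f \<in> V \<Longrightarrow> g \<in> V \<Longrightarrow> (nrm (f + g))\<^sup>2 = (nrm f)\<^sup>2 + (nrm g)\<^sup>2 + 2 * Re (ip f g)"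
proof -
  assume *: "f \<in> V" "g \<in> V"
  have "Re (ip (f + g) (f + g)) = Re (ip f f) + Re (ip g g) + 2 * Re (ip f g)"
    using * ip_commute[OF *] by (simp add: ip_add_left ip_add_right)
  then show ?thesis using * by (simp add: Re_ip_self)
qed

lemma nrm_diff_sq: "f \<in> V \<Longrightarrow> g \<in> V \<Longrightarrow> (nrm (f - g))\<^sup>2 = (nrm f)\<^sup>2 + (nrm g)\<^sup>2 - 2 * Re (ip f g)"
  using nrm_add_sq[of f "(-1) *\<^sub>C g"] nrm_scale[of g "-1"] ip_scale_right[of f g "-1"] scale_in[of g "-1"]
  by simp

lemma Cauchy_Schwarz: "f \<in> V \<Longrightarrow> g \<in> V \<Longrightarrow> cmod (ip f g) \<le> nrm f * nrm g"
proof (cases "g = 0")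
  case False
  assume *: "f \<in> V" "g \<in> V"
  \<comment> \<open>\<open>c *\<^sub>C g\<close> is the orthogonal projection of \<open>f\<close>
    onto the line of \<open>g\<close>; the inequality is the expansion of the squared norm of
    \<open>f - c *\<^sub>C g\<close>.\<close>
  define c where "c = ip f g / of_real ((nrm g)\<^sup>2)"
  have g: "nrm g > 0" using False * nrm_ge_0[of g] by (simp add: order_less_le)
  have "cnj c * ip f g = of_real ((cmod (ip f g))\<^sup>2 / (nrm g)\<^sup>2)"
    by (simp add: c_def complex_norm_square[symmetric] mult.commute[of "cnj _"])
  then have re: "Re (ip f (c *\<^sub>C g)) = (cmod (ip f g))\<^sup>2 / (nrm g)\<^sup>2"
    using * by (simp only: ip_scale_right Re_complex_of_real)
  have n: "(nrm (c *\<^sub>C g))\<^sup>2 = (cmod (ip f g))\<^sup>2 / (nrm g)\<^sup>2"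
    using * g by (simp add: c_def norm_divide norm_mult power2_eq_square field_simps)
  have "0 \<le> (nrm (f - c *\<^sub>C g))\<^sup>2" by simp
  then have "(cmod (ip f g))\<^sup>2 / (nrm g)\<^sup>2 \<le> (nrm f)\<^sup>2"
    using * by (simp only: nrm_diff_sq scale_in re n)
  then have "(cmod (ip f g))\<^sup>2 \<le> (nrm f * nrm g)\<^sup>2"
    using g by (simp add: power_mult_distrib divide_le_eq)
  then show ?thesis by (rule power2_le_imp_le) (use * in simp)
qed simp

lemma nrm_triangle: "f \<in> V \<Longrightarrow> g \<in> V \<Longrightarrow> nrm (f + g) \<le> nrm f + nrm g"
proof -
  assume *: "f \<in> V" "g \<in> V"
  have "Re (ip f g) \<le> nrm f * nrm g"
    using Cauchy_Schwarz[OF *] complex_Re_le_cmod[of "ip f g"] by linarith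
  then have "(nrm (f + g))\<^sup>2 \<le> (nrm f + nrm g)\<^sup>2"
    using * by (simp add: nrm_add_sq power2_sum)
  then show ?thesis by (rule power2_le_imp_le) (use * in simp)
qed

lemma nrm_triangle_diff: "f \<in> V \<Longrightarrow> g \<in> V \<Longrightarrow> h \<in> V \<Longrightarrow> nrm (f - h) \<le> nrm (f - g) + nrm (g - h)"
  using nrm_triangle[OF diff_in diff_in, of f g g h] by simp

lemma complete:
  assumes "\<And>n. X n \<in> V" "\<And>e. e > 0 \<Longrightarrow> \<exists>N. \<forall>m\<ge>N. \<forall>n\<ge>N. nrm (X m - X n) < e"
  obtains f where "f \<in> V" "(\<lambda>n. nrm (X n - f)) \<longlonglongrightarrow> 0"
proof -
  have "\<exists>f\<in>V. (\<lambda>n. nrm (X n - f)) \<longlonglongrightarrow> 0"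
    using hilbert[unfolded hilbert_space_def, THEN conjunct2, THEN conjunct2, THEN conjunct2,
        THEN conjunct2, THEN conjunct2, rule_format, of X] assms by blast
  with that show thesis by blast
qed

lemma ip_eqI:
  assumes "f \<in> V" "g \<in> V" "\<And>h. h \<in> V \<Longrightarrow> ip h f = ip h g"
  shows "f = g"
proof -
  have "ip (f - g) (f - g) = 0" using assms by (simp add: ip_diff_right)
  then have "nrm (f - g) = 0" by (simp add: hnorm_def)
  then show ?thesis using assms by simp
qed

text \<open>\<open>g\<close> maximises the strictly concave functional \<open>\<lambda>f. 2 * Re (L f) - (nrm f)\<^sup>2\<close>.\<close>

theorem Riesz_representation:
  assumes L_add: "\<And>f g. f \<in> V \<Longrightarrow> g \<in> V \<Longrightarrow> L (f + g) = L f + L g"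
    and L_scale: "\<And>c f. f \<in> V \<Longrightarrow> L (c *\<^sub>C f) = c * L f"
    and bdd: "\<And>f. f \<in> V \<Longrightarrow> cmod (L f) \<le> C * nrm f"
  obtains g where "g \<in> V" "\<And>f. f \<in> V \<Longrightarrow> L f = ip f g"
proof -
  define \<Phi> where "\<Phi> f = 2 * Re (L f) - (nrm f)\<^sup>2" for f
  have ReL: "Re (L f) \<le> C * nrm f" if "f \<in> V" for f
    using bdd[OF that] complex_Re_le_cmod[of "L f"] by linarith
  have \<Phi>_le: "\<Phi> f \<le> C\<^sup>2" if "f \<in> V" for f
    using ReL[OF that] sum_squares_ge_zero[of "C - nrm f" 0]
    by (simp add: \<Phi>_def power2_eq_square algebra_simps)
  define m where "m = (SUP f\<in>V. \<Phi> f)"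
  have bddab: "bdd_above (\<Phi> ` V)" using \<Phi>_le by (rule bdd_aboveI2)
  have \<Phi>_le_m: "\<Phi> f \<le> m" if "f \<in> V" for f
    unfolding m_def by (rule cSUP_upper[OF that bddab])
  have "\<exists>f\<in>V. \<Phi> f > m - e" if "e > 0" for e
    using less_cSUP_iff[OF _ bddab, of "m - e"] that zero_in unfolding m_def[symmetric]
    by (metis diff_less_eq empty_iff less_add_same_cancel1)
  then have "\<forall>n. \<exists>f\<in>V. \<Phi> f > m - inverse (real (Suc n))"
    by (metis inverse_positive_iff_positive of_nat_0_less_iff zero_less_Suc)
  then obtain X where X: "\<And>n. X n \<in> V" "\<And>n. \<Phi> (X n) > m - inverse (real (Suc n))" by metis
  \<comment> \<open>The value of \<Phi> at the midpoint of \<open>f\<close> and \<open>g\<close> is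
    at most \<open>m\<close>. With the parallelogram law this makes near maximisers close to each
    other, so the maximising sequence \<open>X\<close> is Cauchy.\<close>
  have mid: "(nrm (f - g))\<^sup>2 \<le> 2 * (m - \<Phi> f) + 2 * (m - \<Phi> g)" if fg: "f \<in> V" "g \<in> V" for f g
  proof -
    have "\<Phi> ((1/2) *\<^sub>C (f + g)) \<le> m" using fg by (intro \<Phi>_le_m) simp
    moreover have "\<Phi> ((1/2) *\<^sub>C (f + g)) = Re (L f) + Re (L g) - (nrm (f + g))\<^sup>2 / 4"
      using fg by (simp add: \<Phi>_def L_scale L_add power_mult_distrib power_divide)
    ultimately have "Re (L f) + Re (L g) - ((nrm f)\<^sup>2 + (nrm g)\<^sup>2 + 2 * Re (ip f g)) / 4 \<le> m"
      using fg by (simp only: nrm_add_sq)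
    then show ?thesis using nrm_diff_sq[OF fg] unfolding \<Phi>_def by argo
  qed
  have "\<exists>N. \<forall>a\<ge>N. \<forall>b\<ge>N. nrm (X a - X b) < e" if e: "e > 0" for e
  proof -
    obtain N where N: "inverse (real (Suc N)) < e\<^sup>2 / 4"
      using reals_Archimedean[of "e\<^sup>2 / 4"] e by auto
    have "nrm (X a - X b) < e" if ab: "a \<ge> N" "b \<ge> N" for a b
    proof -
      have "inverse (real (Suc a)) \<le> inverse (real (Suc N))" "inverse (real (Suc b)) \<le> inverse (real (Suc N))"
        using ab by (auto intro!: le_imp_inverse_le)
      then have "(nrm (X a - X b))\<^sup>2 < e\<^sup>2"
        using mid[OF X(1) X(1), of a b] X(2)[of a] X(2)[of b] N by argo
      then show ?thesis by (rule power_less_imp_less_base) (use e in simp)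
    qed
    then show ?thesis by blast
  qed
  then obtain g where g: "g \<in> V" and lim: "(\<lambda>n. nrm (X n - g)) \<longlonglongrightarrow> 0"
    using complete[of X] X(1) by metis
  have \<Phi>g: "\<Phi> g = m"
  proof (rule antisym[OF \<Phi>_le_m[OF g]], rule LIMSEQ_le_const2)
    \<comment> \<open>Expand \<Phi> at \<open>X n = g + v\<close>; the quadratic term in
      \<open>v\<close> is dropped, which has the right sign, and the linear ones are small.\<close>
    have "m - inverse (real (Suc n)) - (2 * (C + nrm g)) * nrm (X n - g) \<le> \<Phi> g" for n
    proof -
      define v where "v = X n - g"
      have v: "v \<in> V" and Xn: "X n = g + v" using X(1) g by (auto simp: v_def)
      have "\<Phi> (X n) \<le> \<Phi> g + 2 * Re (L v) - 2 * Re (ip g v)"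
        unfolding Xn using g v by (simp add: \<Phi>_def L_add nrm_add_sq)
      moreover have "- Re (ip g v) \<le> nrm g * nrm v"
        using Cauchy_Schwarz[OF g v] abs_Re_le_cmod[of "ip g v"] by linarith
      ultimately show ?thesis using X(2)[of n] ReL[OF v] unfolding v_def[symmetric]
        by (simp add: algebra_simps)
    qed
    then show "\<exists>N. \<forall>n\<ge>N. m - inverse (real (Suc n)) - (2 * (C + nrm g)) * nrm (X n - g) \<le> \<Phi> g" by blast
    have "(\<lambda>n. m - inverse (real (Suc n)) - (2 * (C + nrm g)) * nrm (X n - g)) \<longlonglongrightarrow> m - 0 - (2 * (C + nrm g)) * 0"
      by (intro tendsto_intros lim LIMSEQ_inverse_real_of_nat)
    then show "(\<lambda>n. m - inverse (real (Suc n)) - (2 * (C + nrm g)) * nrm (X n - g)) \<longlonglongrightarrow> m" by simp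
  qed
  have "L f = ip f g" if f: "f \<in> V" for f
  proof -
    define d where "d = L f - ip f g"
    \<comment> \<open>Moving \<open>g\<close> by a multiple of \<open>cnj d *\<^sub>C f\<close>
      changes the linear part of \<Phi> by a real multiple of \<open>(cmod d)\<^sup>2\<close>;
      maximality at \<open>g\<close> then forces \<open>d = 0\<close>.\<close>
    define c where "c = cnj d"
    have "\<epsilon> * (2 * (cmod d)\<^sup>2) \<le> \<epsilon>\<^sup>2 * (cmod d * nrm f)\<^sup>2" for \<epsilon> :: real
    proof -
      let ?h = "(of_real \<epsilon> * c) *\<^sub>C f"
      have h: "?h \<in> V" using f by simp
      have "\<Phi> (g + ?h) \<le> \<Phi> g" unfolding \<Phi>g using g h by (intro \<Phi>_le_m) blast
      then have "2 * Re (L ?h) - 2 * Re (ip g ?h) \<le> (nrm ?h)\<^sup>2"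
        using g h by (simp add: \<Phi>_def L_add nrm_add_sq)
      moreover have "Re (ip g ?h) = Re (ip ?h g)" using ip_commute[OF h g] by simp
      moreover have "L ?h - ip ?h g = of_real \<epsilon> * c * d"
        unfolding L_scale[OF f] ip_scale_left[OF f g] d_def by (simp add: algebra_simps)
      then have "L ?h - ip ?h g = of_real \<epsilon> * of_real ((cmod d)\<^sup>2)"
        unfolding complex_norm_square c_def by (simp only: mult_ac)
      then have "L ?h - ip ?h g = of_real (\<epsilon> * (cmod d)\<^sup>2)" by (simp only: of_real_mult)
      then have "Re (L ?h) - Re (ip ?h g) = \<epsilon> * (cmod d)\<^sup>2"
        by (metis Re_complex_of_real minus_complex.sel(1))
      ultimately show ?thesis using f by (simp add: norm_mult c_def power_mult_distrib)
    qed
    then have "2 * (cmod d)\<^sup>2 \<le> 0" by (rule linear_le_quadratic_imp_le_0)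
    then show ?thesis by (simp add: d_def)
  qed
  with g that show thesis by blast
qed

text \<open>Baire: otherwise \<open>{f. \<exists>N. p N f > n}\<close> is open and dense for every \<open>n\<close>.\<close>

theorem uniform_boundedness:
  fixes p :: "nat \<Rightarrow> 'a \<Rightarrow> real"
  assumes tri: "\<And>N f g. f \<in> V \<Longrightarrow> g \<in> V \<Longrightarrow> p N (f + g) \<le> p N f + p N g"
    and hom: "\<And>N c f. f \<in> V \<Longrightarrow> p N (c *\<^sub>C f) = cmod c * p N f"
    and bdd: "\<And>N f. f \<in> V \<Longrightarrow> p N f \<le> C N * nrm f"
    and pointwise: "\<And>f. f \<in> V \<Longrightarrow> \<exists>B. \<forall>N. p N f \<le> B"
  obtains B where "\<And>N f. f \<in> V \<Longrightarrow> p N f \<le> B * nrm f"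
proof (rule ccontr)
  assume "\<not> thesis"
  then have unb: "\<exists>N f. f \<in> V \<and> p N f > B * nrm f" for B
    using that by (meson not_le)
  \<comment> \<open>\<open>Metric_space\<close> asks for nonnegativity and symmetry on the whole
    type, while nothing is known of \<open>nrm\<close> off \<open>V\<close>; hence the value 0
    there.\<close>
  define d where "d f g = (if f \<in> V \<and> g \<in> V then nrm (f - g) else 0)" for f g
  have dV: "d f g = nrm (f - g)" if "f \<in> V" "g \<in> V" for f g using that by (simp add: d_def)
  interpret M: Metric_space V d
  proof
    show "d x y = 0 \<longleftrightarrow> x = y" if "x \<in> V" "y \<in> V" for x y using that by (simp add: dV)
    show "d x z \<le> d x y + d y z" if "x \<in> V" "y \<in> V" "z \<in> V" for x y z
      using that nrm_triangle_diff by (simp add: dV)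
  qed (auto simp: d_def nrm_minus_commute)
  have complete: "M.mcomplete"
    unfolding M.mcomplete_def
  proof (intro allI impI)
    fix X assume X: "M.MCauchy X"
    then have XV: "X n \<in> V" for n by (auto simp: M.MCauchy_def)
    have "\<exists>N. \<forall>m\<ge>N. \<forall>n\<ge>N. nrm (X m - X n) < e" if "e > 0" for e
      using X that XV unfolding M.MCauchy_def by (simp add: dV)
    then obtain f where f: "f \<in> V" "(\<lambda>n. nrm (X n - f)) \<longlonglongrightarrow> 0"
      using complete[of X] XV by metis
    have "\<forall>\<^sub>F n in sequentially. X n \<in> V \<and> d (X n) f < e" if "e > 0" for e
      using order_tendstoD(2)[OF f(2) that] by eventually_elim (simp add: XV f dV)
    then show "\<exists>x. limitin M.mtopology X x sequentially"
      using f(1) by (auto simp: M.limitin_metric)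
  qed
  define U where "U n = {f \<in> V. \<exists>N. p N f > real n}" for n
  have opn: "openin M.mtopology (U n)" for n
    unfolding M.openin_mtopology
  proof (intro conjI allI impI)
    fix f assume "f \<in> U n"
    then obtain N where f: "f \<in> V" and N: "p N f > real n" by (auto simp: U_def)
    \<comment> \<open>By subadditivity \<open>p N\<close> drops by at most \<open>C N\<close> times
      the distance from \<open>f\<close>, so within this radius it stays above \<open>n\<close>; the
      added 1 keeps the denominator positive.\<close>
    define r where "r = (p N f - real n) / (\<bar>C N\<bar> + 1)"
    have "r > 0" using N by (simp add: r_def)
    moreover have "M.mball f r \<subseteq> U n"
    proof
      fix g assume "g \<in> M.mball f r"
      then have g: "g \<in> V" "nrm (f - g) < r" using f by (auto simp: dV)
      have "p N f \<le> p N g + p N (f - g)" using tri[OF g(1) diff_in[OF f g(1)], of N] by simp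
      also have "p N (f - g) \<le> C N * nrm (f - g)" using f g by (intro bdd) auto
      also have "\<dots> \<le> (\<bar>C N\<bar> + 1) * nrm (f - g)" using f g by (intro mult_right_mono) auto
      also have "\<dots> < (\<bar>C N\<bar> + 1) * r" using g by (intro mult_strict_left_mono) auto
      also have "\<dots> = p N f - real n" by (simp add: r_def)
      finally show "g \<in> U n" using g by (auto simp: U_def)
    qed
    ultimately show "\<exists>r>0. M.mball f r \<subseteq> U n" by blast
  qed (auto simp: U_def)
  have dense: "M.mtopology closure_of U n = V" for n
  proof -
    have "\<exists>g\<in>U n. g \<in> M.mball f r" if f: "f \<in> V" and r: "r > 0" for f r
    proof -
      \<comment> \<open>The factor \<open>2 * real n / r\<close> is chosen so that \<open>h\<close>,
        rescaled to norm \<open>r / 2\<close>, has \<open>p N\<close> above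
        \<open>n\<close>.\<close>
      obtain N h where h: "h \<in> V" "p N h > (2 * real n / r) * nrm h" using unb by blast
      have h0: "h \<noteq> 0" using h(2) bdd[of 0 N] by auto
      then have nh: "nrm h > 0" using h nrm_ge_0[of h] by (simp add: order_less_le)
      define k where "k = of_real (r / (2 * nrm h)) *\<^sub>C h"
      have k: "k \<in> V" "nrm k = r / 2" using h nh h0 r by (simp_all add: k_def norm_divide)
      have "p N k = r / (2 * nrm h) * p N h" using h nh h0 r by (simp add: k_def hom norm_divide)
      also have "\<dots> > r / (2 * nrm h) * ((2 * real n / r) * nrm h)"
        using h nh h0 r by (intro mult_strict_left_mono) auto
      finally have pk: "p N k > real n" using nh h0 h(1) r by simp
      \<comment> \<open>\<open>k\<close> is half the difference of \<open>f + k\<close> and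
        \<open>f - k\<close>, so one of these two points of the ball has \<open>p N\<close> above
        \<open>n\<close>.\<close>
      have "2 *\<^sub>C k = (f + k) + (-1) *\<^sub>C (f - k)"
        using scaleC_add_left[of 1 1 k] by (simp add: scaleC_one)
      then have "2 * p N k = p N ((f + k) + (-1) *\<^sub>C (f - k))" using hom[OF k(1), of N 2] by simp
      also have "\<dots> \<le> p N (f + k) + p N (f - k)"
        using tri[of "f + k" "(-1) *\<^sub>C (f - k)" N] hom[of "f - k" N "-1"] f k by auto
      finally have "p N (f + k) > real n \<or> p N (f - k) > real n" using pk by linarith
      moreover have "f + k \<in> M.mball f r" "f - k \<in> M.mball f r"
        using f k r nrm_scale[of k "-1"] by (auto simp: dV)
      ultimately show ?thesis using f k by (auto simp: U_def)
    qed
    then show ?thesis unfolding M.metric_closure_of by blast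
  qed
  have "M.mtopology closure_of \<Inter>(range U) = V"
    using opn dense by (intro M.metric_Baire_category complete) auto
  then have "\<Inter>(range U) \<noteq> {}" using zero_in by (metis closure_of_empty empty_iff)
  then obtain f where f: "\<And>n. f \<in> U n" by blast
  then have "f \<in> V" by (auto simp: U_def)
  then obtain B where B: "\<And>N. p N f \<le> B" using pointwise by blast
  obtain n where "B < real n" using reals_Archimedean2 by blast
  moreover obtain N where "p N f > real n" using f[of n] by (auto simp: U_def)
  ultimately show False using B[of N] by linarith
qed

end

section \<open>Bounded operators and TROs\<close>

lemma bounded_opsI:
  assumes "\<And>f. f \<in> hcarrier H \<Longrightarrow> x f \<in> hcarrier K" "\<And>f. f \<notin> hcarrier H \<Longrightarrow> x f = 0"
    "\<And>f g. f \<in> hcarrier H \<Longrightarrow> g \<in> hcarrier H \<Longrightarrow> x (f + g) = x f + x g"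
    "\<And>c f. f \<in> hcarrier H \<Longrightarrow> x (c *\<^sub>C f) = c *\<^sub>C x f"
    "\<And>f. f \<in> hcarrier H \<Longrightarrow> hnorm K (x f) \<le> C * hnorm H f"
  shows "x \<in> bounded_ops H K"
  unfolding bounded_ops_def using assms by blast

lemma
  assumes "x \<in> bounded_ops H K"
  shows bop_in [simp, intro]: "f \<in> hcarrier H \<Longrightarrow> x f \<in> hcarrier K"
    and bop_outside: "f \<notin> hcarrier H \<Longrightarrow> x f = 0"
    and bop_add: "f \<in> hcarrier H \<Longrightarrow> g \<in> hcarrier H \<Longrightarrow> x (f + g) = x f + x g"
    and bop_scale: "f \<in> hcarrier H \<Longrightarrow> x (c *\<^sub>C f) = c *\<^sub>C x f"
  using assms unfolding bounded_ops_def by auto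

lemma bop_ext:
  assumes "x \<in> bounded_ops H K" "y \<in> bounded_ops H K" "\<And>f. f \<in> hcarrier H \<Longrightarrow> x f = y f"
  shows "x = y"
proof
  fix f show "x f = y f"
    using assms bop_outside[of x H K f] bop_outside[of y H K f] by (cases "f \<in> hcarrier H") auto
qed

text \<open>The witness \<open>f0\<close> makes the real supremum range over a nonempty set.\<close>

lemma op_normI:
  assumes "f0 \<in> hcarrier H" "hnorm H f0 \<le> 1"
    "\<And>f. f \<in> hcarrier H \<Longrightarrow> hnorm H f \<le> 1 \<Longrightarrow> hnorm K (x f) \<le> c"
  shows "op_norm H K x \<le> c"
  unfolding op_norm_def by (rule cSUP_least) (use assms in auto)

text \<open>The first assumption makes the real supremum bounded. \<open>H\<close> and
  \<open>K\<close> may be any inner product data here, so that the lemma applies to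
  \<open>hilb_power\<close> directly.\<close>

lemma op_normD:
  assumes "\<And>f. f \<in> hcarrier H \<Longrightarrow> hnorm H f \<le> 1 \<Longrightarrow> hnorm K (x f) \<le> c"
    "f \<in> hcarrier H" "hnorm H f \<le> 1"
  shows "hnorm K (x f) \<le> op_norm H K x"
  unfolding op_norm_def
proof (rule cSUP_upper)
  show "bdd_above ((\<lambda>f. hnorm K (x f)) ` {f \<in> hcarrier H. hnorm H f \<le> 1})"
    by (rule bdd_aboveI2[of _ _ c]) (use assms(1) in auto)
qed (use assms in auto)

locale hilb_pair = H: hilb_space H + K: hilb_space K
  for H :: "'a::complex_space hilb" and K :: "'b::complex_space hilb"
begin

lemma bop_bound:
  assumes "x \<in> bounded_ops H K"
  obtains C where "C > 0" "\<And>f. f \<in> H.V \<Longrightarrow> K.nrm (x f) \<le> C * H.nrm f"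
proof -
  obtain C where C: "\<forall>f\<in>H.V. K.nrm (x f) \<le> C * H.nrm f"
    using assms unfolding bounded_ops_def by auto
  have "K.nrm (x f) \<le> (\<bar>C\<bar> + 1) * H.nrm f" if "f \<in> H.V" for f
  proof -
    have "C * H.nrm f \<le> (\<bar>C\<bar> + 1) * H.nrm f" using that by (intro mult_right_mono) auto
    with C that show ?thesis by force
  qed
  then show thesis using that[of "\<bar>C\<bar> + 1"] by auto
qed

lemma bop_zero [simp]: "x \<in> bounded_ops H K \<Longrightarrow> x 0 = 0"
  using bop_scale[of x H K 0 0] by auto

lemma bop_diff: "x \<in> bounded_ops H K \<Longrightarrow> f \<in> H.V \<Longrightarrow> g \<in> H.V \<Longrightarrow> x (f - g) = x f - x g"
  using bop_add[of x H K "f - g" g] by auto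

lemma zero_bop: "0 \<in> bounded_ops H K"
  by (rule bounded_opsI[where C=0]) (auto simp: zero_fun_def[symmetric])

lemma bop_add_op:
  assumes "x \<in> bounded_ops H K" "y \<in> bounded_ops H K"
  shows "x + y \<in> bounded_ops H K"
proof -
  obtain C where C: "\<And>f. f \<in> H.V \<Longrightarrow> K.nrm (x f) \<le> C * H.nrm f" using bop_bound[OF assms(1)] by blast
  obtain D where D: "\<And>f. f \<in> H.V \<Longrightarrow> K.nrm (y f) \<le> D * H.nrm f" using bop_bound[OF assms(2)] by blast
  show ?thesis
  proof (rule bounded_opsI[where C="C + D"])
    fix f assume f: "f \<in> H.V"
    have "K.nrm (x f + y f) \<le> K.nrm (x f) + K.nrm (y f)"
      using assms f by (intro K.nrm_triangle) auto
    then show "K.nrm ((x + y) f) \<le> (C + D) * H.nrm f"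
      using C[OF f] D[OF f] by (simp add: plus_fun_def algebra_simps)
  qed (use assms in \<open>auto simp: plus_fun_def bop_add bop_scale bop_outside scaleC_add_right\<close>)
qed

lemma bop_scale_op:
  assumes "x \<in> bounded_ops H K"
  shows "c *\<^sub>C x \<in> bounded_ops H K"
proof -
  obtain C where C: "\<And>f. f \<in> H.V \<Longrightarrow> K.nrm (x f) \<le> C * H.nrm f" using bop_bound[OF assms(1)] by blast
  show ?thesis
  proof (rule bounded_opsI[where C="cmod c * C"])
    fix f assume f: "f \<in> H.V"
    then show "K.nrm ((c *\<^sub>C x) f) \<le> cmod c * C * H.nrm f"
      using C[OF f] assms by (simp add: scaleC_fun_def mult.assoc mult_left_mono)
  qed (use assms in \<open>auto simp: scaleC_fun_def bop_add bop_scale bop_outside scaleC_add_right scaleC_scaleC mult.commute\<close>)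
qed

lemma bounded_ops_subspace: "csubspace (bounded_ops H K)"
  by (rule complex_space.subspaceI) (auto intro: zero_bop bop_add_op bop_scale_op)

text \<open>Vectors with equal inner products against all of \<open>H.V\<close> coincide, so the
  definite description in \<open>op_adj\<close> has the value \<open>h\<close>. Later facts on
  adjoints rest on this lemma.\<close>

lemma op_adj_unique:
  assumes "x \<in> bounded_ops H K" "k \<in> K.V" "h \<in> H.V" "\<And>f. f \<in> H.V \<Longrightarrow> K.ip (x f) k = H.ip f h"
  shows "op_adj H K x k = h"
proof -
  have "(THE h. h \<in> H.V \<and> (\<forall>f\<in>H.V. K.ip (x f) k = H.ip f h)) = h"
    using assms by (intro the_equality) (auto intro: H.ip_eqI)
  then show ?thesis using assms by (simp add: op_adj_def)
qed

text \<open>Riesz representation of the functional taking \<open>f\<close> to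
  \<open>K.ip (x f) k\<close>, which is bounded by Cauchy-Schwarz.\<close>

lemma op_adj_exists:
  assumes x: "x \<in> bounded_ops H K" and k: "k \<in> K.V"
  obtains h where "h \<in> H.V" "\<And>f. f \<in> H.V \<Longrightarrow> K.ip (x f) k = H.ip f h"
proof -
  obtain C where C: "\<And>f. f \<in> H.V \<Longrightarrow> K.nrm (x f) \<le> C * H.nrm f" using bop_bound[OF x] by blast
  show thesis
  proof (rule H.Riesz_representation[of "\<lambda>f. K.ip (x f) k" "C * K.nrm k"])
    fix f assume f: "f \<in> H.V"
    have "cmod (K.ip (x f) k) \<le> K.nrm (x f) * K.nrm k" using f x k by (intro K.Cauchy_Schwarz) auto
    also have "\<dots> \<le> C * H.nrm f * K.nrm k" using C[OF f] k by (intro mult_right_mono) auto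
    finally show "cmod (K.ip (x f) k) \<le> C * K.nrm k * H.nrm f" by (simp add: mult_ac)
  qed (use x k that in \<open>auto simp: bop_add[OF x] bop_scale[OF x] K.ip_add_left K.ip_scale_left\<close>)
qed

lemma
  assumes x: "x \<in> bounded_ops H K" and k: "k \<in> K.V"
  shows op_adj_in [simp, intro]: "op_adj H K x k \<in> H.V"
    and ip_op_adj: "f \<in> H.V \<Longrightarrow> H.ip f (op_adj H K x k) = K.ip (x f) k"
  using op_adj_exists[OF x k] op_adj_unique[OF x k] by metis+

lemma op_adj_bop:
  assumes x: "x \<in> bounded_ops H K"
  shows "op_adj H K x \<in> bounded_ops K H"
proof -
  obtain C where C: "\<And>f. f \<in> H.V \<Longrightarrow> K.nrm (x f) \<le> C * H.nrm f" "C > 0" using bop_bound[OF x] by blast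
  show ?thesis
  proof (rule bounded_opsI[where C=C])
    fix k assume k: "k \<in> K.V"
    let ?h = "op_adj H K x k"
    have h: "?h \<in> H.V" using x k by simp
    \<comment> \<open>The squared norm of \<open>?h\<close> is the inner product of
      \<open>x ?h\<close> with \<open>k\<close>; Cauchy-Schwarz and cancelling one factor carry the
      bound of \<open>x\<close> over to its adjoint.\<close>
    have "complex_of_real ((H.nrm ?h)\<^sup>2) = K.ip (x ?h) k"
      using ip_op_adj[OF x k h] by (simp only: H.ip_self h)
    then have "(H.nrm ?h)\<^sup>2 = cmod (K.ip (x ?h) k)"
      by (metis abs_power2 norm_of_real real_norm_def)
    also have "\<dots> \<le> K.nrm (x ?h) * K.nrm k" using h k x by (intro K.Cauchy_Schwarz) auto
    also have "\<dots> \<le> C * H.nrm ?h * K.nrm k" using C(1)[OF h] k by (intro mult_right_mono) auto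
    finally have "H.nrm ?h * H.nrm ?h \<le> (C * K.nrm k) * H.nrm ?h" by (simp add: power2_eq_square mult_ac)
    then show "H.nrm ?h \<le> C * K.nrm k"
      using h k C(2) H.nrm_ge_0[OF h] by (cases "H.nrm ?h = 0") (auto simp: mult_le_cancel_right)
  next
    fix k l assume "k \<in> K.V" "l \<in> K.V"
    then show "op_adj H K x (k + l) = op_adj H K x k + op_adj H K x l"
      using x by (intro op_adj_unique) (auto simp: H.ip_add_right K.ip_add_right ip_op_adj)
  next
    fix c k assume "k \<in> K.V"
    then show "op_adj H K x (c *\<^sub>C k) = c *\<^sub>C op_adj H K x k"
      using x by (intro op_adj_unique) (auto simp: H.ip_scale_right K.ip_scale_right ip_op_adj)
  next
    fix k assume "k \<notin> K.V"
    then show "op_adj H K x k = 0" by (simp add: op_adj_def)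
  qed (use x in simp)
qed

lemma op_norm_le:
  assumes "\<And>f. f \<in> H.V \<Longrightarrow> K.nrm (x f) \<le> c * H.nrm f" "c \<ge> 0"
  shows "op_norm H K x \<le> c"
proof (rule op_normI[OF H.zero_in])
  fix f assume "f \<in> H.V" "H.nrm f \<le> 1"
  then show "K.nrm (x f) \<le> c" using assms(1)[of f] mult_left_le[of "H.nrm f" c] assms(2) by auto
qed simp

end

lemma bop_comp:
  assumes "hilbert_space H" "hilbert_space K" "hilbert_space L"
    and x: "x \<in> bounded_ops H K" and y: "y \<in> bounded_ops K L"
  shows "y \<circ> x \<in> bounded_ops H L"
proof -
  interpret HK: hilb_pair H K using assms by (simp add: hilb_pair_def hilb_space_def)
  interpret KL: hilb_pair K L using assms by (simp add: hilb_pair_def hilb_space_def)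
  obtain C where C: "\<And>f. f \<in> hcarrier H \<Longrightarrow> hnorm K (x f) \<le> C * hnorm H f" using HK.bop_bound[OF x] by blast
  obtain D where D: "\<And>f. f \<in> hcarrier K \<Longrightarrow> hnorm L (y f) \<le> D * hnorm K f" "D > 0" using KL.bop_bound[OF y] by blast
  show ?thesis
  proof (rule bounded_opsI[where C="D * C"])
    fix f assume f: "f \<in> hcarrier H"
    have "hnorm L (y (x f)) \<le> D * hnorm K (x f)" using f x by (intro D) auto
    also have "\<dots> \<le> D * (C * hnorm H f)" using C[OF f] D(2) by simp
    finally show "hnorm L ((y \<circ> x) f) \<le> D * C * hnorm H f" by (simp add: mult.assoc)
  qed (use x y in \<open>auto simp: bop_add[OF x] bop_add[OF y] bop_scale[OF x] bop_scale[OF y]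
      bop_outside[OF x] bop_in[OF x] bop_in[OF y]\<close>)
qed

section \<open>Ternary rings of operators and the one generated by a set\<close>

lemma TRO_subspace: "TRO H K T \<Longrightarrow> csubspace T"
  and TRO_subset: "TRO H K T \<Longrightarrow> T \<subseteq> bounded_ops H K"
  by (simp_all add: TRO_def operator_space_def)

lemma TRO_closed:
  assumes "TRO H K T" "\<And>n. X n \<in> T" "x \<in> bounded_ops H K" "(\<lambda>n. op_norm H K (X n - x)) \<longlonglongrightarrow> 0"
  shows "x \<in> T"
  using assms(1)[unfolded TRO_def, THEN conjunct2, THEN conjunct1, rule_format, of x X] assms(2-) by simp

lemma TRO_ternary:
  assumes "TRO H K T" "x \<in> T" "y \<in> T" "z \<in> T"
  shows "x \<circ> op_adj H K y \<circ> z \<in> T"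
  using assms(1)[unfolded TRO_def, THEN conjunct2, THEN conjunct2, rule_format, of x y z] assms(2-) by simp

context hilb_pair
begin

lemma TRO_bounded_ops: "TRO H K (bounded_ops H K)"
  unfolding TRO_def operator_space_def
  using H.hilbert K.hilbert bounded_ops_subspace by (simp add: bop_comp op_adj_bop)

text \<open>Every closure condition passes to intersections. The full operator space belongs to the
  family, so the intersection consists of bounded operators.\<close>

lemma TRO_generated_TRO:
  assumes "M \<subseteq> bounded_ops H K"
  shows "TRO H K (generated_TRO H K M)"
proof -
  define \<T> where "\<T> = {T. TRO H K T \<and> M \<subseteq> T}"
  have B: "bounded_ops H K \<in> \<T>" using TRO_bounded_ops assms by (simp add: \<T>_def)
  have T: "TRO H K T" if "T \<in> \<T>" for T
    using that by (simp add: \<T>_def)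
  have "csubspace (\<Inter>\<T>)"
    by (rule complex_space.subspace_Inter) (simp add: TRO_subspace[OF T])
  moreover have "\<Inter>\<T> \<subseteq> bounded_ops H K" using B by (rule Inter_lower)
  moreover have "x \<in> \<Inter>\<T>"
    if x: "x \<in> bounded_ops H K" and X: "(\<forall>n. X n \<in> \<Inter>\<T>) \<and> (\<lambda>n. op_norm H K (X n - x)) \<longlonglongrightarrow> 0" for X x
  proof
    fix S assume S: "S \<in> \<T>"
    show "x \<in> S" by (rule TRO_closed[OF T[OF S] _ x conjunct2[OF X]]) (use X S in simp)
  qed
  moreover have "x \<circ> op_adj H K y \<circ> z \<in> \<Inter>\<T>" if "x \<in> \<Inter>\<T>" "y \<in> \<Inter>\<T>" "z \<in> \<Inter>\<T>" for x y z
  proof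
    fix S assume S: "S \<in> \<T>"
    show "x \<circ> op_adj H K y \<circ> z \<in> S" by (rule TRO_ternary[OF T[OF S]]) (use that S in simp_all)
  qed
  ultimately have "TRO H K (\<Inter>\<T>)"
    unfolding TRO_def operator_space_def
    by (intro conjI allI ballI impI H.hilbert K.hilbert) assumption+
  then show ?thesis by (simp add: generated_TRO_def \<T>_def)
qed

end

section \<open>Complete contractions\<close>

lemma power_carrier [simp]:
  "h \<in> hcarrier (hilb_power n H) \<longleftrightarrow> (\<forall>i<n. h i \<in> hcarrier H) \<and> (\<forall>i\<ge>n. h i = 0)"
  by (simp add: hilb_power_def)

context hilb_space
begin

lemma
  assumes "\<And>i. i < n \<Longrightarrow> h i \<in> V"
  shows hnorm_power_sq: "(hnorm (hilb_power n H) h)\<^sup>2 = (\<Sum>i<n. (nrm (h i))\<^sup>2)"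
    and hnorm_power_nonneg: "hnorm (hilb_power n H) h \<ge> 0"
proof -
  have "hnorm (hilb_power n H) h = sqrt (\<Sum>i<n. Re (ip (h i) (h i)))"
    by (simp add: hnorm_def hilb_power_def)
  also have "\<dots> = sqrt (\<Sum>i<n. (nrm (h i))\<^sup>2)"
    using assms by (simp add: Re_ip_self)
  finally have eq: "hnorm (hilb_power n H) h = sqrt (\<Sum>i<n. (nrm (h i))\<^sup>2)" .
  have "(\<Sum>i<n. (nrm (h i))\<^sup>2) \<ge> 0" by (intro sum_nonneg) simp
  then show "(hnorm (hilb_power n H) h)\<^sup>2 = (\<Sum>i<n. (nrm (h i))\<^sup>2)" "hnorm (hilb_power n H) h \<ge> 0"
    by (simp_all add: eq)
qed

end

context hilb_pair
begin

lemma matrix_op_in: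
  fixes n :: nat
  assumes "\<And>i j. i < n \<Longrightarrow> j < n \<Longrightarrow> x i j \<in> bounded_ops H K" "\<And>i. i < n \<Longrightarrow> h i \<in> H.V" "i < n"
  shows "(\<Sum>j<n. x i j (h j)) \<in> K.V"
  by (intro K.sum_in bop_in[OF assms(1) assms(2)] assms(3)) simp_all

lemma hnorm_matrix_op_sq:
  assumes x: "\<And>i j. i < n \<Longrightarrow> j < n \<Longrightarrow> x i j \<in> bounded_ops H K" and h: "h \<in> hcarrier (hilb_power n H)"
  shows "(hnorm (hilb_power n K) (matrix_op n H x h))\<^sup>2 = (\<Sum>i<n. (K.nrm (\<Sum>j<n. x i j (h j)))\<^sup>2)"
  using h matrix_op_in[of n x h, OF x]
  by (subst K.hnorm_power_sq) (auto simp: matrix_op_def)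

text \<open>A crude bound from the bounds of the entries. It serves to make the supremum in
  \<open>op_norm\<close> finite; its size is irrelevant.\<close>

lemma matrix_op_bound:
  assumes x: "\<And>i j. i < n \<Longrightarrow> j < n \<Longrightarrow> x i j \<in> bounded_ops H K"
  shows "\<exists>C. \<forall>h\<in>hcarrier (hilb_power n H). hnorm (hilb_power n H) h \<le> 1 \<longrightarrow>
    hnorm (hilb_power n K) (matrix_op n H x h) \<le> C"
proof -
  have "\<exists>C. C > 0 \<and> (\<forall>f\<in>H.V. K.nrm (x i j f) \<le> C * H.nrm f)" if "i < n" "j < n" for i j
    using bop_bound[OF x[OF that]] by metis
  then obtain C where C: "\<And>i j. i < n \<Longrightarrow> j < n \<Longrightarrow> C i j > 0"
    "\<And>i j f. i < n \<Longrightarrow> j < n \<Longrightarrow> f \<in> H.V \<Longrightarrow> K.nrm (x i j f) \<le> C i j * H.nrm f" by metis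
  have tri: "K.nrm (sum g A) \<le> (\<Sum>i\<in>A. K.nrm (g i))" if "finite A" "\<And>i. i \<in> A \<Longrightarrow> g i \<in> K.V" for g and A :: "nat set"
    using that
  proof (induction A rule: finite_induct)
    case (insert a A)
    have "K.nrm (g a + sum g A) \<le> K.nrm (g a) + K.nrm (sum g A)"
      using insert by (intro K.nrm_triangle K.sum_in) auto
    with insert show ?case by simp
  qed simp
  show ?thesis
  proof (intro exI ballI impI)
    fix h assume h: "h \<in> hcarrier (hilb_power n H)" and le: "hnorm (hilb_power n H) h \<le> 1"
    then have hi: "h i \<in> H.V" if "i < n" for i using that by simp
    have "(\<Sum>i<n. (H.nrm (h i))\<^sup>2) \<le> 1"
      using le H.hnorm_power_sq[of n h] H.hnorm_power_nonneg[of n h] hi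
        power_le_one[of "hnorm (hilb_power n H) h" 2] by simp
    moreover have "(H.nrm (h i))\<^sup>2 \<le> (\<Sum>i<n. (H.nrm (h i))\<^sup>2)" if "i < n" for i
      by (rule member_le_sum) (use that in auto)
    ultimately have nh: "H.nrm (h i) \<le> 1" if "i < n" for i
      using that H.nrm_ge_0[OF hi[OF that]] by (metis abs_of_nonneg abs_square_le_1 order_trans)
    have "(hnorm (hilb_power n K) (matrix_op n H x h))\<^sup>2 = (\<Sum>i<n. (K.nrm (\<Sum>j<n. x i j (h j)))\<^sup>2)"
      by (rule hnorm_matrix_op_sq[OF x h])
    also have "\<dots> \<le> (\<Sum>i<n. (\<Sum>j<n. C i j)\<^sup>2)"
    proof (intro sum_mono power_mono)
      fix i assume i: "i \<in> {..<n}"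
      have "K.nrm (\<Sum>j<n. x i j (h j)) \<le> (\<Sum>j<n. K.nrm (x i j (h j)))"
        by (rule tri) (use i bop_in[OF x hi] in auto)
      also have "\<dots> \<le> (\<Sum>j<n. C i j)"
      proof (rule sum_mono)
        fix j assume j: "j \<in> {..<n}"
        have "K.nrm (x i j (h j)) \<le> C i j * H.nrm (h j)" using C(2) i j hi by simp
        also have "\<dots> \<le> C i j" using C(1)[of i j] i j nh[of j] by (simp add: mult_left_le)
        finally show "K.nrm (x i j (h j)) \<le> C i j" .
      qed
      finally show "K.nrm (\<Sum>j<n. x i j (h j)) \<le> (\<Sum>j<n. C i j)" .
      show "0 \<le> K.nrm (\<Sum>j<n. x i j (h j))"
        using i by (intro K.nrm_ge_0 matrix_op_in x hi) auto
    qed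
    finally show "hnorm (hilb_power n K) (matrix_op n H x h) \<le> sqrt (\<Sum>i<n. (\<Sum>j<n. C i j)\<^sup>2)"
      by (rule real_le_rsqrt)
  qed
qed

text \<open>Together with \<open>matrix_norm_bound\<close> this translates matrix norms into
  inequalities between sums of squares, the form in which all estimates below are made.\<close>

lemma matrix_norm_le:
  assumes x: "\<And>i j. i < n \<Longrightarrow> j < n \<Longrightarrow> x i j \<in> bounded_ops H K" and "c \<ge> 0"
    and le: "\<And>h. (\<And>i. i < n \<Longrightarrow> h i \<in> H.V) \<Longrightarrow>
      (\<Sum>i<n. (K.nrm (\<Sum>j<n. x i j (h j)))\<^sup>2) \<le> c\<^sup>2 * (\<Sum>j<n. (H.nrm (h j))\<^sup>2)"
  shows "matrix_norm n H K x \<le> c"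
  unfolding matrix_norm_def
proof (rule op_normI[of 0])
  show "hnorm (hilb_power n H) 0 \<le> 1"
    using H.hnorm_power_sq[of n 0] by simp
  fix h assume h: "h \<in> hcarrier (hilb_power n H)" "hnorm (hilb_power n H) h \<le> 1"
  then have hi: "\<And>i. i < n \<Longrightarrow> h i \<in> H.V" by simp
  have "(\<Sum>j<n. (H.nrm (h j))\<^sup>2) \<le> 1"
    using h(2) H.hnorm_power_sq[of n h] H.hnorm_power_nonneg[of n h] hi
      power_le_one[of "hnorm (hilb_power n H) h" 2] by simp
  then have "c\<^sup>2 * (\<Sum>j<n. (H.nrm (h j))\<^sup>2) \<le> c\<^sup>2" by (simp add: mult_left_le)
  moreover have "(hnorm (hilb_power n K) (matrix_op n H x h))\<^sup>2 \<le> c\<^sup>2 * (\<Sum>j<n. (H.nrm (h j))\<^sup>2)"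
    by (subst hnorm_matrix_op_sq[OF _ h(1)], rule x, assumption+, rule le, rule hi)
  ultimately have "(hnorm (hilb_power n K) (matrix_op n H x h))\<^sup>2 \<le> c\<^sup>2" by linarith
  then show "hnorm (hilb_power n K) (matrix_op n H x h) \<le> c"
    using \<open>c \<ge> 0\<close> by (rule power2_le_imp_le)
qed simp

lemma matrix_norm_bound:
  assumes x: "\<And>i j. i < n \<Longrightarrow> j < n \<Longrightarrow> x i j \<in> bounded_ops H K"
    and le: "matrix_norm n H K x \<le> 1" and h: "\<And>i. i < n \<Longrightarrow> h i \<in> H.V"
  shows "(\<Sum>i<n. (K.nrm (\<Sum>j<n. x i j (h j)))\<^sup>2) \<le> (\<Sum>j<n. (H.nrm (h j))\<^sup>2)"
proof (cases "(\<Sum>j<n. (H.nrm (h j))\<^sup>2) = 0")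
  case True
  then have "h j = 0" if "j < n" for j
    using that h by (simp add: sum_nonneg_eq_0_iff)
  then show ?thesis using x by (simp add: bop_zero)
next
  case False
  define N where "N = sqrt (\<Sum>j<n. (H.nrm (h j))\<^sup>2)"
  have nn: "(\<Sum>j<n. (H.nrm (h j))\<^sup>2) \<ge> 0" by (intro sum_nonneg) simp
  have N: "N > 0" "N\<^sup>2 = (\<Sum>j<n. (H.nrm (h j))\<^sup>2)"
    using False nn by (simp_all add: N_def)
  \<comment> \<open>Normalising \<open>h\<close> brings it into the unit ball of
    \<open>op_norm\<close>; cutting it off at \<open>n\<close> puts it into the carrier of
    \<open>hilb_power\<close>.\<close>
  define k where "k = (\<lambda>i. if i < n then of_real (1/N) *\<^sub>C h i else 0)"
  have k: "k \<in> hcarrier (hilb_power n H)" using h by (simp add: k_def)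
  have "(hnorm (hilb_power n H) k)\<^sup>2 = (\<Sum>i<n. (1/N)\<^sup>2 * (H.nrm (h i))\<^sup>2)"
    using h N by (subst H.hnorm_power_sq) (auto simp: k_def power_divide norm_divide)
  also have "\<dots> = 1"
    unfolding sum_distrib_left[symmetric] N(2)[symmetric] using N(1) by (simp add: power_divide)
  finally have "hnorm (hilb_power n H) k \<le> 1" by (auto simp: power2_eq_1_iff)
  moreover have "\<exists>C. \<forall>h\<in>hcarrier (hilb_power n H). hnorm (hilb_power n H) h \<le> 1 \<longrightarrow>
      hnorm (hilb_power n K) (matrix_op n H x h) \<le> C"
    by (rule matrix_op_bound) (rule x)
  then obtain C where "\<And>h. h \<in> hcarrier (hilb_power n H) \<Longrightarrow> hnorm (hilb_power n H) h \<le> 1 \<Longrightarrow>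
      hnorm (hilb_power n K) (matrix_op n H x h) \<le> C"
    by blast
  ultimately have "hnorm (hilb_power n K) (matrix_op n H x k) \<le> matrix_norm n H K x"
    unfolding matrix_norm_def using k by (intro op_normD)
  then have "hnorm (hilb_power n K) (matrix_op n H x k) \<le> 1" using le by linarith
  moreover have "hnorm (hilb_power n K) (matrix_op n H x k) \<ge> 0"
    using k matrix_op_in[of n x k] x by (intro K.hnorm_power_nonneg) (simp add: matrix_op_def)
  ultimately have "(hnorm (hilb_power n K) (matrix_op n H x k))\<^sup>2 \<le> 1"
    by (simp add: power_le_one)
  moreover have "(\<Sum>j<n. x i j (k j)) = of_real (1/N) *\<^sub>C (\<Sum>j<n. x i j (h j))" if "i < n" for i
    unfolding complex_space.scale_sum_right
    using that h x bop_scale[OF x] by (intro sum.cong) (auto simp: k_def)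
  then have "(\<Sum>i<n. (K.nrm (\<Sum>j<n. x i j (k j)))\<^sup>2) = (1/N)\<^sup>2 * (\<Sum>i<n. (K.nrm (\<Sum>j<n. x i j (h j)))\<^sup>2)"
    using matrix_op_in[of n x h] x h N by (simp add: sum_distrib_left power_divide norm_divide)
  moreover have "(\<Sum>j<n. (H.nrm (h j))\<^sup>2) > 0" using False nn by linarith
  ultimately show ?thesis using N hnorm_matrix_op_sq[of n x k] x k by (simp add: power_divide divide_le_eq)
qed

text \<open>For the identity map each term of the supremum is bounded by its own constraint. The 1
  by 1 matrix \<open>j\<close>, a contraction attaining norm 1 at \<open>e\<close>, shows that the
  value 1 is reached.\<close>

lemma cb_norm_identity:
  assumes Y: "Y \<subseteq> bounded_ops H K" and j: "j \<in> Y" "\<And>f. f \<in> H.V \<Longrightarrow> K.nrm (j f) \<le> H.nrm f"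
    and e: "e \<in> H.V" "H.nrm e = 1" "K.nrm (j e) = 1"
  shows "cb_norm H K Y H K (\<lambda>x. x) = 1"
proof (rule antisym)
  show "cb_norm H K Y H K (\<lambda>x. x) \<le> 1"
    unfolding cb_norm_def by (intro SUP_least) (simp add: ennreal_le_1)
  have jB: "j \<in> bounded_ops H K" using Y j by blast
  have le: "matrix_norm 1 H K (\<lambda>_ _. j) \<le> 1"
    using j jB by (intro matrix_norm_le) auto
  have "1 \<le> matrix_norm 1 H K (\<lambda>_ _. j)"
  proof -
    obtain C where C: "\<forall>h\<in>hcarrier (hilb_power 1 H). hnorm (hilb_power 1 H) h \<le> 1 \<longrightarrow>
        hnorm (hilb_power 1 K) (matrix_op 1 H (\<lambda>_ _. j) h) \<le> C"
      using matrix_op_bound[of 1 "\<lambda>_ _. j"] jB by blast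
    define h where "h = (\<lambda>i::nat. if i = 0 then e else 0)"
    have h: "h \<in> hcarrier (hilb_power 1 H)" using e by (simp add: h_def)
    have "(hnorm (hilb_power 1 H) h)\<^sup>2 = 1"
      using e by (subst H.hnorm_power_sq) (auto simp: h_def)
    then have "hnorm (hilb_power 1 H) h \<le> 1" by (auto simp: power2_eq_1_iff)
    moreover have "(hnorm (hilb_power 1 K) (matrix_op 1 H (\<lambda>_ _. j) h))\<^sup>2 = 1"
      using e jB h by (subst hnorm_matrix_op_sq) (auto simp: h_def)
    moreover have "hnorm (hilb_power 1 K) (matrix_op 1 H (\<lambda>_ _. j) h) \<ge> 0"
      using h jB by (intro K.hnorm_power_nonneg) (auto simp: matrix_op_def)
    ultimately show ?thesis
      using op_normD[of "hilb_power 1 H" "hilb_power 1 K" "matrix_op 1 H (\<lambda>_ _. j)" C h] C h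
      unfolding matrix_norm_def by (auto simp: power2_eq_1_iff)
  qed
  then have "1 \<le> ennreal (matrix_norm 1 H K (\<lambda>_ _. j))" by (simp add: ennreal_ge_1)
  also have "\<dots> \<le> cb_norm H K Y H K (\<lambda>x. x)"
    unfolding cb_norm_def
    by (rule SUP_upper2[of 1], simp, rule SUP_upper2[of "\<lambda>_ _. j"]) (use le j in simp_all)
  finally show "1 \<le> cb_norm H K Y H K (\<lambda>x. x)" .
qed

end

section \<open>Norm inequalities preserved by a completely contractive map\<close>

locale cc_TRO_map = hilb_pair H K
  for H :: "'a::complex_space hilb" and K :: "'b::complex_space hilb" +
  fixes T :: "('a \<Rightarrow> 'b) set" and \<psi> :: "('a \<Rightarrow> 'b) \<Rightarrow> 'a \<Rightarrow> 'b"
  assumes TRO: "TRO H K T"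
    and lin: "linear_map_on T (bounded_ops H K) \<psi>"
    and cc: "cb_norm H K T H K \<psi> \<le> 1"
begin

lemma in_T [simp, intro]: "x \<in> T \<Longrightarrow> x \<in> bounded_ops H K"
  using TRO_subset[OF TRO] by blast

lemma
  shows zero_T [simp, intro]: "0 \<in> T"
    and add_T [simp, intro]: "x \<in> T \<Longrightarrow> y \<in> T \<Longrightarrow> x + y \<in> T"
    and diff_T [simp, intro]: "x \<in> T \<Longrightarrow> y \<in> T \<Longrightarrow> x - y \<in> T"
    and scale_T [simp, intro]: "x \<in> T \<Longrightarrow> c *\<^sub>C x \<in> T"
  using TRO_subspace[OF TRO] complex_space.subspace_0 complex_space.subspace_add
    complex_space.subspace_diff complex_space.subspace_scale by blast+

lemma \<psi>_bop [simp, intro]: "x \<in> T \<Longrightarrow> \<psi> x \<in> bounded_ops H K"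
  and \<psi>_add: "x \<in> T \<Longrightarrow> y \<in> T \<Longrightarrow> \<psi> (x + y) = \<psi> x + \<psi> y"
  and \<psi>_scale: "x \<in> T \<Longrightarrow> \<psi> (c *\<^sub>C x) = c *\<^sub>C \<psi> x"
  using lin by (simp_all add: linear_map_on_def)

lemma \<psi>_zero [simp]: "\<psi> 0 = 0"
  using \<psi>_scale[of 0 0] by simp

lemma \<psi>_diff: "x \<in> T \<Longrightarrow> y \<in> T \<Longrightarrow> \<psi> (x - y) = \<psi> x - \<psi> y"
  using \<psi>_add[of "x - y" y] by simp

text \<open>Divided by \<open>c\<close>, the matrix is among those over which \<open>cb_norm\<close>
  takes its supremum; linearity of \<psi> undoes the division.\<close>

lemma \<psi>_contractive_matrix:
  fixes n :: nat
  assumes x: "\<And>i j. i < n \<Longrightarrow> j < n \<Longrightarrow> x i j \<in> T" and c: "c > 0"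
    and le: "\<And>h. (\<And>i. i < n \<Longrightarrow> h i \<in> H.V) \<Longrightarrow>
      (\<Sum>i<n. (K.nrm (\<Sum>j<n. x i j (h j)))\<^sup>2) \<le> c\<^sup>2 * (\<Sum>j<n. (H.nrm (h j))\<^sup>2)"
    and h: "\<And>i. i < n \<Longrightarrow> h i \<in> H.V"
  shows "(\<Sum>i<n. (K.nrm (\<Sum>j<n. \<psi> (x i j) (h j)))\<^sup>2) \<le> c\<^sup>2 * (\<Sum>j<n. (H.nrm (h j))\<^sup>2)"
proof -
  have scale: "(\<Sum>i<n. (K.nrm (\<Sum>j<n. (of_real (1/c) *\<^sub>C y i j) (h j)))\<^sup>2)
      = (\<Sum>i<n. (K.nrm (\<Sum>j<n. y i j (h j)))\<^sup>2) / c\<^sup>2"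
    if "\<And>i j. i < n \<Longrightarrow> j < n \<Longrightarrow> y i j \<in> bounded_ops H K" "\<And>i. i < n \<Longrightarrow> h i \<in> H.V" for y h
    using matrix_op_in[of n y h, OF that] c
    by (simp add: scaleC_fun_def sum_divide_distrib power_divide norm_divide flip: complex_space.scale_sum_right)
  have "matrix_norm n H K (\<lambda>i j. of_real (1/c) *\<^sub>C x i j) \<le> 1"
  proof (rule matrix_norm_le)
    fix h assume h: "\<And>i. i < n \<Longrightarrow> h i \<in> H.V"
    show "(\<Sum>i<n. (K.nrm (\<Sum>j<n. (of_real (1/c) *\<^sub>C x i j) (h j)))\<^sup>2) \<le> 1\<^sup>2 * (\<Sum>j<n. (H.nrm (h j))\<^sup>2)"
      using le[OF h] c x h by (subst scale) (auto simp: divide_le_eq mult.commute)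
  qed (use x in auto)
  then have "ennreal (matrix_norm n H K (\<lambda>i j. \<psi> (of_real (1/c) *\<^sub>C x i j))) \<le> cb_norm H K T H K \<psi>"
    unfolding cb_norm_def using x
    by (intro SUP_upper2[of n]) (auto intro!: SUP_upper2[of "\<lambda>i j. of_real (1/c) *\<^sub>C x i j"])
  also note cc
  finally have "matrix_norm n H K (\<lambda>i j. \<psi> (of_real (1/c) *\<^sub>C x i j)) \<le> 1"
    by (simp add: ennreal_le_1)
  then have "(\<Sum>i<n. (K.nrm (\<Sum>j<n. \<psi> (of_real (1/c) *\<^sub>C x i j) (h j)))\<^sup>2) \<le> (\<Sum>j<n. (H.nrm (h j))\<^sup>2)"
    using x h by (intro matrix_norm_bound) auto
  moreover have "(\<Sum>i<n. (K.nrm (\<Sum>j<n. \<psi> (of_real (1/c) *\<^sub>C x i j) (h j)))\<^sup>2)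
      = (\<Sum>i<n. (K.nrm (\<Sum>j<n. (of_real (1/c) *\<^sub>C \<psi> (x i j)) (h j)))\<^sup>2)"
    using x by (intro sum.cong arg_cong[where f="\<lambda>v. (K.nrm v)\<^sup>2"]) (auto simp: \<psi>_scale)
  ultimately show ?thesis
    using scale[of "\<lambda>i j. \<psi> (x i j)" h] x h c by (simp add: divide_le_eq mult.commute)
qed

text \<open>The row is padded by zeros to a 2 by 2 matrix, since \<open>cb_norm\<close> ranges over
  square matrices.\<close>

lemma \<psi>_row:
  assumes "a \<in> T" "b \<in> T" "c > 0"
    and "\<And>u v. u \<in> H.V \<Longrightarrow> v \<in> H.V \<Longrightarrow> (K.nrm (a u + b v))\<^sup>2 \<le> c\<^sup>2 * ((H.nrm u)\<^sup>2 + (H.nrm v)\<^sup>2)"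
    and "u \<in> H.V" "v \<in> H.V"
  shows "(K.nrm (\<psi> a u + \<psi> b v))\<^sup>2 \<le> c\<^sup>2 * ((H.nrm u)\<^sup>2 + (H.nrm v)\<^sup>2)"
proof -
  define x where "x = (\<lambda>(i::nat) (j::nat). if i = (0::nat) then if j = 0 then a else b else 0)"
  define h where "h = (\<lambda>j::nat. if j = 0 then u else v)"
  have "(\<Sum>i<2. (K.nrm (\<Sum>j<2. \<psi> (x i j) (h j)))\<^sup>2) \<le> c\<^sup>2 * (\<Sum>j<2. (H.nrm (h j))\<^sup>2)"
  proof (rule \<psi>_contractive_matrix)
    fix k :: "nat \<Rightarrow> 'a" assume k: "\<And>i. i < 2 \<Longrightarrow> k i \<in> H.V"
    show "(\<Sum>i<2. (K.nrm (\<Sum>j<2. x i j (k j)))\<^sup>2) \<le> c\<^sup>2 * (\<Sum>j<2. (H.nrm (k j))\<^sup>2)"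
      using assms(4)[of "k 0" "k 1"] k[of 0] k[of 1] by (simp add: numeral_2_eq_2 x_def)
  qed (use assms in \<open>auto simp: x_def h_def\<close>)
  then show ?thesis by (simp add: numeral_2_eq_2 x_def h_def)
qed

text \<open>As for rows, with a second column of zeros; the vector gets a second entry 0, so that
  the right hand side involves \<open>u\<close> alone.\<close>

lemma \<psi>_column:
  assumes "a \<in> T" "b \<in> T" "c > 0"
    and "\<And>u. u \<in> H.V \<Longrightarrow> (K.nrm (a u))\<^sup>2 + (K.nrm (b u))\<^sup>2 \<le> c\<^sup>2 * (H.nrm u)\<^sup>2"
    and "u \<in> H.V"
  shows "(K.nrm (\<psi> a u))\<^sup>2 + (K.nrm (\<psi> b u))\<^sup>2 \<le> c\<^sup>2 * (H.nrm u)\<^sup>2"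
proof -
  define x where "x = (\<lambda>(i::nat) (j::nat). if j = (0::nat) then if i = 0 then a else b else 0)"
  define h where "h = (\<lambda>j::nat. if j = 0 then u else 0)"
  have "(\<Sum>i<2. (K.nrm (\<Sum>j<2. \<psi> (x i j) (h j)))\<^sup>2) \<le> c\<^sup>2 * (\<Sum>j<2. (H.nrm (h j))\<^sup>2)"
  proof (rule \<psi>_contractive_matrix)
    fix k :: "nat \<Rightarrow> 'a" assume k: "\<And>i. i < 2 \<Longrightarrow> k i \<in> H.V"
    have "c\<^sup>2 * (H.nrm (k 0))\<^sup>2 \<le> c\<^sup>2 * ((H.nrm (k 0))\<^sup>2 + (H.nrm (k 1))\<^sup>2)"
      by (intro mult_left_mono) auto
    then have "(K.nrm (a (k 0)))\<^sup>2 + (K.nrm (b (k 0)))\<^sup>2 \<le> c\<^sup>2 * ((H.nrm (k 0))\<^sup>2 + (H.nrm (k 1))\<^sup>2)"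
      using assms(4)[of "k 0"] k[of 0] by simp
    then show "(\<Sum>i<2. (K.nrm (\<Sum>j<2. x i j (k j)))\<^sup>2) \<le> c\<^sup>2 * (\<Sum>j<2. (H.nrm (k j))\<^sup>2)"
      by (simp add: numeral_2_eq_2 x_def)
  qed (use assms in \<open>auto simp: x_def h_def\<close>)
  then show ?thesis by (simp add: numeral_2_eq_2 x_def h_def)
qed

lemma \<psi>_norm_le:
  assumes "a \<in> T" "c > 0" "\<And>u. u \<in> H.V \<Longrightarrow> K.nrm (a u) \<le> c * H.nrm u" "u \<in> H.V"
  shows "K.nrm (\<psi> a u) \<le> c * H.nrm u"
proof -
  have "(K.nrm (\<psi> a u))\<^sup>2 + (K.nrm (\<psi> 0 u))\<^sup>2 \<le> c\<^sup>2 * (H.nrm u)\<^sup>2"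
  proof (rule \<psi>_column)
    fix v assume v: "v \<in> H.V"
    then have "(K.nrm (a v))\<^sup>2 \<le> (c * H.nrm v)\<^sup>2"
      using assms K.nrm_ge_0[OF bop_in[OF in_T[OF assms(1)] v]] by (intro power_mono) auto
    then show "(K.nrm (a v))\<^sup>2 + (K.nrm (0 v))\<^sup>2 \<le> c\<^sup>2 * (H.nrm v)\<^sup>2"
      by (simp add: power_mult_distrib)
  qed (use assms in auto)
  then have "(K.nrm (\<psi> a u))\<^sup>2 \<le> (c * H.nrm u)\<^sup>2" by (simp add: power_mult_distrib)
  then show ?thesis by (rule power2_le_imp_le) (use assms in auto)
qed

end

section \<open>Rigidity from rank one operators\<close>

text \<open>The operator f tensor h*, linear in \<open>f\<close> and antilinear in \<open>h\<close>,
  with the value 0 off the carrier as for all operators here.\<close>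

definition rank_one :: "'a::complex_space hilb \<Rightarrow> 'b::complex_space \<Rightarrow> 'a \<Rightarrow> 'a \<Rightarrow> 'b" where
  "rank_one H f h = (\<lambda>u. if u \<in> hcarrier H then hinner H u h *\<^sub>C f else 0)"

lemma rank_one_apply [simp]: "u \<in> hcarrier H \<Longrightarrow> rank_one H f h u = hinner H u h *\<^sub>C f"
  and rank_one_outside: "u \<notin> hcarrier H \<Longrightarrow> rank_one H f h u = 0"
  and rank_one_zero [simp]: "rank_one H 0 h = 0"
  by (auto simp: rank_one_def fun_eq_iff)

lemma rank_one_add: "rank_one H (f + g) h = rank_one H f h + rank_one H g h"
  and rank_one_scale: "rank_one H (c *\<^sub>C f) h = c *\<^sub>C rank_one H f h"
  by (auto simp: rank_one_def fun_eq_iff scaleC_add_right scaleC_fun_def scaleC_scaleC mult.commute)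

section \<open>Rank one operators between two Hilbert spaces\<close>

context hilb_pair
begin

lemma rank_one_norm:
  assumes "f \<in> K.V" "h \<in> H.V" "u \<in> H.V"
  shows "K.nrm (rank_one H f h u) \<le> K.nrm f * H.nrm h * H.nrm u"
  using assms mult_left_mono[OF H.Cauchy_Schwarz[of u h] K.nrm_ge_0[of f]] by (simp add: mult_ac)

lemma rank_one_bop [simp, intro]:
  assumes "f \<in> K.V" "h \<in> H.V"
  shows "rank_one H f h \<in> bounded_ops H K"
proof (rule bounded_opsI[where C="K.nrm f * H.nrm h"])
  show "K.nrm (rank_one H f h u) \<le> K.nrm f * H.nrm h * H.nrm u" if "u \<in> H.V" for u
    using rank_one_norm[OF assms that] .
qed (use assms in \<open>auto simp: rank_one_def H.ip_add_left H.ip_scale_left scaleC_add_left scaleC_scaleC\<close>)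

lemma op_adj_rank_one:
  assumes "f \<in> K.V" "h \<in> H.V" "k \<in> K.V"
  shows "op_adj H K (rank_one H f h) k = K.ip k f *\<^sub>C h"
  using assms
  by (intro op_adj_unique) (auto simp: K.ip_scale_left H.ip_scale_right K.ip_commute[of k f])

text \<open>The adjoint of \<open>rank_one H g e\<close> maps into the line of \<open>e\<close>, and
  \<open>rank_one H f e\<close> takes the unit vector \<open>e\<close> to \<open>f\<close>. Thus
  ternary products turn rank one operators with the fixed right vector \<open>e\<close> into ones
  whose right vector is any adjoint image of \<open>g\<close>.\<close>

lemma rank_one_comp:
  assumes x: "x \<in> bounded_ops H K" and "f \<in> K.V" "g \<in> K.V" "e \<in> H.V" "H.nrm e = 1"
  shows "rank_one H f e \<circ> op_adj H K (rank_one H g e) \<circ> x = rank_one H f (op_adj H K x g)"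
proof
  fix u
  have "H.ip e e = 1" using assms by (simp add: H.ip_self)
  moreover have "op_adj H K (rank_one H g e) 0 = 0"
    using bop_scale[OF op_adj_bop[OF rank_one_bop[of g e]], of 0 0] assms by simp
  ultimately show "(rank_one H f e \<circ> op_adj H K (rank_one H g e) \<circ> x) u = rank_one H f (op_adj H K x g) u"
    using assms bop_outside[OF x, of u]
    by (cases "u \<in> H.V") (auto simp: op_adj_rank_one H.ip_scale_left ip_op_adj rank_one_outside)
qed

end

section \<open>Rigidity of a map that is correct on enough rank one operators\<close>

context cc_TRO_map
begin

text \<open>The entries \<open>rank_one H f e\<close> and \<open>c *\<^sub>C x\<close> have
  orthogonal ranges, so as a row they have norm at most that of \<open>f\<close>. The image row
  already reaches this norm at \<open>e\<close>. If \<open>\<psi> x u\<close> were not orthogonal to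
  \<open>f\<close>, adding a small multiple of it would exceed the bound to first order.\<close>

lemma \<psi>_annihilates:
  assumes e: "e \<in> H.V" "H.nrm e = 1" and f: "f \<in> K.V" and F: "rank_one H f e \<in> T" "\<psi> (rank_one H f e) e = f"
    and x: "x \<in> T" "\<And>u. u \<in> H.V \<Longrightarrow> K.ip (x u) f = 0" and u: "u \<in> H.V"
  shows "K.ip (\<psi> x u) f = 0"
proof (cases "f = 0")
  case True
  then show ?thesis using bop_in[OF \<psi>_bop[OF x(1)] u] by simp
next
  case False
  define N where "N = K.nrm f"
  have N: "N > 0" using False f K.nrm_ge_0[OF f] unfolding N_def by (simp add: order_less_le)
  obtain C where C: "C > 0" "\<And>u. u \<in> H.V \<Longrightarrow> K.nrm (x u) \<le> C * H.nrm u"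
    using bop_bound[OF in_T[OF x(1)]] by blast
  \<comment> \<open>This factor scales \<open>x\<close> down to the norm of \<open>f\<close>, so
    that the row keeps the norm \<open>N\<close>.\<close>
  define c where "c = complex_of_real (N / C)"
  define z where "z = K.ip (\<psi> x u) f"
  have row: "(K.nrm (\<psi> (rank_one H f e) v + \<psi> (c *\<^sub>C x) w))\<^sup>2 \<le> N\<^sup>2 * ((H.nrm v)\<^sup>2 + (H.nrm w)\<^sup>2)"
    if "v \<in> H.V" "w \<in> H.V" for v w
  proof (rule \<psi>_row)
    fix v w assume vw: "v \<in> H.V" "w \<in> H.V"
    have xw: "x w \<in> K.V" using x vw by blast
    have "K.ip f (x w) = 0" using x(2)[OF vw(2)] K.ip_commute[OF xw f] by simp
    then have "(K.nrm (rank_one H f e v + (c *\<^sub>C x) w))\<^sup>2 = (K.nrm (rank_one H f e v))\<^sup>2 + (K.nrm (c *\<^sub>C x w))\<^sup>2"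
      using vw xw f by (simp add: scaleC_fun_def K.nrm_add_sq K.ip_scale_left K.ip_scale_right)
    moreover have "(K.nrm (rank_one H f e v))\<^sup>2 \<le> (N * H.nrm v)\<^sup>2"
      using rank_one_norm[OF f e(1) vw(1)] e f vw rank_one_bop[of f e]
      by (intro power_mono K.nrm_ge_0) (auto simp: N_def)
    moreover have "K.nrm (c *\<^sub>C x w) \<le> N * H.nrm w"
      using C(2)[OF vw(2)] C(1) N xw by (simp add: c_def norm_divide field_simps)
    then have "(K.nrm (c *\<^sub>C x w))\<^sup>2 \<le> (N * H.nrm w)\<^sup>2"
      using xw by (intro power_mono K.nrm_ge_0) auto
    ultimately show "(K.nrm (rank_one H f e v + (c *\<^sub>C x) w))\<^sup>2 \<le> N\<^sup>2 * ((H.nrm v)\<^sup>2 + (H.nrm w)\<^sup>2)"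
      by (simp add: power_mult_distrib distrib_left)
  qed (use that F x N in auto)
  have xu: "\<psi> x u \<in> K.V" using x u by blast
  have "\<epsilon> * (2 * (N / C) * (cmod z)\<^sup>2) \<le> \<epsilon>\<^sup>2 * (N\<^sup>2 * (cmod z)\<^sup>2 * (H.nrm u)\<^sup>2)" if "\<epsilon> > 0" for \<epsilon> :: real
  proof -
    \<comment> \<open>The phase of \<open>cnj z\<close> makes the inner product with
      \<open>f\<close> real and nonnegative.\<close>
    define \<tau> where "\<tau> = of_real \<epsilon> * cnj z"
    have p: "\<psi> (c *\<^sub>C x) (\<tau> *\<^sub>C u) = (c * \<tau>) *\<^sub>C \<psi> x u"
      unfolding \<psi>_scale[OF x(1)]
      unfolding scaleC_fun_def bop_scale[OF \<psi>_bop[OF x(1)] u] by (simp add: scaleC_scaleC)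
    have "(K.nrm (f + (c * \<tau>) *\<^sub>C \<psi> x u))\<^sup>2 \<le> N\<^sup>2 * (1 + (H.nrm (\<tau> *\<^sub>C u))\<^sup>2)"
      using row[OF e(1), of "\<tau> *\<^sub>C u"] F(2) p u e(2) by simp
    moreover have "(K.nrm (f + (c * \<tau>) *\<^sub>C \<psi> x u))\<^sup>2 \<ge> N\<^sup>2 + 2 * Re (K.ip ((c * \<tau>) *\<^sub>C \<psi> x u) f)"
      using f xu K.nrm_add_sq[of "(c * \<tau>) *\<^sub>C \<psi> x u" f] by (simp add: N_def add.commute)
    moreover have "K.ip ((c * \<tau>) *\<^sub>C \<psi> x u) f = of_real (\<epsilon> * (N / C)) * (z * cnj z)"
      unfolding K.ip_scale_left[OF xu f] z_def[symmetric] by (simp add: c_def \<tau>_def)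
    then have "K.ip ((c * \<tau>) *\<^sub>C \<psi> x u) f = of_real (\<epsilon> * (N / C) * (cmod z)\<^sup>2)"
      unfolding complex_norm_square[symmetric] by (simp only: of_real_mult)
    then have "Re (K.ip ((c * \<tau>) *\<^sub>C \<psi> x u) f) = \<epsilon> * (N / C) * (cmod z)\<^sup>2" by simp
    moreover have "(H.nrm (\<tau> *\<^sub>C u))\<^sup>2 = \<epsilon>\<^sup>2 * (cmod z)\<^sup>2 * (H.nrm u)\<^sup>2"
      using u by (simp add: \<tau>_def norm_mult power_mult_distrib)
    ultimately have "2 * (\<epsilon> * (N / C) * (cmod z)\<^sup>2) \<le> N\<^sup>2 * (\<epsilon>\<^sup>2 * (cmod z)\<^sup>2 * (H.nrm u)\<^sup>2)"
      by (simp add: distrib_left)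
    then show ?thesis by (simp only: mult_ac)
  qed
  then have "2 * (N / C) * (cmod z)\<^sup>2 \<le> 0" by (rule linear_le_quadratic_imp_le_0)
  moreover have "2 * (N / C) > 0" using N C by simp
  ultimately have "(cmod z)\<^sup>2 \<le> 0" by (metis mult_pos_pos not_le)
  then show ?thesis by (simp add: z_def)
qed

text \<open>The component of \<open>\<psi> x u\<close> along \<open>f\<close> is determined by
  \<psi> at \<open>rank_one H f (adj x f)\<close>. These operators are fixed first for
  \<open>x = j\<close>, then with two different vectors of \<open>D\<close> by polarization, and
  finally for all \<open>x\<close>, because \<open>adj j\<close> maps \<open>D\<close> onto a dense
  set and \<psi> is contractive.\<close>

theorem \<psi>_identity:
  assumes e: "e \<in> H.V" "H.nrm e = 1"
    and D: "csubspace D" "D \<subseteq> K.V" "\<And>v. v \<in> K.V \<Longrightarrow> (\<And>f. f \<in> D \<Longrightarrow> K.ip v f = 0) \<Longrightarrow> v = 0"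
    and F: "\<And>f. f \<in> D \<Longrightarrow> rank_one H f e \<in> T" "\<And>f. f \<in> D \<Longrightarrow> \<psi> (rank_one H f e) e = f"
    and j: "j \<in> T" "\<psi> j = j"
    and dense: "\<And>h \<epsilon>. h \<in> H.V \<Longrightarrow> \<epsilon> > 0 \<Longrightarrow> \<exists>g\<in>D. H.nrm (h - op_adj H K j g) < \<epsilon>"
    and x: "x \<in> T"
  shows "\<psi> x = x"
proof -
  define adj where "adj = op_adj H K"
  have DV: "f \<in> K.V" if "f \<in> D" for f using that D by blast
  have Dadd: "f + g \<in> D" "f - g \<in> D" "c *\<^sub>C f \<in> D" if "f \<in> D" "g \<in> D" for f g c
    using that D(1) complex_space.subspace_add complex_space.subspace_diff complex_space.subspace_scale by blast+
  have adjV: "adj x f \<in> H.V" if "x \<in> T" "f \<in> D" for x f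
    unfolding adj_def using that DV by blast
  have rT: "rank_one H f (adj x g) \<in> T" if "x \<in> T" "f \<in> D" "g \<in> D" for x f g
    using TRO_ternary[OF TRO F(1)[OF that(2)] F(1)[OF that(3)] that(1)] that e DV
    by (simp add: rank_one_comp adj_def)
  have ann: "K.ip (\<psi> x u) f = 0" if "f \<in> D" "x \<in> T" "\<And>u. u \<in> H.V \<Longrightarrow> K.ip (x u) f = 0" "u \<in> H.V" for f x u
    using \<psi>_annihilates[OF e DV[OF that(1)] F(1)[OF that(1)] F(2)[OF that(1)]] that by blast
  \<comment> \<open>\<open>?N *\<^sub>C x - ?r\<close> is \<open>?N\<close> times the part of
    \<open>x\<close> whose range is orthogonal to \<open>f\<close>, so \<psi> maps it to an operator
    with range orthogonal to \<open>f\<close>.\<close>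
  have corner: "of_real ((K.nrm f)\<^sup>2) * K.ip (\<psi> x u) f = K.ip (\<psi> (rank_one H f (adj x f)) u) f"
    if f: "f \<in> D" and x: "x \<in> T" and u: "u \<in> H.V" for x f u
  proof -
    let ?N = "complex_of_real ((K.nrm f)\<^sup>2)" and ?r = "rank_one H f (adj x f)"
    have y: "?N *\<^sub>C x - ?r \<in> T" using rT[OF x f f] x by blast
    have V: "x v \<in> K.V" "?r v \<in> K.V" "\<psi> x v \<in> K.V" "\<psi> ?r v \<in> K.V" if "v \<in> H.V" for v
      using that x rT[OF x f f] by blast+
    have "K.ip (\<psi> (?N *\<^sub>C x - ?r) u) f = 0"
    proof (rule ann[OF f y _ u])
      fix v assume v: "v \<in> H.V"
      have "K.ip (?r v) f = K.ip (x v) f * ?N"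
        using v f DV x by (simp add: K.ip_scale_left K.ip_self adj_def ip_op_adj)
      then show "K.ip ((?N *\<^sub>C x - ?r) v) f = 0"
        using V[OF v] DV[OF f] by (simp add: scaleC_fun_def K.ip_diff_left K.ip_scale_left del: rank_one_apply)
    qed
    moreover have "\<psi> (?N *\<^sub>C x - ?r) = ?N *\<^sub>C \<psi> x - \<psi> ?r"
      using x rT[OF x f f] by (simp only: \<psi>_diff \<psi>_scale scale_T)
    ultimately have "K.ip (?N *\<^sub>C \<psi> x u - \<psi> ?r u) f = 0"
      by (simp add: scaleC_fun_def)
    then show ?thesis using V[OF u] DV[OF f] by (simp add: K.ip_diff_left K.ip_scale_left)
  qed
  \<comment> \<open>Test \<open>\<psi> ?r u\<close> against \<open>g\<close> in \<open>D\<close>: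
    the part of \<open>g\<close> orthogonal to \<open>f\<close> gives 0 by \<open>ann\<close>, and
    the part along \<open>f\<close> is given by \<open>corner\<close> for \<open>j\<close>, which
    \<psi> fixes.\<close>
  have diag: "\<psi> (rank_one H f (adj j f)) = rank_one H f (adj j f)" if f: "f \<in> D" for f
  proof (cases "f = 0")
    case True
    then show ?thesis by simp
  next
    case False
    let ?r = "rank_one H f (adj j f)"
    have r: "?r \<in> T" using rT[OF j(1) f f] .
    let ?N = "complex_of_real ((K.nrm f)\<^sup>2)"
    have N: "?N \<noteq> 0" using False f DV by simp
    show ?thesis
    proof (rule bop_ext[OF \<psi>_bop[OF r] in_T[OF r]])
      fix u assume u: "u \<in> H.V"
      have V: "?r u \<in> K.V" "\<psi> ?r u \<in> K.V" using u r by blast+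
      have "K.ip (\<psi> ?r u - ?r u) g = 0" if g: "g \<in> D" for g
      proof -
        \<comment> \<open>\<open>g'\<close> is \<open>g\<close> minus its projection onto the line
          of \<open>f\<close>; it stays in the subspace \<open>D\<close>, as \<open>ann\<close>
          requires.\<close>
        define \<alpha> where "\<alpha> = K.ip g f / ?N"
        define g' where "g' = g - \<alpha> *\<^sub>C f"
        have g': "g' \<in> D" unfolding g'_def using f g Dadd by blast
        have "K.ip g' f = 0"
          unfolding g'_def using f g DV N by (simp add: K.ip_diff_left K.ip_scale_left K.ip_self \<alpha>_def)
        then have fg': "K.ip f g' = 0" using K.ip_commute[of g' f] g' f DV by simp
        have 1: "K.ip (?r v) g' = 0" if "v \<in> H.V" for v
          using that fg' f g' DV by (simp add: K.ip_scale_left)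
        have 2: "K.ip (\<psi> ?r u) g' = 0" by (rule ann[OF g' r 1 u])
        have "K.ip (?r u) f = ?N * K.ip (j u) f"
          using u f DV j by (simp add: K.ip_scale_left K.ip_self adj_def ip_op_adj)
        then have 3: "K.ip (\<psi> ?r u) f = K.ip (?r u) f" using corner[OF f j(1) u] j(2) by simp
        have "g = g' + \<alpha> *\<^sub>C f" by (simp add: g'_def)
        then have "K.ip (\<psi> ?r u) g = K.ip (?r u) g"
          using 1[OF u] 2 3 V f g' DV by (simp add: K.ip_add_right K.ip_scale_right del: rank_one_apply)
        then show ?thesis using V g DV by (simp add: K.ip_diff_left del: rank_one_apply)
      qed
      then have "\<psi> ?r u - ?r u = 0" using V D(3)[of "\<psi> ?r u - ?r u"] by blast
      then show "\<psi> ?r u = ?r u" by simp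
    qed
  qed
  \<comment> \<open>\<Delta> is sesquilinear and vanishes on the diagonal, hence is antisymmetric;
    replacing \<open>f\<close> by \<open>\<i> *\<^sub>C f\<close> makes it symmetric as well, so it
    is 0.\<close>
  have offdiag: "\<psi> (rank_one H f (adj j g)) = rank_one H f (adj j g)" if f: "f \<in> D" and g: "g \<in> D" for f g
  proof -
    define R where "R f g = rank_one H f (adj j g)" for f g :: 'b
    define \<Delta> where "\<Delta> f g = \<psi> (R f g) - R f g" for f g :: 'b
    have RT: "R f g \<in> T" if "f \<in> D" "g \<in> D" for f g using that rT j by (simp add: R_def)
    have adj_add: "adj j (f + g) = adj j f + adj j g" and adj_scale: "adj j (c *\<^sub>C f) = c *\<^sub>C adj j f"
      if "f \<in> D" "g \<in> D" for f g c
      using op_adj_bop[OF in_T[OF j(1)]] that DV by (simp_all add: adj_def bop_add bop_scale)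
    have R: "R (f + g) (f + g) = (R f f + R g g) + (R f g + R g f)" if "f \<in> D" "g \<in> D" for f g
      using that adjV[OF j(1)] by (auto simp: R_def rank_one_def fun_eq_iff adj_add H.ip_add_right
          scaleC_add_left scaleC_add_right)
    have R1: "R (\<i> *\<^sub>C f) g = \<i> *\<^sub>C R f g" "R g (\<i> *\<^sub>C f) = (-\<i>) *\<^sub>C R g f" if "f \<in> D" "g \<in> D" for f g
      using that adjV[OF j(1)] by (auto simp: R_def rank_one_def fun_eq_iff adj_scale H.ip_scale_right
          scaleC_fun_def scaleC_scaleC mult.commute)
    have \<Delta>0: "\<Delta> f f = 0" if "f \<in> D" for f using diag[OF that] by (simp add: \<Delta>_def R_def)
    have sym: "\<Delta> f g + \<Delta> g f = 0" if "f \<in> D" "g \<in> D" for f g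
    proof -
      have "\<Delta> (f + g) (f + g) = (\<Delta> f f + \<Delta> g g) + (\<Delta> f g + \<Delta> g f)"
        unfolding \<Delta>_def R[OF that] using RT that by (simp add: \<psi>_add)
      then show ?thesis using that Dadd by (simp add: \<Delta>0)
    qed
    have "\<Delta> (\<i> *\<^sub>C f) g = \<i> *\<^sub>C \<Delta> f g" "\<Delta> g (\<i> *\<^sub>C f) = (-\<i>) *\<^sub>C \<Delta> g f"
      unfolding \<Delta>_def R1[OF f g] using RT f g
      by (simp_all only: \<psi>_scale complex_space.scale_right_diff_distrib)
    then have "\<i> *\<^sub>C \<Delta> f g + (-\<i>) *\<^sub>C \<Delta> g f = 0" using sym[of "\<i> *\<^sub>C f" g] f g Dadd by simp
    moreover have "\<Delta> g f = (-1) *\<^sub>C \<Delta> f g" using sym[OF f g] by (simp add: eq_neg_iff_add_eq_0 add.commute)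
    ultimately have "\<i> *\<^sub>C \<Delta> f g + \<i> *\<^sub>C \<Delta> f g = 0" by (simp only: scaleC_scaleC) simp
    then have "(2 * \<i>) *\<^sub>C \<Delta> f g = 0" by (simp add: scaleC_add_left[symmetric])
    then have "\<Delta> f g = 0" by simp
    then show ?thesis by (simp add: \<Delta>_def R_def)
  qed
  \<comment> \<open>Replace \<open>adj x f\<close> by a nearby \<open>adj j g\<close>, where
    \<open>offdiag\<close> applies. The remainder \<open>?q\<close> and its image under \<psi> are
    both of size \<epsilon>, so \<open>d\<close> is 0 and \<open>corner\<close> transfers this to
    \<open>x\<close>.\<close>
  have entry: "K.ip (\<psi> x u) f = K.ip (x u) f" if u: "u \<in> H.V" and f: "f \<in> D" for u f
  proof (cases "f = 0")
    case True
    then show ?thesis using bop_in[OF \<psi>_bop[OF x] u] bop_in[OF in_T[OF x] u] by simp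
  next
    case False
    let ?N = "complex_of_real ((K.nrm f)\<^sup>2)" and ?r = "rank_one H f (adj x f)"
    have N: "?N \<noteq> 0" using False f DV by simp
    have r: "?r \<in> T" using rT x f by blast
    define d where "d = K.ip (\<psi> ?r u) f - K.ip (?r u) f"
    have bound: "cmod d \<le> \<epsilon> * (2 * (K.nrm f)\<^sup>2 * H.nrm u)" if \<epsilon>: "\<epsilon> > 0" for \<epsilon>
    proof -
      obtain g where g: "g \<in> D" "H.nrm (adj x f - adj j g) < \<epsilon>"
        using dense[OF adjV[OF x f] \<epsilon>] by (auto simp: adj_def)
      let ?s = "rank_one H f (adj j g)" and ?q = "rank_one H f (adj x f - adj j g)"
      have s: "?s \<in> T" using rT j f g by blast
      have V: "adj x f \<in> H.V" "adj j g \<in> H.V" using adjV x j f g by blast+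
      have q: "?r = ?s + ?q"
        using V by (auto simp: rank_one_def fun_eq_iff H.ip_diff_right complex_space.scale_left_diff_distrib)
      have "?q = ?r - ?s" using q by simp
      then have qT: "?q \<in> T" using r s by simp
      have nrm: "K.nrm (?q v) \<le> (K.nrm f * \<epsilon>) * H.nrm v" if "v \<in> H.V" for v
      proof -
        have "K.nrm f * H.nrm (adj x f - adj j g) * H.nrm v \<le> K.nrm f * \<epsilon> * H.nrm v"
          using g(2) that f DV by (intro mult_right_mono mult_left_mono) auto
        then show ?thesis using rank_one_norm[OF DV[OF f] _ that, of "adj x f - adj j g"] V by force
      qed
      have Npos: "K.nrm f * \<epsilon> > 0" using False f DV K.nrm_ge_0[of f] \<epsilon> by (simp add: order_less_le)
      have nrm\<psi>: "K.nrm (\<psi> ?q u) \<le> (K.nrm f * \<epsilon>) * H.nrm u"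
        by (rule \<psi>_norm_le[OF qT Npos nrm u])
      have W: "?q u \<in> K.V" "\<psi> ?q u \<in> K.V" "?s u \<in> K.V" "f \<in> K.V" using qT s u f DV by blast+
      have "\<psi> ?r = ?s + \<psi> ?q" unfolding q using \<psi>_add[OF s qT] offdiag[OF f g(1)] by simp
      then have "K.ip (\<psi> ?r u) f = K.ip (?s u) f + K.ip (\<psi> ?q u) f"
        using W by (simp add: K.ip_add_left del: rank_one_apply)
      moreover have "K.ip (?r u) f = K.ip (?s u) f + K.ip (?q u) f"
        unfolding q using W by (simp add: K.ip_add_left del: rank_one_apply)
      ultimately have "d = K.ip (\<psi> ?q u) f - K.ip (?q u) f" by (simp add: d_def)
      then have "cmod d \<le> cmod (K.ip (\<psi> ?q u) f) + cmod (K.ip (?q u) f)" by (simp add: norm_triangle_ineq4)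
      also have "\<dots> \<le> K.nrm (\<psi> ?q u) * K.nrm f + K.nrm (?q u) * K.nrm f"
        using W by (intro add_mono K.Cauchy_Schwarz)
      also have "\<dots> \<le> (K.nrm f * \<epsilon>) * H.nrm u * K.nrm f + (K.nrm f * \<epsilon>) * H.nrm u * K.nrm f"
        using W by (intro add_mono mult_right_mono nrm nrm\<psi> u) auto
      finally show ?thesis by (simp add: power2_eq_square algebra_simps)
    qed
    have "cmod d \<le> 0"
      by (rule linear_le_quadratic_imp_le_0[where b="2 * (K.nrm f)\<^sup>2 * H.nrm u"])
        (use bound in \<open>simp add: power2_eq_square mult.assoc\<close>)
    then have "K.ip (\<psi> ?r u) f = K.ip (?r u) f" by (simp add: d_def)
    also have "\<dots> = ?N * K.ip (x u) f"
      using u f DV x by (simp add: K.ip_scale_left K.ip_self adj_def ip_op_adj)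
    finally show ?thesis using corner[OF f x u] N by simp
  qed
  show ?thesis
  proof (rule bop_ext[OF \<psi>_bop[OF x] in_T[OF x]])
    fix u assume u: "u \<in> H.V"
    have V: "\<psi> x u \<in> K.V" "x u \<in> K.V" using x u by blast+
    have "\<psi> x u - x u = 0"
      using V DV entry[OF u] by (intro D(3)) (auto simp: K.ip_diff_left)
    then show "\<psi> x u = x u" by simp
  qed
qed

text \<open>The column of \<open>a\<close> and \<open>b\<close> attains its norm at
  \<open>e\<close>, with a gap on the orthogonal complement. Keeping it at \<open>e\<close> and
  stretching it by some \<open>l > 1\<close> on the complement therefore does not raise the norm.
  Let A be the pair \<open>a e\<close>, \<open>b e\<close> and X the pair of images of
  \<open>E\<close> and \<open>F\<close> at \<open>e\<close>. As \<psi> fixes \<open>a\<close> and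
  \<open>b\<close>, both X and (1 - l) X + l A lie in the ball of radius \<open>sqrt n2\<close>.
  Between these two points lies A, on the sphere; strict convexity gives X = A.\<close>

lemma \<psi>_top_singular_vector:
  assumes e: "e \<in> H.V" "H.nrm e = 1"
    and a: "a \<in> T" "\<psi> a = a" and b: "b \<in> T" "\<psi> b = b"
    and E: "rank_one H (a e) e \<in> T" and F: "rank_one H (b e) e \<in> T"
    and q: "0 < q" "q < (K.nrm (a e))\<^sup>2 + (K.nrm (b e))\<^sup>2"
    and gap: "\<And>v. v \<in> H.V \<Longrightarrow> H.ip v e = 0 \<Longrightarrow> K.ip (a v) (a e) = 0 \<and> K.ip (b v) (b e) = 0 \<and>
      (K.nrm (a v))\<^sup>2 + (K.nrm (b v))\<^sup>2 \<le> q * (H.nrm v)\<^sup>2"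
  shows "\<psi> (rank_one H (a e) e) e = a e" "\<psi> (rank_one H (b e) e) e = b e"
proof -
  define E where "E = rank_one H (a e) e"
  define F where "F = rank_one H (b e) e"
  define n2 where "n2 = (K.nrm (a e))\<^sup>2 + (K.nrm (b e))\<^sup>2"
  have n2: "n2 > 0" "q < n2" using q by (auto simp: n2_def)
  have T: "E \<in> T" "F \<in> T" using assms by (auto simp: E_def F_def)
  have aV: "a u \<in> K.V" "b u \<in> K.V" if "u \<in> H.V" for u using that a b by blast+
  \<comment> \<open>The combination acts as \<open>c\<close> on the line of \<open>e\<close> and as
    \<mu> times \<open>c\<close> on its complement; Pythagoras applies since the two images are
    orthogonal.\<close>
  have norm_dilation: "(K.nrm (((1 - of_real \<mu>) *\<^sub>C rank_one H (c e) e + of_real \<mu> *\<^sub>C c) u))\<^sup>2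
      = (cmod (H.ip u e))\<^sup>2 * (K.nrm (c e))\<^sup>2 + \<mu>\<^sup>2 * (K.nrm (c (u - H.ip u e *\<^sub>C e)))\<^sup>2"
    if c: "c \<in> T" and u: "u \<in> H.V" and perp: "K.ip (c (u - H.ip u e *\<^sub>C e)) (c e) = 0" for c u \<mu>
  proof -
    define \<alpha> where "\<alpha> = H.ip u e"
    define v where "v = u - \<alpha> *\<^sub>C e"
    have v: "v \<in> H.V" and u_eq: "u = \<alpha> *\<^sub>C e + v" using u e by (auto simp: v_def)
    have V: "c e \<in> K.V" "c v \<in> K.V" using c v e by blast+
    have "c u = \<alpha> *\<^sub>C c e + c v"
      unfolding u_eq using c v e by (simp add: bop_add[OF in_T[OF c]] bop_scale[OF in_T[OF c]])
    moreover have "rank_one H (c e) e u = \<alpha> *\<^sub>C c e" using u by (simp add: \<alpha>_def)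
    ultimately have "((1 - of_real \<mu>) *\<^sub>C rank_one H (c e) e + of_real \<mu> *\<^sub>C c) u
        = (1 - of_real \<mu>) *\<^sub>C (\<alpha> *\<^sub>C c e) + of_real \<mu> *\<^sub>C (\<alpha> *\<^sub>C c e + c v)"
      by (simp add: scaleC_fun_def)
    also have "\<dots> = \<alpha> *\<^sub>C c e + of_real \<mu> *\<^sub>C c v"
    proof -
      have "(1 - m) *\<^sub>C w + m *\<^sub>C (w + z) = w + m *\<^sub>C z" for m and w z :: 'b
        using scaleC_add_left[of "1 - m" m w] by (simp add: scaleC_add_right scaleC_one flip: add.assoc)
      then show ?thesis .
    qed
    finally show ?thesis
      using V perp K.ip_commute[of "c v" "c e"]
      by (simp add: K.nrm_add_sq K.ip_scale_left K.ip_scale_right power_mult_distrib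
          flip: \<alpha>_def v_def)
  qed
  have column: "(K.nrm (\<psi> ((1 - of_real \<mu>) *\<^sub>C E + of_real \<mu> *\<^sub>C a) e))\<^sup>2
      + (K.nrm (\<psi> ((1 - of_real \<mu>) *\<^sub>C F + of_real \<mu> *\<^sub>C b) e))\<^sup>2 \<le> n2"
    if \<mu>: "\<mu>\<^sup>2 * q \<le> n2" for \<mu> :: real
  proof -
    let ?X = "(1 - of_real \<mu>) *\<^sub>C E + of_real \<mu> *\<^sub>C a" and ?Y = "(1 - of_real \<mu>) *\<^sub>C F + of_real \<mu> *\<^sub>C b"
    have "(K.nrm (\<psi> ?X e))\<^sup>2 + (K.nrm (\<psi> ?Y e))\<^sup>2 \<le> (sqrt n2)\<^sup>2 * (H.nrm e)\<^sup>2"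
    proof (rule \<psi>_column)
      fix u assume u: "u \<in> H.V"
      define v where "v = u - H.ip u e *\<^sub>C e"
      have v: "v \<in> H.V" "H.ip v e = 0" using u e by (auto simp: v_def H.ip_diff_left H.ip_scale_left H.ip_self)
      have "u = H.ip u e *\<^sub>C e + v" by (simp add: v_def)
      then have nu: "(H.nrm u)\<^sup>2 = (cmod (H.ip u e))\<^sup>2 + (H.nrm v)\<^sup>2"
        using H.nrm_add_sq[of "H.ip u e *\<^sub>C e" v] e v H.ip_commute[of v e] by (simp add: H.ip_scale_left)
      note gapv = gap[OF v]
      have "\<mu>\<^sup>2 * ((K.nrm (a v))\<^sup>2 + (K.nrm (b v))\<^sup>2) \<le> \<mu>\<^sup>2 * (q * (H.nrm v)\<^sup>2)"
        using gapv by (intro mult_left_mono) auto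
      also have "\<dots> \<le> n2 * (H.nrm v)\<^sup>2" using mult_right_mono[OF \<mu>, of "(H.nrm v)\<^sup>2"] by (simp add: mult.assoc)
      finally have le: "\<mu>\<^sup>2 * ((K.nrm (a v))\<^sup>2 + (K.nrm (b v))\<^sup>2) \<le> n2 * (H.nrm v)\<^sup>2" .
      have "(K.nrm (?X u))\<^sup>2 + (K.nrm (?Y u))\<^sup>2
          = (cmod (H.ip u e))\<^sup>2 * n2 + \<mu>\<^sup>2 * ((K.nrm (a v))\<^sup>2 + (K.nrm (b v))\<^sup>2)"
        using norm_dilation[OF a(1) u, of \<mu>] norm_dilation[OF b(1) u, of \<mu>] gapv
        unfolding E_def F_def v_def[symmetric] by (simp add: n2_def distrib_left del: plus_fun_apply)
      then show "(K.nrm (?X u))\<^sup>2 + (K.nrm (?Y u))\<^sup>2 \<le> (sqrt n2)\<^sup>2 * (H.nrm u)\<^sup>2"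
        using le n2 nu by (simp add: distrib_left mult.commute)
    qed (use T a b n2 e in auto)
    then show ?thesis using n2 e by simp
  qed
  define x where "x = \<psi> E e"
  define y where "y = \<psi> F e"
  have V: "x \<in> K.V" "y \<in> K.V" "a e \<in> K.V" "b e \<in> K.V" using T e aV by (auto simp: x_def y_def)
  define S where "S = (K.nrm x)\<^sup>2 + (K.nrm y)\<^sup>2"
  define \<rho> where "\<rho> = Re (K.ip x (a e)) + Re (K.ip y (b e))"
  define l where "l = sqrt (n2 / q)"
  have l: "l > 1" "l\<^sup>2 * q \<le> n2" using n2 q by (simp_all add: l_def)
  have S: "S \<le> n2" using column[of 0] n2 a b T by (simp add: S_def x_def y_def scaleC_one)
  have expand: "(K.nrm ((1 - of_real l) *\<^sub>C z + of_real l *\<^sub>C w))\<^sup>2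
      = (l - 1)\<^sup>2 * (K.nrm z)\<^sup>2 + l\<^sup>2 * (K.nrm w)\<^sup>2 - 2 * l * (l - 1) * Re (K.ip z w)"
    if "z \<in> K.V" "w \<in> K.V" for z w
  proof -
    have c: "1 - complex_of_real l = of_real (1 - l)" by simp
    show ?thesis unfolding c using that K.ip_commute[of z w]
      by (simp add: K.nrm_add_sq K.ip_scale_left K.ip_scale_right power_mult_distrib power2_commute[of l 1]
          algebra_simps del: of_real_diff)
  qed
  have comb: "\<psi> (k *\<^sub>C z + m *\<^sub>C w) = k *\<^sub>C \<psi> z + m *\<^sub>C \<psi> w" if "z \<in> T" "w \<in> T" for k m z w
    using that by (simp only: \<psi>_add \<psi>_scale scale_T)
  have eqs: "\<psi> ((1 - of_real l) *\<^sub>C E + of_real l *\<^sub>C a) e = (1 - of_real l) *\<^sub>C x + of_real l *\<^sub>C a e"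
    "\<psi> ((1 - of_real l) *\<^sub>C F + of_real l *\<^sub>C b) e = (1 - of_real l) *\<^sub>C y + of_real l *\<^sub>C b e"
    unfolding comb[OF T(1) a(1)] comb[OF T(2) b(1)] a(2) b(2) x_def y_def
    by (simp_all add: scaleC_fun_def)
  have "(l - 1)\<^sup>2 * S + l\<^sup>2 * n2 - 2 * l * (l - 1) * \<rho> \<le> n2"
    using column[OF l(2)] unfolding eqs expand[OF V(1,3)] expand[OF V(2,4)]
    by (simp add: S_def \<rho>_def n2_def algebra_simps)
  then have "(l - 1) * (2 * l * \<rho>) \<ge> (l - 1) * ((l - 1) * S + (l + 1) * n2)"
    by (simp add: power2_eq_square algebra_simps)
  then have "2 * l * \<rho> \<ge> (l - 1) * S + (l + 1) * n2" using l(1) by simp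
  moreover have "(l - 1) * S + (l + 1) * n2 = l * (S + n2) + (n2 - S)" by (simp add: algebra_simps)
  ultimately have "l * (S + n2) \<le> l * (2 * \<rho>)" using S by (simp add: algebra_simps)
  then have "S + n2 \<le> 2 * \<rho>" using l(1) by simp
  moreover have "(K.nrm (x - a e))\<^sup>2 + (K.nrm (y - b e))\<^sup>2 = S + n2 - 2 * \<rho>"
    using V by (simp add: K.nrm_diff_sq S_def n2_def \<rho>_def)
  ultimately have "(K.nrm (x - a e))\<^sup>2 + (K.nrm (y - b e))\<^sup>2 \<le> 0" by simp
  then have "K.nrm (x - a e) = 0" "K.nrm (y - b e) = 0"
    by (auto simp: sum_power2_le_zero_iff)
  then have "x - a e = 0" "y - b e = 0" using V by simp_all
  then show "\<psi> (rank_one H (a e) e) e = a e" "\<psi> (rank_one H (b e) e) e = b e"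
    by (simp_all add: x_def y_def E_def F_def)
qed

end

section \<open>Multipliers\<close>

interpretation Hs: hilb_space "Hs s" for s
  by unfold_locales (rule hilbert_space_Hs)

interpretation HsHt: hilb_pair "Hs s" "Hs t" for s t
  by unfold_locales

section \<open>Monomials and Taylor coefficients in the weighted spaces\<close>

definition zpow :: "nat \<Rightarrow> complex \<Rightarrow> complex" where
  "zpow i z = (if z \<in> ball 0 1 then z ^ i else 0)"

lemma zpow_sums:
  assumes "cmod z < 1"
  shows "(\<lambda>n. (if n = i then 1 else 0) * z ^ n) sums zpow i z"
proof -
  have "(\<lambda>n. (if n = i then 1 else 0) * z ^ n) = (\<lambda>n. if n = i then z ^ n else 0)" by auto
  then show ?thesis using sums_single[of i "\<lambda>n. z ^ n"] assms by (simp add: zpow_def)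
qed

lemma taylor_coeff_zpow: "taylor_coeff (zpow i) k = (if k = i then 1 else 0)"
  using taylor_coeff_powser(2)[OF zpow_sums, of i] by (simp add: fun_eq_iff)

lemma zpow_Hs [simp, intro]: "zpow i \<in> hcarrier (Hs s)"
proof -
  have "summable (\<lambda>n. (cmod (taylor_coeff (zpow i) n))\<^sup>2 * (real n + 1) powr (-s))"
    by (rule summable_finite[of "{i}"]) (auto simp: taylor_coeff_zpow)
  moreover have "\<forall>z. z \<notin> ball 0 1 \<longrightarrow> zpow i z = 0" by (simp add: zpow_def)
  ultimately show ?thesis using taylor_coeff_powser(1)[OF zpow_sums, of i] by (simp add: Hs_def)
qed

lemma hinner_zpow:
  assumes "f \<in> hcarrier (Hs s)"
  shows "hinner (Hs s) f (zpow i) = taylor_coeff f i * of_real ((real i + 1) powr (-s))"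
proof -
  have "(\<lambda>n. if n = i then taylor_coeff f n * of_real ((real n + 1) powr (-s)) else 0) sums hinner (Hs s) f (zpow i)"
    using hinner_Hs_sums[OF assms zpow_Hs, of i]
    by (rule back_subst[of "\<lambda>g. g sums _"]) (auto simp: taylor_coeff_zpow)
  from sums_unique2[OF this sums_single] show ?thesis .
qed

lemma hnorm_zpow_0 [simp]: "hnorm (Hs s) (zpow 0) = 1"
  by (simp add: hnorm_def hinner_zpow taylor_coeff_zpow)

lemma Hs_zero_iff:
  assumes "f \<in> hcarrier (Hs s)" "\<And>i. hinner (Hs s) f (zpow i) = 0"
  shows "f = 0"
  using assms by (intro Hs_eqI[of f s 0]) (auto simp: hinner_zpow add_nonneg_eq_0_iff)

text \<open>Up to the weight, the coefficient is the inner product with a monomial, so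
  Cauchy-Schwarz bounds it.\<close>

lemma taylor_coeff_bound:
  assumes "f \<in> hcarrier (Hs s)"
  shows "cmod (taylor_coeff f i) \<le> (hnorm (Hs s) (zpow i) * (real i + 1) powr s) * hnorm (Hs s) f"
proof -
  have "cmod (taylor_coeff f i) = cmod (hinner (Hs s) f (zpow i)) * (real i + 1) powr s"
    using assms by (simp add: hinner_zpow norm_mult mult.assoc flip: powr_add)
  also have "\<dots> \<le> hnorm (Hs s) f * hnorm (Hs s) (zpow i) * (real i + 1) powr s"
    using assms by (intro mult_right_mono Hs.Cauchy_Schwarz) auto
  finally show ?thesis by (simp add: mult_ac)
qed

section \<open>Multiplication operators, their boundedness and the monomial multipliers\<close>

lemma taylor_coeff_mult:
  assumes "f holomorphic_on ball 0 1" "g holomorphic_on ball 0 1"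
  shows "taylor_coeff (\<lambda>z. f z * g z) n = (\<Sum>i\<le>n. taylor_coeff f i * taylor_coeff g (n - i))"
proof -
  have "taylor_coeff (\<lambda>z. f z * g z) n =
      (\<Sum>i=0..n. of_nat (n choose i) * (deriv ^^ i) f 0 * (deriv ^^ (n - i)) g 0) / fact n"
    unfolding taylor_coeff_def using higher_deriv_mult[OF assms, of 0 n] by simp
  also have "\<dots> = (\<Sum>i\<le>n. taylor_coeff f i * taylor_coeff g (n - i))"
    unfolding sum_divide_distrib atMost_atLeast0
    by (intro sum.cong) (auto simp: taylor_coeff_def binomial_fact)
  finally show ?thesis .
qed

lemma Hs_holomorphic: "f \<in> hcarrier (Hs s) \<Longrightarrow> f holomorphic_on ball 0 1"
  by (simp add: Hs_def)

text \<open>\<phi> is its own product with the constant function 1 on the disc, which is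
  \<open>zpow 0\<close>.\<close>

lemma Mult_subset_Hs:
  assumes "\<phi> \<in> Mult s t"
  shows "\<phi> \<in> hcarrier (Hs t)"
proof -
  have "(\<lambda>z. \<phi> z * zpow 0 z) \<in> hcarrier (Hs t)" using assms by (simp add: Mult_def)
  moreover have "(\<lambda>z. \<phi> z * zpow 0 z) = \<phi>" using assms by (auto simp: Mult_def zpow_def)
  ultimately show ?thesis by simp
qed

lemma mult_op_apply: "f \<in> hcarrier (Hs s) \<Longrightarrow> mult_op s \<phi> f = (\<lambda>z. \<phi> z * f z)"
  by (simp add: mult_op_def)

lemma taylor_coeff_mult_op:
  assumes "\<phi> \<in> Mult s t" "f \<in> hcarrier (Hs s)"
  shows "taylor_coeff (mult_op s \<phi> f) n = (\<Sum>i\<le>n. taylor_coeff \<phi> i * taylor_coeff f (n - i))"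
  using taylor_coeff_mult[OF Hs_holomorphic[OF Mult_subset_Hs[OF assms(1)]] Hs_holomorphic[OF assms(2)], of n]
  by (simp add: mult_op_apply assms)

text \<open>\<open>p N f\<close> is the norm of the first \<open>N\<close> terms of the product. It
  is bounded in \<open>f\<close> for fixed \<open>N\<close>, because each coefficient of a product
  involves finitely many coefficients of the factors, and bounded in \<open>N\<close> for fixed
  \<open>f\<close> by the norm of the product. Uniform boundedness and the limit in \<open>N\<close>
  give the operator bound.\<close>

lemma mult_op_bounded:
  assumes \<phi>: "\<phi> \<in> Mult s t"
  shows "mult_op s \<phi> \<in> bounded_ops (Hs s) (Hs t)"
proof -
  let ?w = "\<lambda>k. sqrt ((real k + 1) powr (-t))"
  have M: "mult_op s \<phi> f \<in> hcarrier (Hs t)" if "f \<in> hcarrier (Hs s)" for f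
    using \<phi> that by (simp add: Mult_def mult_op_def)
  have add: "mult_op s \<phi> (f + g) = mult_op s \<phi> f + mult_op s \<phi> g"
    if "f \<in> hcarrier (Hs s)" "g \<in> hcarrier (Hs s)" for f g
    using that by (simp add: mult_op_apply fun_eq_iff distrib_left)
  have scale: "mult_op s \<phi> (c *\<^sub>C f) = c *\<^sub>C mult_op s \<phi> f" if "f \<in> hcarrier (Hs s)" for f c
    using that Hs.scale_in[OF that, of c] by (simp add: mult_op_apply fun_eq_iff scaleC_fun_def scaleC_complex_def)
  define p where "p N f = L2_set (\<lambda>k. cmod (taylor_coeff (mult_op s \<phi> f) k) * ?w k) {..<N}" for N f
  have p_sq: "(p N f)\<^sup>2 = (\<Sum>k<N. (cmod (taylor_coeff (mult_op s \<phi> f) k))\<^sup>2 * (real k + 1) powr (-t))" for N f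
    unfolding p_def L2_set_def by (subst real_sqrt_pow2) (auto intro!: sum_nonneg simp: power_mult_distrib)
  have p_nonneg: "p N f \<ge> 0" for N f by (simp add: p_def)
  have p_le: "p N f \<le> hnorm (Hs t) (mult_op s \<phi> f)" if f: "f \<in> hcarrier (Hs s)" for N f
  proof (rule power2_le_imp_le)
    note sm = hnorm_Hs_sums(1)[OF M[OF f]]
    show "(p N f)\<^sup>2 \<le> (hnorm (Hs t) (mult_op s \<phi> f))\<^sup>2"
      unfolding p_sq sums_unique[OF sm] by (rule sum_le_suminf) (use sm in \<open>auto simp: sums_iff\<close>)
  qed (use M f in auto)
  obtain B where B: "\<And>N f. f \<in> hcarrier (Hs s) \<Longrightarrow> p N f \<le> B * hnorm (Hs s) f"
  proof (rule Hs.uniform_boundedness[of s p])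
    fix N f g assume fg: "f \<in> hcarrier (Hs s)" "g \<in> hcarrier (Hs s)"
    have "p N (f + g) \<le> L2_set (\<lambda>k. cmod (taylor_coeff (mult_op s \<phi> f) k) * ?w k
        + cmod (taylor_coeff (mult_op s \<phi> g) k) * ?w k) {..<N}"
      unfolding p_def add[OF fg] Hs_add(2)[OF M[OF fg(1)] M[OF fg(2)]] distrib_right[symmetric]
      by (intro L2_set_mono mult_right_mono norm_triangle_ineq) auto
    also have "\<dots> \<le> p N f + p N g" unfolding p_def by (rule L2_set_triangle_ineq)
    finally show "p N (f + g) \<le> p N f + p N g" .
  next
    fix N c f assume f: "f \<in> hcarrier (Hs s)"
    show "p N (c *\<^sub>C f) = cmod c * p N f"
      unfolding p_def scale[OF f] Hs_scaleC(2)[OF M[OF f]]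
      by (simp add: L2_set_right_distrib norm_mult mult.assoc)
  next
    fix N f assume f: "f \<in> hcarrier (Hs s)"
    define c where "c i = hnorm (Hs s) (zpow i) * (real i + 1) powr s" for i
    have "p N f \<le> (\<Sum>k<N. cmod (taylor_coeff (mult_op s \<phi> f) k) * ?w k)"
      unfolding p_def by (rule L2_set_le_sum) simp
    also have "\<dots> \<le> (\<Sum>k<N. ((\<Sum>i\<le>k. cmod (taylor_coeff \<phi> i) * c (k - i)) * hnorm (Hs s) f) * ?w k)"
    proof (intro sum_mono mult_right_mono)
      fix k
      have "cmod (taylor_coeff (mult_op s \<phi> f) k) \<le> (\<Sum>i\<le>k. cmod (taylor_coeff \<phi> i * taylor_coeff f (k - i)))"
        unfolding taylor_coeff_mult_op[OF \<phi> f] by (rule norm_sum)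
      also have "\<dots> \<le> (\<Sum>i\<le>k. cmod (taylor_coeff \<phi> i) * (c (k - i) * hnorm (Hs s) f))"
        unfolding norm_mult c_def by (intro sum_mono mult_left_mono taylor_coeff_bound f) auto
      finally show "cmod (taylor_coeff (mult_op s \<phi> f) k)
          \<le> (\<Sum>i\<le>k. cmod (taylor_coeff \<phi> i) * c (k - i)) * hnorm (Hs s) f"
        by (simp add: sum_distrib_right mult.assoc)
    qed auto
    also have "\<dots> = (\<Sum>k<N. (\<Sum>i\<le>k. cmod (taylor_coeff \<phi> i) * c (k - i)) * ?w k) * hnorm (Hs s) f"
      by (subst sum_distrib_right) (simp only: mult_ac)
    finally show "p N f \<le> (\<Sum>k<N. (\<Sum>i\<le>k. cmod (taylor_coeff \<phi> i) *
        (hnorm (Hs s) (zpow (k - i)) * (real (k - i) + 1) powr s)) * ?w k) * hnorm (Hs s) f"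
      by (simp add: c_def)
  qed (use p_le in blast)+
  show ?thesis
  proof (rule bounded_opsI[where C=B])
    fix f assume f: "f \<in> hcarrier (Hs s)"
    have B0: "B * hnorm (Hs s) f \<ge> 0" using B[OF f, of 0] p_nonneg[of 0 f] by linarith
    have "(\<Sum>k<N. (cmod (taylor_coeff (mult_op s \<phi> f) k))\<^sup>2 * (real k + 1) powr (-t)) \<le> (B * hnorm (Hs s) f)\<^sup>2" for N
      unfolding p_sq[symmetric] by (intro power_mono B f p_nonneg)
    then have "(hnorm (Hs t) (mult_op s \<phi> f))\<^sup>2 \<le> (B * hnorm (Hs s) f)\<^sup>2"
      unfolding sums_unique[OF hnorm_Hs_sums(1)[OF M[OF f]]]
      by (rule suminf_le_const[OF sums_summable[OF hnorm_Hs_sums(1)[OF M[OF f]]]])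
    then show "hnorm (Hs t) (mult_op s \<phi> f) \<le> B * hnorm (Hs s) f" using B0 by (rule power2_le_imp_le)
  qed (use M add scale in \<open>auto simp: mult_op_def\<close>)
qed

lemma Mult_ops_subspace: "csubspace (Mult_ops s t)"
proof (rule complex_space.subspaceI)
  have "mult_op s 0 = 0" by (simp add: mult_op_def fun_eq_iff)
  moreover have "0 \<in> Mult s t"
    using Hs.zero_in[of t] by (simp add: Mult_def zero_fun_def)
  ultimately show "0 \<in> Mult_ops s t" by (force simp: Mult_ops_def)
next
  fix x y assume "x \<in> Mult_ops s t" "y \<in> Mult_ops s t"
  then obtain \<phi> \<eta> where *: "\<phi> \<in> Mult s t" "\<eta> \<in> Mult s t" "x = mult_op s \<phi>" "y = mult_op s \<eta>"
    by (auto simp: Mult_ops_def)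
  have "(\<lambda>z. (\<phi> + \<eta>) z * f z) \<in> hcarrier (Hs t)" if "f \<in> hcarrier (Hs s)" for f
    using Hs.add_in[of "\<lambda>z. \<phi> z * f z" t "\<lambda>z. \<eta> z * f z"] * that
    by (simp add: Mult_def plus_fun_def distrib_right)
  then have "\<phi> + \<eta> \<in> Mult s t" using * by (simp add: Mult_def)
  moreover have "x + y = mult_op s (\<phi> + \<eta>)"
    using * by (simp add: mult_op_def fun_eq_iff distrib_right)
  ultimately show "x + y \<in> Mult_ops s t" by (simp add: Mult_ops_def)
next
  fix c x assume "x \<in> Mult_ops s t"
  then obtain \<phi> where *: "\<phi> \<in> Mult s t" "x = mult_op s \<phi>"
    by (auto simp: Mult_ops_def)
  have "(\<lambda>z. (c *\<^sub>C \<phi>) z * f z) \<in> hcarrier (Hs t)" if "f \<in> hcarrier (Hs s)" for f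
    using Hs.scale_in[of "\<lambda>z. \<phi> z * f z" t c] * that
    by (simp add: Mult_def scaleC_fun_def scaleC_complex_def mult.assoc)
  then have "c *\<^sub>C \<phi> \<in> Mult s t" using * by (simp add: Mult_def scaleC_fun_def scaleC_complex_def)
  moreover have "c *\<^sub>C x = mult_op s (c *\<^sub>C \<phi>)"
    using * by (simp add: mult_op_def fun_eq_iff scaleC_fun_def scaleC_complex_def mult.assoc)
  ultimately show "c *\<^sub>C x \<in> Mult_ops s t" by (simp add: Mult_ops_def)
qed

lemma Mult_ops_bounded: "Mult_ops s t \<subseteq> bounded_ops (Hs s) (Hs t)"
  using mult_op_bounded by (auto simp: Mult_ops_def)

text \<open>Comparison of weights behind the boundedness of multiplication by a monomial. For
  \<open>s \<ge> 0\<close> the weight decreases; for \<open>s < 0\<close> use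
  \<open>k + i + 1 \<le> (i + 1) * (k + 1)\<close>. The absolute value covers both cases.\<close>

lemma powr_shift_le:
  fixes s t :: real
  assumes "s \<le> t"
  shows "(real (k + i) + 1) powr (-t) \<le> (real i + 1) powr \<bar>s\<bar> * (real k + 1) powr (-s)"
proof -
  have "(real (k + i) + 1) powr (-t) \<le> (real (k + i) + 1) powr (-s)"
    using assms by (intro powr_mono) auto
  also have "\<dots> \<le> (real i + 1) powr \<bar>s\<bar> * (real k + 1) powr (-s)"
  proof (cases "s \<ge> 0")
    case True
    have "(real (k + i) + 1) powr (-s) \<le> 1 * (real k + 1) powr (-s)"
      using True by (simp add: powr_mono2')
    also have "\<dots> \<le> (real i + 1) powr \<bar>s\<bar> * (real k + 1) powr (-s)"
      by (intro mult_right_mono ge_one_powr_ge_zero) auto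
    finally show ?thesis .
  next
    case False
    have "(real (k + i) + 1) powr (-s) \<le> ((real i + 1) * (real k + 1)) powr (-s)"
      using False by (intro powr_mono2) (auto simp: algebra_simps)
    then show ?thesis using False by (simp add: powr_mult)
  qed
  finally show ?thesis .
qed

lemma taylor_coeff_zpow_mult:
  assumes "f \<in> hcarrier (Hs s)"
  shows "taylor_coeff (\<lambda>z. zpow i z * f z) k = (if i \<le> k then taylor_coeff f (k - i) else 0)"
proof -
  have "(\<Sum>j\<le>k. (if j = i then 1 else 0) * taylor_coeff f (k - j))
      = (\<Sum>j\<le>k. if j = i then taylor_coeff f (k - j) else 0)"
    by (intro sum.cong) auto
  then show ?thesis
    using taylor_coeff_mult[OF Hs_holomorphic[OF zpow_Hs] Hs_holomorphic[OF assms], of i k]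
    by (simp add: taylor_coeff_zpow)
qed

lemma zpow_Mult:
  assumes "s \<le> t"
  shows "zpow i \<in> Mult s t"
proof -
  have "(\<lambda>z. zpow i z * f z) \<in> hcarrier (Hs t)" if f: "f \<in> hcarrier (Hs s)" for f
  proof -
    have "(\<lambda>z. zpow i z * f z) holomorphic_on ball 0 1"
      by (intro holomorphic_on_mult Hs_holomorphic[OF zpow_Hs] Hs_holomorphic[OF f])
    moreover have "summable (\<lambda>k. (cmod (taylor_coeff f k))\<^sup>2 * (real (k + i) + 1) powr (-t))"
    proof (rule summable_comparison_test')
      show "summable (\<lambda>k. (real i + 1) powr \<bar>s\<bar> * ((cmod (taylor_coeff f k))\<^sup>2 * (real k + 1) powr (-s)))"
        by (intro summable_mult) (use f in \<open>simp add: Hs_def\<close>)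
      fix k
      show "norm ((cmod (taylor_coeff f k))\<^sup>2 * (real (k + i) + 1) powr (-t))
          \<le> (real i + 1) powr \<bar>s\<bar> * ((cmod (taylor_coeff f k))\<^sup>2 * (real k + 1) powr (-s))"
        using mult_left_mono[OF powr_shift_le[OF assms, of k i], of "(cmod (taylor_coeff f k))\<^sup>2"]
        by (simp add: mult_ac)
    qed
    then have "summable (\<lambda>k. (cmod (taylor_coeff (\<lambda>z. zpow i z * f z) k))\<^sup>2 * (real k + 1) powr (-t))"
      by (subst summable_iff_shift[symmetric, of _ i]) (simp add: taylor_coeff_zpow_mult[OF f])
    ultimately show ?thesis using f by (simp add: Hs_def)
  qed
  then show ?thesis by (simp add: Mult_def zpow_def)
qed

section \<open>The TRO generated by the multipliers\<close>

abbreviation mon_op :: "real \<Rightarrow> nat \<Rightarrow> (complex \<Rightarrow> complex) \<Rightarrow> complex \<Rightarrow> complex" where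
  "mon_op s i \<equiv> mult_op s (zpow i)"

abbreviation Mult_TRO :: "real \<Rightarrow> real \<Rightarrow> ((complex \<Rightarrow> complex) \<Rightarrow> complex \<Rightarrow> complex) set" where
  "Mult_TRO s t \<equiv> generated_TRO (Hs s) (Hs t) (Mult_ops s t)"

lemma TRO_Mult_TRO: "TRO (Hs s) (Hs t) (Mult_TRO s t)"
  by (rule HsHt.TRO_generated_TRO[OF Mult_ops_bounded])

lemma Mult_ops_subset_TRO: "Mult_ops s t \<subseteq> Mult_TRO s t"
  by (auto simp: generated_TRO_def)

lemma mon_op_zpow [simp]: "mon_op s i (zpow k) = zpow (i + k)"
  by (simp add: mult_op_apply fun_eq_iff zpow_def power_add)

lemma taylor_coeff_mon_op:
  "f \<in> hcarrier (Hs s) \<Longrightarrow> taylor_coeff (mon_op s i f) k = (if i \<le> k then taylor_coeff f (k - i) else 0)"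
  by (simp add: mult_op_apply taylor_coeff_zpow_mult)

context
  fixes s t :: real
  assumes st: "s < t"
begin

lemma mon_op_Mult_ops: "mon_op s i \<in> Mult_ops s t"
  using zpow_Mult[of s t i] st by (simp add: Mult_ops_def)

lemma mon_op_TRO [simp, intro]: "mon_op s i \<in> Mult_TRO s t"
  using mon_op_Mult_ops Mult_ops_subset_TRO by blast

lemma mon_op_bop [simp, intro]: "mon_op s i \<in> bounded_ops (Hs s) (Hs t)"
  using mon_op_Mult_ops Mult_ops_bounded by blast

lemma hnorm_mon_op_sums:
  assumes f: "f \<in> hcarrier (Hs s)"
  shows "(\<lambda>k. (cmod (taylor_coeff f k))\<^sup>2 * (real (k + i) + 1) powr (-t)) sums (hnorm (Hs t) (mon_op s i f))\<^sup>2"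
proof -
  have "(\<lambda>k. (cmod (taylor_coeff (mon_op s i f) k))\<^sup>2 * (real k + 1) powr (-t)) sums (hnorm (Hs t) (mon_op s i f))\<^sup>2"
    by (rule hnorm_Hs_sums(1)[OF bop_in[OF mon_op_bop f]])
  then have "(\<lambda>k. (cmod (taylor_coeff (mon_op s i f) (k + i)))\<^sup>2 * (real (k + i) + 1) powr (-t))
      sums (hnorm (Hs t) (mon_op s i f))\<^sup>2"
    by (subst sums_iff_shift) (simp add: taylor_coeff_mon_op[OF f])
  then show ?thesis by (simp add: taylor_coeff_mon_op[OF f])
qed

lemma hnorm_mon_op_le:
  assumes f: "f \<in> hcarrier (Hs s)"
  shows "(hnorm (Hs t) (mon_op s i f))\<^sup>2 \<le> (real i + 1) powr \<bar>s\<bar> * (hnorm (Hs s) f)\<^sup>2"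
proof (rule sums_le[OF _ hnorm_mon_op_sums[OF f] sums_mult[OF hnorm_Hs_sums(1)[OF f]]])
  fix k
  show "(cmod (taylor_coeff f k))\<^sup>2 * (real (k + i) + 1) powr (-t)
      \<le> (real i + 1) powr \<bar>s\<bar> * ((cmod (taylor_coeff f k))\<^sup>2 * (real k + 1) powr (-s))"
    using mult_left_mono[OF powr_shift_le[of s t k i], of "(cmod (taylor_coeff f k))\<^sup>2"] st
    by (simp add: mult_ac)
qed

lemma hnorm_inclusion_le:
  assumes f: "f \<in> hcarrier (Hs s)"
  shows "hnorm (Hs t) (mon_op s 0 f) \<le> hnorm (Hs s) f"
  by (rule power2_le_imp_le[OF _ Hs.nrm_ge_0[OF f]]) (use hnorm_mon_op_le[OF f, of 0] in simp)

text \<open>The squared singular values of the inclusion are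
  \<open>(real k + 1) powr (s - t)\<close>; below the top value 1 the largest occurs at
  \<open>k = 1\<close>.\<close>

lemma powr_gap:
  assumes "k \<noteq> 0"
  shows "(real k + 1) powr (s - t) \<le> 2 powr (s - t)"
  using assms st by (intro powr_mono2') auto

lemma hnorm_inclusion_gap:
  assumes f: "f \<in> hcarrier (Hs s)" "taylor_coeff f 0 = 0"
  shows "(hnorm (Hs t) (mon_op s 0 f))\<^sup>2 \<le> 2 powr (s - t) * (hnorm (Hs s) f)\<^sup>2"
proof (rule sums_le[OF _ hnorm_mon_op_sums[OF f(1)] sums_mult[OF hnorm_Hs_sums(1)[OF f(1)]]])
  fix k
  have "(real k + 1) powr (-t) = (real k + 1) powr (s - t) * (real k + 1) powr (-s)"
    by (simp flip: powr_add)
  then show "(cmod (taylor_coeff f k))\<^sup>2 * (real (k + 0) + 1) powr (-t)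
      \<le> 2 powr (s - t) * ((cmod (taylor_coeff f k))\<^sup>2 * (real k + 1) powr (-s))"
    using mult_right_mono[OF powr_gap, of k "(cmod (taylor_coeff f k))\<^sup>2 * (real k + 1) powr (-s)"] f(2)
    by (cases "k = 0") (simp_all add: mult_ac)
qed

text \<open>Pairing with \<open>zpow k\<close> in both spaces shows that the adjoint is diagonal,
  with the quotient of the two weights as entries.\<close>

lemma taylor_coeff_adj_inclusion:
  assumes v: "v \<in> hcarrier (Hs t)"
  shows "taylor_coeff (op_adj (Hs s) (Hs t) (mon_op s 0) v) k = of_real ((real k + 1) powr (s - t)) * taylor_coeff v k"
proof -
  let ?w = "op_adj (Hs s) (Hs t) (mon_op s 0) v"
  have w: "?w \<in> hcarrier (Hs s)" by (rule HsHt.op_adj_in[OF mon_op_bop v])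
  have "hinner (Hs s) (zpow k) ?w = hinner (Hs t) (zpow k) v"
    using HsHt.ip_op_adj[OF mon_op_bop[of 0] v zpow_Hs[of k]] by simp
  then have "hinner (Hs s) ?w (zpow k) = hinner (Hs t) v (zpow k)"
    using Hs.ip_commute[OF w zpow_Hs[of k]] Hs.ip_commute[OF v zpow_Hs[of k]] by simp
  then have *: "taylor_coeff ?w k * of_real ((real k + 1) powr (-s)) = taylor_coeff v k * of_real ((real k + 1) powr (-t))"
    using w v by (simp add: hinner_zpow)
  have "(real k + 1) powr (-t) = (real k + 1) powr (s - t) * (real k + 1) powr (-s)"
    by (simp flip: powr_add)
  with * have "taylor_coeff ?w k * of_real ((real k + 1) powr (-s))
      = (of_real ((real k + 1) powr (s - t)) * taylor_coeff v k) * of_real ((real k + 1) powr (-s))"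
    by (simp only: of_real_mult mult_ac)
  then show ?thesis by simp
qed

text \<open>The powers \<open>(J J\<^sup>*)\<^sup>n J\<close> of the inclusion \<open>J\<close> of \<open>H_s\<close> in \<open>H_t\<close> are diagonal
  with entries \<open>(k + 1) powr (s - t)\<close> to the power \<open>n\<close>, hence converge to the projection onto the constants.\<close>

lemma rank_one_const_TRO: "rank_one (Hs s) (zpow 0) (zpow 0) \<in> Mult_TRO s t"
proof -
  let ?J = "mon_op s 0" and ?E = "rank_one (Hs s) (zpow 0) (zpow 0)"
  define X where "X = rec_nat ?J (\<lambda>_ x. ?J \<circ> op_adj (Hs s) (Hs t) ?J \<circ> x)"
  have X0: "X 0 = ?J" and XSuc: "X (Suc n) = ?J \<circ> op_adj (Hs s) (Hs t) ?J \<circ> X n" for n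
    by (simp_all add: X_def)
  have XT: "X n \<in> Mult_TRO s t" for n
  proof (induction n)
    case (Suc n)
    show ?case unfolding XSuc by (rule TRO_ternary[OF TRO_Mult_TRO mon_op_TRO mon_op_TRO Suc])
  qed (simp add: X0)
  have XB: "X n \<in> bounded_ops (Hs s) (Hs t)" for n
    by (rule subsetD[OF TRO_subset[OF TRO_Mult_TRO] XT])
  have EB: "?E \<in> bounded_ops (Hs s) (Hs t)" by (rule HsHt.rank_one_bop[OF zpow_Hs zpow_Hs])
  \<comment> \<open>A bound below 1 for all diagonal entries except the first, which is 1 and is
    removed by \<open>?E\<close>.\<close>
  define \<kappa> where "\<kappa> = 2 powr (s - t)"
  have \<kappa>: "0 \<le> \<kappa>" "\<kappa> < 1" using st powr_less_mono[of "s - t" 0 2] by (simp_all add: \<kappa>_def)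
  have coeff: "taylor_coeff (X n f) k = of_real ((real k + 1) powr (s - t)) ^ n * taylor_coeff f k"
    if f: "f \<in> hcarrier (Hs s)" for n k f
  proof (induction n)
    case (Suc n)
    have v: "X n f \<in> hcarrier (Hs t)" by (rule bop_in[OF XB f])
    have "op_adj (Hs s) (Hs t) ?J (X n f) \<in> hcarrier (Hs s)" by (rule HsHt.op_adj_in[OF mon_op_bop v])
    then show ?case using Suc by (simp add: XSuc taylor_coeff_mon_op taylor_coeff_adj_inclusion[OF v])
  qed (use f in \<open>simp add: X0 taylor_coeff_mon_op\<close>)
  have le: "hnorm (Hs t) ((X n - ?E) f) \<le> \<kappa> ^ n * hnorm (Hs s) f" if f: "f \<in> hcarrier (Hs s)" for n f
  proof (rule power2_le_imp_le)
    have V: "X n f \<in> hcarrier (Hs t)" "?E f \<in> hcarrier (Hs t)" by (rule bop_in[OF XB f], rule bop_in[OF EB f])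
    let ?d = "\<lambda>k. taylor_coeff (X n f - ?E f) k"
    have "taylor_coeff (?E f) k = (if k = 0 then taylor_coeff f 0 else 0)" for k
      using f Hs_scaleC(2)[OF zpow_Hs] by (simp add: hinner_zpow taylor_coeff_zpow)
    then have d: "?d k = (if k = 0 then 0 else of_real ((real k + 1) powr (s - t)) ^ n * taylor_coeff f k)" for k
      unfolding Hs_diff(2)[OF V] by (simp add: coeff[OF f])
    have sm: "(\<lambda>k. (cmod (?d k))\<^sup>2 * (real k + 1) powr (-t)) sums (hnorm (Hs t) (X n f - ?E f))\<^sup>2"
      by (rule hnorm_Hs_sums(1)[OF Hs.diff_in[OF V]])
    have "(hnorm (Hs t) (X n f - ?E f))\<^sup>2 \<le> (\<kappa> ^ n)\<^sup>2 * (hnorm (Hs s) f)\<^sup>2"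
    proof (rule sums_le[OF _ sm sums_mult[OF hnorm_Hs_sums(1)[OF f]]])
      fix k
      have "cmod (?d k) \<le> \<kappa> ^ n * cmod (taylor_coeff f k)"
        using powr_gap[of k] \<kappa> unfolding d
        by (auto simp: norm_mult norm_power \<kappa>_def intro!: mult_right_mono power_mono)
      then have "(cmod (?d k))\<^sup>2 \<le> (\<kappa> ^ n * cmod (taylor_coeff f k))\<^sup>2" by (intro power_mono) auto
      then have "(cmod (?d k))\<^sup>2 * (real k + 1) powr (-t) \<le> (\<kappa> ^ n * cmod (taylor_coeff f k))\<^sup>2 * (real k + 1) powr (-s)"
        using st by (intro mult_mono powr_mono) auto
      then show "(cmod (?d k))\<^sup>2 * (real k + 1) powr (-t)
          \<le> (\<kappa> ^ n)\<^sup>2 * ((cmod (taylor_coeff f k))\<^sup>2 * (real k + 1) powr (-s))"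
        by (simp add: power_mult_distrib mult.assoc)
    qed
    then show "(hnorm (Hs t) ((X n - ?E) f))\<^sup>2 \<le> (\<kappa> ^ n * hnorm (Hs s) f)\<^sup>2" by (simp only: minus_apply power_mult_distrib)
  qed (use f \<kappa> in simp)
  have "(\<lambda>n. op_norm (Hs s) (Hs t) (X n - ?E)) \<longlonglongrightarrow> 0"
  proof (rule tendsto_sandwich[of "\<lambda>_. 0" _ _ "\<lambda>n. \<kappa> ^ n"])
    have "op_norm (Hs s) (Hs t) (X n - ?E) \<le> \<kappa> ^ n" for n
      using \<kappa> by (intro HsHt.op_norm_le le) auto
    then show "\<forall>\<^sub>F n in sequentially. op_norm (Hs s) (Hs t) (X n - ?E) \<le> \<kappa> ^ n" by simp
    have "0 \<le> op_norm (Hs s) (Hs t) (X n - ?E)" for n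
    proof -
      have "hnorm (Hs t) ((X n - ?E) 0) \<le> op_norm (Hs s) (Hs t) (X n - ?E)"
      proof (rule op_normD)
        fix f assume "f \<in> hcarrier (Hs s)" "hnorm (Hs s) f \<le> 1"
        then show "hnorm (Hs t) ((X n - ?E) f) \<le> \<kappa> ^ n"
          using le[of f n] mult_left_le[of "hnorm (Hs s) f" "\<kappa> ^ n"] \<kappa> by auto
      qed (simp_all only: Hs.zero_in Hs.nrm_zero zero_le_one)
      moreover have "(X n - ?E) 0 = 0"
        using HsHt.bop_zero[OF XB[of n]] HsHt.bop_zero[OF EB] by simp
      ultimately show ?thesis by simp
    qed
    then show "\<forall>\<^sub>F n in sequentially. 0 \<le> op_norm (Hs s) (Hs t) (X n - ?E)" by simp
    show "(\<lambda>n. \<kappa> ^ n) \<longlonglongrightarrow> 0" using \<kappa> by (simp add: LIMSEQ_realpow_zero)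
  qed simp
  then show ?thesis by (rule TRO_closed[OF TRO_Mult_TRO XT EB])
qed

text \<open>The adjoint of \<open>?E\<close> followed after \<open>?E\<close> is the projection of
  the domain onto the constants; multiplication by \<open>zpow i\<close> then takes 1 to the
  monomial.\<close>

lemma rank_one_zpow_TRO: "rank_one (Hs s) (zpow i) (zpow 0) \<in> Mult_TRO s t"
proof -
  let ?E = "rank_one (Hs s) (zpow 0) (zpow 0)"
  have adj: "op_adj (Hs s) (Hs t) ?E k = hinner (Hs t) k (zpow 0) *\<^sub>C zpow 0" if "k \<in> hcarrier (Hs t)" for k
    by (rule HsHt.op_adj_rank_one[OF zpow_Hs zpow_Hs that])
  have "(mon_op s i \<circ> op_adj (Hs s) (Hs t) ?E \<circ> ?E) f = rank_one (Hs s) (zpow i) (zpow 0) f" for f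
  proof (cases "f \<in> hcarrier (Hs s)")
    case True
    then show ?thesis
      by (simp add: adj Hs.ip_scale_left[OF zpow_Hs zpow_Hs] Hs.scale_in[OF zpow_Hs] Hs.ip_self[OF zpow_Hs]
          bop_scale[OF mon_op_bop zpow_Hs])
  next
    case False
    then show ?thesis
      by (simp add: rank_one_outside adj HsHt.bop_zero[OF mon_op_bop])
  qed
  then have "mon_op s i \<circ> op_adj (Hs s) (Hs t) ?E \<circ> ?E = rank_one (Hs s) (zpow i) (zpow 0)" by (rule ext)
  then show ?thesis
    using TRO_ternary[OF TRO_Mult_TRO mon_op_TRO rank_one_const_TRO rank_one_const_TRO, of i] by simp
qed

end

section \<open>Rigidity and irreducibility for the multipliers\<close>

context
  fixes s t :: real
  assumes st: "s < t"
begin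

lemma adj_inclusion_dense:
  assumes h: "h \<in> hcarrier (Hs s)" and \<epsilon>: "\<epsilon> > 0"
    and D: "csubspace D" "D \<subseteq> hcarrier (Hs t)" "\<And>i. zpow i \<in> D"
  shows "\<exists>g\<in>D. hnorm (Hs s) (h - op_adj (Hs s) (Hs t) (mon_op s 0) g) < \<epsilon>"
proof -
  \<comment> \<open>The coefficients that the diagonal adjoint of the inclusion maps to those of
    \<open>h\<close>; thus the image of \<open>g N\<close> is exactly the partial sum of
    \<open>h\<close>, and the error is a tail.\<close>
  define a where "a k = taylor_coeff h k / of_real ((real k + 1) powr (s - t))" for k
  define g where "g N = (\<Sum>k<N. a k *\<^sub>C zpow k)" for N
  have gD: "g N \<in> D" for N
    unfolding g_def by (intro complex_space.subspace_sum complex_space.subspace_scale D)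
  have gV: "g N \<in> hcarrier (Hs t)" for N using gD D(2) by (rule subsetD[rotated])
  have gc: "taylor_coeff (g N) k = (if k < N then a k else 0)" for N k
  proof (induction N)
    case (Suc N)
    have "taylor_coeff (g (Suc N)) k = taylor_coeff (g N) k + a N * taylor_coeff (zpow N) k"
      using Hs_add(2)[OF gV[of N] Hs_scaleC(1)[OF zpow_Hs[of N t], of "a N"], of k]
        Hs_scaleC(2)[OF zpow_Hs[of N t], of "a N" k]
      by (simp add: g_def)
    then show ?case using Suc by (auto simp: taylor_coeff_zpow less_Suc_eq)
  next
    case 0
    have g0: "g 0 = 0" by (simp only: g_def lessThan_0 sum.empty)
    show ?case unfolding g0 taylor_coeff_zero by simp
  qed
  let ?f = "\<lambda>k. (cmod (taylor_coeff h k))\<^sup>2 * (real k + 1) powr (-s)"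
  have "summable ?f" using hnorm_Hs_sums(1)[OF h] by (simp add: sums_iff)
  then obtain N where N: "norm (\<Sum>i. ?f (i + N)) < \<epsilon>\<^sup>2"
    using suminf_exist_split[of "\<epsilon>\<^sup>2" ?f] \<epsilon> by auto
  let ?w = "op_adj (Hs s) (Hs t) (mon_op s 0) (g N)"
  have w: "?w \<in> hcarrier (Hs s)" by (rule HsHt.op_adj_in[OF mon_op_bop[OF st] gV])
  have "taylor_coeff (h - ?w) k = (if k < N then 0 else taylor_coeff h k)" for k
    unfolding Hs_diff(2)[OF h w] taylor_coeff_adj_inclusion[OF st gV] gc by (simp add: a_def)
  then have "(\<lambda>k. (cmod (if k < N then 0 else taylor_coeff h k))\<^sup>2 * (real k + 1) powr (-s)) sums (hnorm (Hs s) (h - ?w))\<^sup>2"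
    using hnorm_Hs_sums(1)[OF Hs.diff_in[OF h w]] by simp
  then have "(\<lambda>k. ?f (k + N)) sums (hnorm (Hs s) (h - ?w))\<^sup>2"
    using sums_iff_shift[of "\<lambda>k. (cmod (if k < N then 0 else taylor_coeff h k))\<^sup>2 * (real k + 1) powr (-s)" N]
    by simp
  then have "(hnorm (Hs s) (h - ?w))\<^sup>2 < \<epsilon>\<^sup>2" using N by (simp add: sums_iff)
  then have "hnorm (Hs s) (h - ?w) < \<epsilon>" by (rule power_less_imp_less_base) (use \<epsilon> in simp)
  then show ?thesis using gD by blast
qed

lemma Mult_TRO_rigid:
  assumes lin: "linear_map_on (Mult_TRO s t) (bounded_ops (Hs s) (Hs t)) \<psi>"
    and cc: "cb_norm (Hs s) (Hs t) (Mult_TRO s t) (Hs s) (Hs t) \<psi> \<le> 1"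
    and fixed: "\<And>x. x \<in> Mult_ops s t \<Longrightarrow> \<psi> x = x"
    and x: "x \<in> Mult_TRO s t"
  shows "\<psi> x = x"
proof -
  interpret cc_TRO_map "Hs s" "Hs t" "Mult_TRO s t" \<psi>
    by unfold_locales (use TRO_Mult_TRO lin cc in simp_all)
  define e where "e = zpow 0"
  have e: "e \<in> hcarrier (Hs s)" "hnorm (Hs s) e = 1" by (simp_all add: e_def)
  \<comment> \<open>The vectors for which the hypotheses of \<open>\<psi>_identity\<close> hold.
    They form a subspace, so it is enough to find the monomials in it.\<close>
  define D where "D = {f \<in> hcarrier (Hs t). rank_one (Hs s) f e \<in> Mult_TRO s t \<and> \<psi> (rank_one (Hs s) f e) e = f}"
  have D_sub: "csubspace D"
  proof (rule complex_space.subspaceI)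
    show "0 \<in> D" unfolding D_def using zero_T by (simp add: Hs.zero_in)
    show "f + g \<in> D" if "f \<in> D" "g \<in> D" for f g
      using that add_T[of "rank_one (Hs s) f e" "rank_one (Hs s) g e"] Hs.add_in[of f t g]
      by (simp add: D_def rank_one_add \<psi>_add)
    show "c *\<^sub>C f \<in> D" if "f \<in> D" for c f
    proof -
      have "(c *\<^sub>C \<psi> (rank_one (Hs s) f e)) e = c *\<^sub>C f"
        using that by (simp add: D_def scaleC_fun_def)
      then show ?thesis
        using that scale_T[of "rank_one (Hs s) f e" c] Hs.scale_in[of f t c]
        by (simp add: D_def rank_one_scale \<psi>_scale)
    qed
  qed
  have fix_mon: "\<psi> (mon_op s i) = mon_op s i" for i
    by (rule fixed[OF mon_op_Mult_ops[OF st]])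
  have zpow_D: "zpow i \<in> D" for i
  proof -
    define \<kappa> where "\<kappa> = 2 powr (s - t)"
    have \<kappa>: "0 < \<kappa>" "\<kappa> < 1" using st powr_less_mono[of "s - t" 0 2] by (simp_all add: \<kappa>_def)
    define C where "C = (real i + 1) powr \<bar>s\<bar>"
    have C: "C > 0" by (simp add: C_def)
    \<comment> \<open>On the complement of the constants the inclusion contributes at most \<kappa>
      and \<open>b\<close> at most \<open>(1 - \<kappa>) / 2\<close>. The sum
      \<open>(1 + \<kappa>) / 2\<close> is below 1, the contribution of the inclusion at
      \<open>e\<close>.\<close>
    define \<eta> where "\<eta> = sqrt ((1 - \<kappa>) / (2 * C))"
    have \<eta>: "\<eta> > 0" "\<eta>\<^sup>2 * C = (1 - \<kappa>) / 2" using \<kappa> C by (simp_all add: \<eta>_def)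
    define b where "b = of_real \<eta> *\<^sub>C mon_op s i"
    have be: "b e = of_real \<eta> *\<^sub>C zpow i" by (simp add: b_def e_def scaleC_fun_def)
    have ae: "mon_op s 0 e = zpow 0" by (simp add: e_def)
    have "\<psi> (rank_one (Hs s) (b e) e) e = b e"
    proof (rule \<psi>_top_singular_vector(2)[of e "mon_op s 0" b "(1 + \<kappa>) / 2"])
      show "b \<in> Mult_TRO s t" unfolding b_def by (rule scale_T[OF mon_op_TRO[OF st]])
      show "\<psi> b = b" unfolding b_def \<psi>_scale[OF mon_op_TRO[OF st]] fix_mon ..
      show "rank_one (Hs s) (mon_op s 0 e) e \<in> Mult_TRO s t"
        unfolding ae unfolding e_def by (rule rank_one_zpow_TRO[OF st])
      show "rank_one (Hs s) (b e) e \<in> Mult_TRO s t"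
        unfolding be rank_one_scale unfolding e_def by (rule scale_T[OF rank_one_zpow_TRO[OF st]])
      have "(hnorm (Hs t) (mon_op s 0 e))\<^sup>2 = 1" unfolding ae by simp
      moreover have "(hnorm (Hs t) (b e))\<^sup>2 \<ge> 0" by simp
      ultimately show "(1 + \<kappa>) / 2 < (hnorm (Hs t) (mon_op s 0 e))\<^sup>2 + (hnorm (Hs t) (b e))\<^sup>2"
        using \<kappa> by argo
      fix v assume v: "v \<in> hcarrier (Hs s)" "hinner (Hs s) v e = 0"
      then have v0: "taylor_coeff v 0 = 0" by (simp add: e_def hinner_zpow)
      have V: "mon_op s j v \<in> hcarrier (Hs t)" for j by (rule bop_in[OF mon_op_bop[OF st] v(1)])
      have bv: "b v = of_real \<eta> *\<^sub>C mon_op s i v" by (simp add: b_def scaleC_fun_def)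
      have "hinner (Hs t) (mon_op s 0 v) (mon_op s 0 e) = 0"
        unfolding ae using v0 by (simp add: hinner_zpow[OF V] taylor_coeff_mon_op[OF v(1)])
      moreover have "hinner (Hs t) (b v) (b e) = 0"
        unfolding bv be Hs.ip_scale_left[OF V Hs.scale_in[OF zpow_Hs]] Hs.ip_scale_right[OF V zpow_Hs]
        using v0 by (simp add: hinner_zpow[OF V] taylor_coeff_mon_op[OF v(1)])
      moreover have "(hnorm (Hs t) (mon_op s 0 v))\<^sup>2 + (hnorm (Hs t) (b v))\<^sup>2 \<le> (1 + \<kappa>) / 2 * (hnorm (Hs s) v)\<^sup>2"
      proof -
        have "(hnorm (Hs t) (b v))\<^sup>2 = \<eta>\<^sup>2 * (hnorm (Hs t) (mon_op s i v))\<^sup>2"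
          unfolding bv Hs.nrm_scale[OF V] by (simp add: power_mult_distrib)
        also have "\<dots> \<le> \<eta>\<^sup>2 * (C * (hnorm (Hs s) v)\<^sup>2)"
          unfolding C_def by (intro mult_left_mono hnorm_mon_op_le[OF st v(1)]) simp
        also have "\<dots> = (1 - \<kappa>) / 2 * (hnorm (Hs s) v)\<^sup>2" unfolding \<eta>(2)[symmetric] by (simp only: mult.assoc)
        finally have "(hnorm (Hs t) (mon_op s 0 v))\<^sup>2 + (hnorm (Hs t) (b v))\<^sup>2
            \<le> \<kappa> * (hnorm (Hs s) v)\<^sup>2 + (1 - \<kappa>) / 2 * (hnorm (Hs s) v)\<^sup>2"
          using hnorm_inclusion_gap[OF st v(1) v0] unfolding \<kappa>_def[symmetric] by linarith
        also have "\<dots> = (1 + \<kappa>) / 2 * (hnorm (Hs s) v)\<^sup>2" by (simp add: field_simps)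
        finally show ?thesis .
      qed
      ultimately show "hinner (Hs t) (mon_op s 0 v) (mon_op s 0 e) = 0 \<and> hinner (Hs t) (b v) (b e) = 0 \<and>
        (hnorm (Hs t) (mon_op s 0 v))\<^sup>2 + (hnorm (Hs t) (b v))\<^sup>2 \<le> (1 + \<kappa>) / 2 * (hnorm (Hs s) v)\<^sup>2"
        by blast
    qed (use e \<kappa> fix_mon mon_op_TRO[OF st] in simp_all)
    moreover have "rank_one (Hs s) (b e) e \<in> Mult_TRO s t"
      unfolding be rank_one_scale unfolding e_def by (rule scale_T[OF rank_one_zpow_TRO[OF st]])
    moreover have "b e \<in> hcarrier (Hs t)" unfolding be by (rule Hs.scale_in[OF zpow_Hs])
    ultimately have "b e \<in> D" by (simp add: D_def)
    then have "of_real (1 / \<eta>) *\<^sub>C b e \<in> D" by (rule complex_space.subspace_scale[OF D_sub])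
    then show ?thesis unfolding be using \<eta>(1) by (simp add: scaleC_scaleC scaleC_one)
  qed
  have D_V: "D \<subseteq> hcarrier (Hs t)" by (auto simp: D_def)
  show ?thesis
  proof (rule \<psi>_identity[OF e D_sub D_V])
    show "v = 0" if "v \<in> hcarrier (Hs t)" "\<And>f. f \<in> D \<Longrightarrow> hinner (Hs t) v f = 0" for v
      by (rule Hs_zero_iff[OF that(1) that(2)[OF zpow_D]])
    show "rank_one (Hs s) f e \<in> Mult_TRO s t" "\<psi> (rank_one (Hs s) f e) e = f" if "f \<in> D" for f
      using that by (simp_all add: D_def)
    show "\<exists>g\<in>D. hnorm (Hs s) (h - op_adj (Hs s) (Hs t) (mon_op s 0) g) < \<epsilon>"
      if "h \<in> hcarrier (Hs s)" "\<epsilon> > 0" for h \<epsilon>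
      by (rule adj_inclusion_dense[OF that D_sub D_V zpow_D])
  qed (use x fix_mon mon_op_TRO[OF st] in simp_all)
qed

lemma inclusion_inj:
  assumes "f \<in> hcarrier (Hs s)" "mon_op s 0 f = 0"
  shows "f = 0"
  by (rule Hs_eqI[OF assms(1) Hs.zero_in]) (use taylor_coeff_mon_op[OF assms(1), of 0] assms(2) in simp)

text \<open>Against monomials the adjoint of \<open>q\<close> acts as the scalar
  \<open>cnj c\<close>. Monomials separate vectors, so the adjoint is that scalar everywhere, and
  hence \<open>q\<close> is \<open>c\<close>.\<close>

lemma bop_eq_scale:
  assumes q: "q \<in> bounded_ops (Hs t) (Hs t)" and eq: "\<And>i. q (zpow i) = c *\<^sub>C zpow i" and f: "f \<in> hcarrier (Hs t)"
  shows "q f = c *\<^sub>C f"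
proof -
  let ?r = "op_adj (Hs t) (Hs t) q"
  have r: "?r k \<in> hcarrier (Hs t)" if "k \<in> hcarrier (Hs t)" for k by (rule HsHt.op_adj_in[OF q that])
  have adj: "?r k = cnj c *\<^sub>C k" if k: "k \<in> hcarrier (Hs t)" for k
  proof -
    have "hinner (Hs t) (?r k - cnj c *\<^sub>C k) (zpow i) = 0" for i
    proof -
      have "hinner (Hs t) (zpow i) (?r k) = c * hinner (Hs t) (zpow i) k"
        unfolding HsHt.ip_op_adj[OF q k zpow_Hs] eq Hs.ip_scale_left[OF zpow_Hs k] ..
      then have "hinner (Hs t) (?r k) (zpow i) = cnj c * hinner (Hs t) k (zpow i)"
        unfolding Hs.ip_commute[OF zpow_Hs r[OF k]] Hs.ip_commute[OF zpow_Hs k] by simp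
      then show ?thesis
        unfolding Hs.ip_diff_left[OF r[OF k] Hs.scale_in[OF k] zpow_Hs] Hs.ip_scale_left[OF k zpow_Hs] by simp
    qed
    then have "?r k - cnj c *\<^sub>C k = 0"
      by (rule Hs_zero_iff[OF Hs.diff_in[OF r[OF k] Hs.scale_in[OF k]]])
    then show ?thesis by simp
  qed
  show ?thesis
  proof (rule Hs.ip_eqI[OF bop_in[OF q f] Hs.scale_in[OF f]])
    fix h assume h: "h \<in> hcarrier (Hs t)"
    have "hinner (Hs t) (q f) h = hinner (Hs t) f (?r h)" using HsHt.ip_op_adj[OF q h f] by simp
    also have "\<dots> = hinner (Hs t) (c *\<^sub>C f) h"
      unfolding adj[OF h] Hs.ip_scale_right[OF f h] Hs.ip_scale_left[OF f h] by simp
    finally show "hinner (Hs t) h (q f) = hinner (Hs t) h (c *\<^sub>C f)"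
      unfolding Hs.ip_commute[OF bop_in[OF q f] h] Hs.ip_commute[OF Hs.scale_in[OF f] h] by simp
  qed
qed

text \<open>Commuting with the operators \<open>rank_one (Hs s) (zpow i) (zpow 0)\<close> makes
  \<open>q\<close> a scalar \<open>c\<close>; commuting with the injective inclusion makes
  \<open>p\<close> the same scalar, and an idempotent scalar is 0 or 1.\<close>

lemma Mult_TRO_irreducible:
  assumes "\<And>x. x \<in> Mult_TRO s t \<Longrightarrow> \<psi> x = x"
  shows "irreducible_map (Mult_TRO s t) (Hs s) (Hs t) \<psi>"
  unfolding irreducible_map_def
proof (intro ballI impI)
  fix p q assume p: "p \<in> projections (Hs s)" and q: "q \<in> projections (Hs t)"
    and comm: "\<forall>x\<in>Mult_TRO s t. q \<circ> \<psi> x = \<psi> x \<circ> p"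
  have pB: "p \<in> bounded_ops (Hs s) (Hs s)" and qB: "q \<in> bounded_ops (Hs t) (Hs t)" and qq: "q \<circ> q = q"
    using p q by (simp_all add: projections_def)
  have comm': "q (x f) = x (p f)" if "x \<in> Mult_TRO s t" for x f
    using fun_cong[OF comm[rule_format, OF that], of f] assms[OF that] by simp
  have pz: "p (zpow 0) \<in> hcarrier (Hs s)" by (rule bop_in[OF pB zpow_Hs])
  \<comment> \<open>The inner product of \<open>p (zpow 0)\<close> with \<open>zpow 0\<close>, since
    the weight at index 0 is 1.\<close>
  define c where "c = taylor_coeff (p (zpow 0)) 0"
  have "q (zpow i) = c *\<^sub>C zpow i" for i
  proof -
    have "rank_one (Hs s) (zpow i) (zpow 0) (zpow 0) = zpow i"
      by (simp add: Hs.ip_self[OF zpow_Hs] scaleC_one)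
    then have "q (zpow i) = rank_one (Hs s) (zpow i) (zpow 0) (p (zpow 0))"
      using comm'[OF rank_one_zpow_TRO[OF st], of i "zpow 0"] by simp
    also have "\<dots> = c *\<^sub>C zpow i" using pz by (simp add: hinner_zpow c_def)
    finally show ?thesis .
  qed
  then have q_eq: "q f = c *\<^sub>C f" if "f \<in> hcarrier (Hs t)" for f
    by (rule bop_eq_scale[OF qB _ that])
  have pJ: "mon_op s 0 (p f - c *\<^sub>C f) = 0" if f: "f \<in> hcarrier (Hs s)" for f
  proof -
    have "mon_op s 0 (p f) = c *\<^sub>C mon_op s 0 f"
      using comm'[OF mon_op_TRO[OF st], of 0 f] q_eq[OF bop_in[OF mon_op_bop[OF st] f]] by simp
    then show ?thesis
      unfolding HsHt.bop_diff[OF mon_op_bop[OF st] bop_in[OF pB f] Hs.scale_in[OF f]] bop_scale[OF mon_op_bop[OF st] f]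
      by simp
  qed
  have p_eq: "p f = c *\<^sub>C f" if f: "f \<in> hcarrier (Hs s)" for f
    using inclusion_inj[OF Hs.diff_in[OF bop_in[OF pB f] Hs.scale_in[OF f]] pJ[OF f]] by simp
  have "c *\<^sub>C c *\<^sub>C zpow 0 = c *\<^sub>C zpow 0"
    using fun_cong[OF qq, of "zpow 0"] q_eq[OF zpow_Hs[of 0]] q_eq[OF Hs.scale_in[OF zpow_Hs[of 0], of c]] by simp
  then have "c * c = c" by (auto simp: fun_eq_iff scaleC_fun_def scaleC_complex_def zpow_def dest: spec[of _ 0])
  then have "c = 0 \<or> c = 1" by simp
  then show "p = op_id (Hs s) \<and> q = op_id (Hs t) \<or> p = 0 \<and> q = 0"
  proof
    assume "c = 0"
    then have "p f = 0" "q g = 0" for f g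
      using p_eq[of f] bop_outside[OF pB, of f] q_eq[of g] bop_outside[OF qB, of g] by force+
    then show ?thesis by (simp add: fun_eq_iff)
  next
    assume "c = 1"
    then have "p f = op_id (Hs s) f" "q g = op_id (Hs t) g" for f g
      using p_eq[of f] bop_outside[OF pB, of f] q_eq[of g] bop_outside[OF qB, of g]
      by (simp_all add: op_id_def scaleC_one)
    then show ?thesis by (simp add: fun_eq_iff)
  qed
qed

text \<open>Injectivity of the inclusion gives \<open>p = 0\<close>; every monomial is the image of
  1 under a multiplier, so \<open>q\<close> kills all monomials and is 0.\<close>

lemma Mult_ops_nondegenerate: "nondegenerate_map (Mult_ops s t) (Hs s) (Hs t) (\<lambda>x. x)"
  unfolding nondegenerate_map_def
proof (intro ballI impI)
  fix p q assume p: "p \<in> projections (Hs s)" and q: "q \<in> projections (Hs t)"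
    and zero: "\<forall>x\<in>Mult_ops s t. q \<circ> x = 0 \<and> x \<circ> p = 0"
  have pB: "p \<in> bounded_ops (Hs s) (Hs s)" and qB: "q \<in> bounded_ops (Hs t) (Hs t)"
    using p q by (simp_all add: projections_def)
  note zero_mon = bspec[OF zero mon_op_Mult_ops[OF st]]
  have zero': "q (mon_op s i f) = 0" "mon_op s i (p f) = 0" for i f
    using fun_cong[OF conjunct1[OF zero_mon[of i]], of f] fun_cong[OF conjunct2[OF zero_mon[of i]], of f]
    by simp_all
  have "p f = 0" for f
    using inclusion_inj[OF bop_in[OF pB] zero'(2)] bop_outside[OF pB, of f] by blast
  moreover have "q f = 0" for f
  proof (cases "f \<in> hcarrier (Hs t)")
    case True
    have "q (zpow i) = 0 *\<^sub>C zpow i" for i using zero'(1)[of i "zpow 0"] by simp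
    then have "q f = 0 *\<^sub>C f" by (rule bop_eq_scale[OF qB _ True])
    then show ?thesis by simp
  qed (rule bop_outside[OF qB])
  ultimately show "p = 0 \<and> q = 0" by (simp add: fun_eq_iff)
qed

lemma Mult_ops_rectangular_operator_state:
  "rectangular_operator_state (Hs s) (Hs t) (Mult_ops s t) (Hs s) (Hs t) (\<lambda>x. x)"
proof -
  have "cb_norm (Hs s) (Hs t) (Mult_ops s t) (Hs s) (Hs t) (\<lambda>x. x) = 1"
    by (rule HsHt.cb_norm_identity[OF Mult_ops_bounded mon_op_Mult_ops[OF st, of 0] _ zpow_Hs[of 0]])
      (simp_all add: hnorm_inclusion_le[OF st])
  moreover have "linear_map_on (Mult_ops s t) (bounded_ops (Hs s) (Hs t)) (\<lambda>x. x)"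
    using Mult_ops_bounded by (auto simp: linear_map_on_def)
  ultimately show ?thesis
    unfolding rectangular_operator_state_def operator_space_def
    by (intro conjI hilbert_space_Hs Mult_ops_subspace Mult_ops_bounded Mult_ops_nondegenerate)
qed

end

theorem corollary2p20:
  fixes s t :: real
  assumes "s < t"
  shows "identity_is_boundary_representation (Hs s) (Hs t) (Mult_ops s t)"
  unfolding identity_is_boundary_representation_def
proof (intro conjI allI impI)
  show "rectangular_operator_state (Hs s) (Hs t) (Mult_ops s t) (Hs s) (Hs t) (\<lambda>x. x)"
    by (rule Mult_ops_rectangular_operator_state[OF assms])
  fix \<psi>
  assume "rectangular_operator_state (Hs s) (Hs t) (Mult_TRO s t) (Hs s) (Hs t) \<psi> \<and> (\<forall>x\<in>Mult_ops s t. \<psi> x = x)"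
  then have lin: "linear_map_on (Mult_TRO s t) (bounded_ops (Hs s) (Hs t)) \<psi>"
    and cb: "cb_norm (Hs s) (Hs t) (Mult_TRO s t) (Hs s) (Hs t) \<psi> = 1"
    and fixed: "\<And>x. x \<in> Mult_ops s t \<Longrightarrow> \<psi> x = x"
    by (simp_all add: rectangular_operator_state_def)
  \<comment> \<open>Every admissible extension is the identity on the generated TRO, so both
    conclusions concern the inclusion itself.\<close>
  have id: "\<psi> x = x" if "x \<in> Mult_TRO s t" for x
    by (rule Mult_TRO_rigid[OF assms lin _ fixed that]) (simp add: cb)
  then show "irreducible_map (Mult_TRO s t) (Hs s) (Hs t) \<psi>"
    by (rule Mult_TRO_irreducible[OF assms])
  show "TRO_representation (Hs s) (Hs t) (Mult_TRO s t) (Hs s) (Hs t) \<psi>"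
    unfolding TRO_representation_def
    by (intro conjI ballI TRO_Mult_TRO hilbert_space_Hs lin) (simp add: id TRO_ternary[OF TRO_Mult_TRO])
qed

end
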